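(* Let $|q|<1$ and let $k\ge 2$ be an integer. Then for each $i=1,\dots,k$, \[ \sum_{r^{(1)},\dots,r^{(k-1)}\in\mathbb Z^2} \frac{q^{\frac12\sum_{j=1}^{k-1}r^{(j)}Cr^{(j)}+\sum_{j=i}^{k-1}|r^{(j)}|}\,(1-q^{|r^{(i-1)}|+1})} {(q)_{r^{(1)}-r^{(2)}}\cdots(q)_{r^{(k-2)}-r^{(k-1)}}(q)_{r^{(k-1)}}(q)_{|r^{(k-1)}|+1}} =\frac{(q^i,q^i,q^{2i},q^{3k-2i+1},q^{3k-i+1},q^{3k-i+1},q^{3k+1},q^{3k+1};q^{3k+1})_\infty}{(q)_\infty^3}, \] where for $i=1$ the factor $(1-q^{|r^{(0)}|+1})$ is interpreted as $1$. Moreover, for $\sigma\in\{0,1\}$, \[ \sum_{r^{(1)},\dots,r^{(k-1)}\in\mathbb Z^2} \frac{q^{\sum_{j=1}^{k-1}(\frac12 r^{(j)}Cr^{(j)}+r^{(j)}_1)+\sigma r^{(k-1)}_2}} {(q)_{r^{(1)}-r^{(2)}}\cdots(q)_{r^{(k-2)}-r^{(k-1)}}(q)_{r^{(k-1)}}(q)_{|r^{(k-1)}|+1}} =\frac{(q,q^{k-\sigma},q^{k+1-\sigma},q^{2k+\sigma},q^{2k+1+\sigma},q^{3k},q^{3k+1},q^{3k+1};q^{3k+1})_\infty}{(q)_\infty^3}. \]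
   Context: $(x;q)_n=\prod_{j=0}^{n-1}(1-xq^j)$ for $n\ge0$, $(x;q)_\infty=\prod_{j\ge0}(1-xq^j)$, $(x_1,\dots,x_m;q)_\infty=\prod_{l}(x_l;q)_\infty$, and $(q)_n=(q;q)_n$ with the convention $1/(q)_n=0$ for $n<0$. For $v=(v_1,v_2)\in\mathbb Z^2$: $|v|=v_1+v_2$, $(q)_v=(q)_{v_1}(q)_{v_2}$, and $vCv=\sum_{i,j=1}^2 v_iC_{ij}v_j$ where $C=\begin{pmatrix}2&-1\\-1&2\end{pmatrix}$ is the A$_2$ Cartan matrix, so $\frac12 vCv=v_1^2-v_1v_2+v_2^2$. Differences $r^{(j)}-r^{(j+1)}$ are componentwise. When $k=2$ the chain $(q)_{r^{(1)}-r^{(2)}}\cdots(q)_{r^{(k-2)}-r^{(k-1)}}$ is empty. *)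

theory Defs
  imports "HOL-Analysis.Analysis"
begin

definition qpoch_inf :: "complex \<Rightarrow> complex \<Rightarrow> complex" where
  "qpoch_inf x p = prodinf (\<lambda>j::nat. 1 - x * p ^ j)"

definition inv_qfac :: "complex \<Rightarrow> int \<Rightarrow> complex" where
  "inv_qfac q n = (if n < 0 then 0 else 1 / (\<Prod>j<nat n. (1 - q ^ (j + 1))))"

definition inv_qfac2 :: "complex \<Rightarrow> int \<times> int \<Rightarrow> complex" where
  "inv_qfac2 q v = inv_qfac q (fst v) * inv_qfac q (snd v)"

definition vabs :: "int \<times> int \<Rightarrow> int" where
  "vabs v = fst v + snd v"

text \<open>(1/2) v C v = v1^2 - v1 v2 + v2^2 for the A2 Cartan matrix C.\<close>
definition halfvCv :: "int \<times> int \<Rightarrow> int" where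
  "halfvCv v = (fst v)^2 - fst v * snd v + (snd v)^2"

definition vdiff :: "int \<times> int \<Rightarrow> int \<times> int \<Rightarrow> int \<times> int" where
  "vdiff u v = (fst u - fst v, snd u - snd v)"

text \<open>Tuples (r^(1),...,r^(k-1)) in (Z^2)^(k-1), encoded as functions
  nat \<Rightarrow> Z^2 that vanish outside {1..k-1}.\<close>
definition tuples :: "nat \<Rightarrow> (nat \<Rightarrow> int \<times> int) set" where
  "tuples k = {r. \<forall>j. j \<notin> {1..k-1} \<longrightarrow> r j = (0, 0)}"

definition denom_inv :: "complex \<Rightarrow> nat \<Rightarrow> (nat \<Rightarrow> int \<times> int) \<Rightarrow> complex" where
  "denom_inv q k r =
     (\<Prod>j\<in>{1..k-2}. inv_qfac2 q (vdiff (r j) (r (j+1))))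
     * inv_qfac2 q (r (k-1)) * inv_qfac q (vabs (r (k-1)) + 1)"

definition term1 :: "complex \<Rightarrow> nat \<Rightarrow> nat \<Rightarrow> (nat \<Rightarrow> int \<times> int) \<Rightarrow> complex" where
  "term1 q k i r =
     q powi ((\<Sum>j\<in>{1..k-1}. halfvCv (r j)) + (\<Sum>j\<in>{i..k-1}. vabs (r j)))
     * (if i = 1 then 1 else 1 - q powi (vabs (r (i-1)) + 1))
     * denom_inv q k r"

definition term2 :: "complex \<Rightarrow> nat \<Rightarrow> nat \<Rightarrow> (nat \<Rightarrow> int \<times> int) \<Rightarrow> complex" where
  "term2 q k \<sigma> r =
     q powi ((\<Sum>j\<in>{1..k-1}. halfvCv (r j) + fst (r j)) + int \<sigma> * snd (r (k-1)))
     * denom_inv q k r"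

end

theory Submission
  imports Defs
begin

text \<open>
  Let \<open>Phi\<close> denote the functions \<open>(q)\<^bsub>r1+r2+t\<^esub> / \<Prod>\<^sub>i (q)\<^bsub>r1-a\<^sub>i\<^esub> (q)\<^bsub>r2+t+a\<^sub>i\<^esub>\<close>. Up to a
  power of \<open>q\<close> they are fixed by the summation over one of the vectors \<open>r\<^sup>(\<^sup>j\<^sup>)\<close> (the A2 Bailey
  lemma of Andrews, Schilling and Warnaar): one \<open>q\<close>-Vandermonde sum decouples the two components,
  each of which is then summed by a Durfee rectangle identity, and a second \<open>q\<close>-Vandermonde sum
  reassembles the product. So it suffices to expand the innermost factor
  \<open>1 / ((q)\<^sub>r (q)\<^bsub>|r|+1\<^esub>)\<close> in the \<open>Phi\<close>, which for suitable \<open>t\<close> also takes care of the linear terms in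
  the exponent. The coefficients are those of the A2 Macdonald product, and the expansion is
  a constant term identity that follows from the antisymmetry and the quasi-periodicity of that product.
  The factor \<open>1 - q\<^bsup>|r|+1\<^esup>\<close> is absorbed by a 3 by 3 determinant that turns the functions with
  \<open>t = 2\<close> into alternating sums of those with \<open>t = 0\<close>. Letting the outermost bound tend to infinity
  leaves a theta series on the A2 root lattice, which the Macdonald identity factors.
\<close>

section \<open>The diagonal form of the A2 Bailey transformation\<close>

text \<open>The Bailey transformation acts on every \<open>Phi\<close> separately: summing over one
  vector only multiplies it by a power of \<open>q\<close>, provided that the linear part of the
  weight is \<open>- (s + t) * fst r + (2 * t + s) * snd r\<close>, where \<open>s\<close> is the
  sum of the three parameters. Matching this with the linear terms that occur fixes
  \<open>(t, s)\<close>: it is \<open>(0, 0)\<close> for no linear term, \<open>(2, - 3)\<close> for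
  \<open>fst r + snd r\<close> and \<open>(1, - 2)\<close> for \<open>fst r\<close>. The first
  family has both kinds of vectors and must therefore change from \<open>t = 2\<close> to
  \<open>t = 0\<close> in the middle of the chain. The obstacle is that for \<open>t = 2\<close> the
  functions used are symmetric under permutations of the lattice coordinates, so that against
  antisymmetric coefficients their sum would cancel. A Vandermonde determinant in the powers
  \<open>Q (- v)\<close> restores antisymmetry. The same determinant appears when the functions with
  \<open>t = 0\<close> are antisymmetrised, and the constant released on the way is exactly
  \<open>1 - q ^ (|r| + 1)\<close>, the factor in the numerator of the first family.\<close>

locale qbase =
  fixes q :: complex
  assumes q_nz [simp]: "q \<noteq> 0" and q_lt1: "norm q < 1"
begin

abbreviation I :: "int \<Rightarrow> complex" where "I \<equiv> inv_qfac q"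
abbreviation Q :: "int \<Rightarrow> complex" where "Q n \<equiv> q powi n"

lemma Q_add: "Q (m + n) = Q m * Q n"
  by (simp add: power_int_add)

lemma Q_diff: "Q (m - n) = Q m / Q n"
  by (simp add: power_int_diff)

lemma Q_inj: "Q n = 1 \<longleftrightarrow> n = 0"
proof -
  have nat1: "q ^ m \<noteq> 1" if "m > 0" for m
  proof
    assume "q ^ m = 1"
    then have "norm q ^ m = 1" by (metis norm_one norm_power)
    moreover have "norm q ^ m < 1" using that q_lt1 by (simp add: power_less_one_iff)
    ultimately show False by simp
  qed
  show ?thesis
  proof
    assume *: "Q n = 1"
    show "n = 0"
    proof (rule ccontr)
      assume "n \<noteq> 0"
      then consider "n > 0" | "n < 0" by linarith
      then show False
      proof cases
        case 1
        then show False using * nat1[of "nat n"] by (simp add: power_int_def)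
      next
        case 2
        then have "q ^ nat (- n) = 1"
          using * by (simp add: power_int_def power_inverse)
        then show False using nat1[of "nat (- n)"] 2 by simp
      qed
    qed
  qed simp
qed

lemma norm_Q_le: "m \<le> n \<Longrightarrow> norm (Q n) \<le> norm (Q m)"
  using q_nz q_lt1 by (simp add: norm_power_int power_int_decreasing)

section \<open>Reciprocal q-factorials with integer index\<close>

lemma I_neg: "n < 0 \<Longrightarrow> I n = 0"
  by (simp add: inv_qfac_def)

lemma I_0 [simp]: "I 0 = 1"
  by (simp add: inv_qfac_def)

lemma I_nz: "n \<ge> 0 \<Longrightarrow> I n \<noteq> 0"
proof -
  assume "n \<ge> 0"
  have "1 - q ^ (j + 1) \<noteq> 0" for j
    using Q_inj[of "int j + 1"] by (simp add: power_int_def nat_add_distrib)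
  then show ?thesis using \<open>n \<ge> 0\<close> by (simp add: inv_qfac_def)
qed

lemma I_pred: "I (n - 1) = (1 - Q n) * I n"
proof (cases "n \<le> 0")
  case True
  then show ?thesis by (cases "n = 0") (auto simp: inv_qfac_def)
next
  case False
  define m where "m = nat (n - 1)"
  have n: "n = int m + 1" using False by (simp add: m_def)
  have nz: "1 - q ^ Suc j \<noteq> 0" for j
    using Q_inj[of "int j + 1"] by (simp add: power_int_def nat_add_distrib)
  have "Q n = q ^ Suc m" by (simp add: n power_int_def nat_add_distrib)
  moreover have "nat n = Suc m" by (simp add: n)
  ultimately show ?thesis using nz[of m] False
    by (simp add: inv_qfac_def m_def[symmetric])
qed

lemma I_rec: "I n = (1 - Q (n + 1)) * I (n + 1)"
  using I_pred[of "n + 1"] by simp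

text \<open>\<open>e p = I (d - p)\<close> with \<open>D = Q d\<close> gives the \<open>q\<close>-Chu--Vandermonde sum, and \<open>e p = 1\<close>
  with \<open>D = 0\<close> its limit, the Durfee rectangle sum. In the proof, \<open>g\<close> is the telescoping
  certificate.\<close>

lemma vandermonde_general:
  fixes e :: "int \<Rightarrow> complex" and D :: complex
  assumes e: "\<And>p. e (p + 1) = (1 - D * Q (- p)) * e p"
    and J: "finite J" "{max a b..c} \<subseteq> J"
  shows "(\<Sum>p\<in>J. Q ((p - a) * (p - b)) * I (p - a) * I (p - b) * I (c - p) * e p)
           * e (a + b - c) = I (c - a) * I (c - b) * e a * e b"
proof -
  define m where "m = max a b"
  define t where "t c p = Q ((p - a) * (p - b)) * I (p - a) * I (p - b) * I (c - p) * e p" for c p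
  define S where "S c = (\<Sum>p\<in>{m..c}. t c p)" for c
  have t0: "t c p = 0" if "p \<notin> {m..c}" for c p
  proof -
    have "p - a < 0 \<or> p - b < 0 \<or> c - p < 0" using that by (auto simp: m_def)
    then show ?thesis by (auto simp: t_def I_neg)
  qed
  have SJ: "(\<Sum>p\<in>J. t c p) = S c"
    unfolding S_def using J t0 by (intro sum.mono_neutral_right) (auto simp: m_def)
  \<comment> \<open>A first order recurrence in \<open>c\<close> reduces everything to the value at
    \<open>c = m\<close>. For \<open>c > m\<close> both factors on the left are nonzero, so the
    induction can divide by them.\<close>
  have step: "(1 - Q (c - a)) * (1 - Q (c - b)) * S c = (1 - D * Q (c - a - b)) * S (c - 1)"
    if "c > m" for c
  proof -
    define g where "g p = - Q (c - p) * (1 - Q (p - a)) * (1 - Q (p - b)) * t c p" for p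
    have pt: "(1 - Q (c - a)) * (1 - Q (c - b)) * t c p - (1 - D * Q (c - a - b)) * t (c - 1) p
                = g (p + 1) - g p" for p
    proof -
      define P A B C where "P = Q p" and "A = Q a" and "B = Q b" and "C = Q c"
      have nz: "P \<noteq> 0" "A \<noteq> 0" "B \<noteq> 0" "C \<noteq> 0" by (auto simp: P_def A_def B_def C_def)
      have comm: "c - 1 - p = c - p - 1" by simp
      have "I (c - 1 - p) = (1 - C / P) * I (c - p)"
        unfolding comm I_pred by (simp add: Q_diff P_def C_def)
      then have tc: "t (c - 1) p = (1 - C / P) * t c p"
        by (simp only: t_def mult_ac)
      have "(p + 1 - a) * (p + 1 - b) = (p - a) * (p - b) + (2 * p + 1 - a - b)"
        by (simp add: algebra_simps)
      then have q1: "Q ((p + 1 - a) * (p + 1 - b))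
          = Q ((p - a) * (p - b)) * (P * P * q / (A * B))"
        unfolding P_def A_def B_def
        by (simp only: Q_add Q_diff mult_2) (simp add: field_simps)
      have i1: "I (p - a) = (1 - P * q / A) * I (p + 1 - a)"
        using I_rec[of "p - a"] by (simp add: Q_add Q_diff P_def A_def algebra_simps)
      have i2: "I (p - b) = (1 - P * q / B) * I (p + 1 - b)"
        using I_rec[of "p - b"] by (simp add: Q_add Q_diff P_def B_def algebra_simps)
      have i3: "I (c - (p + 1)) = (1 - C / P) * I (c - p)"
        using I_pred[of "c - p"] by (simp add: Q_diff P_def C_def algebra_simps)
      have e1: "e (p + 1) = (1 - D / P) * e p"
        unfolding e P_def by (simp add: power_int_minus divide_inverse)
      have g1: "g (p + 1) = - (C / (P * q)) * (P * P * q / (A * B)) * (1 - C / P) * (1 - D / P) * t c p"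
      proof -
        have "g (p + 1) = - (C / (P * q)) * (1 - P * q / A) * (1 - P * q / B) *
           (Q ((p - a) * (p - b)) * (P * P * q / (A * B)) * I (p + 1 - a) * I (p + 1 - b)
            * ((1 - C / P) * I (c - p)) * ((1 - D / P) * e p))"
          unfolding g_def t_def q1 i3 e1
          by (simp add: Q_add Q_diff P_def A_def B_def C_def algebra_simps)
        also have "\<dots> = - (C / (P * q)) * (P * P * q / (A * B)) * (1 - C / P) * (1 - D / P) *
           (Q ((p - a) * (p - b)) * ((1 - P * q / A) * I (p + 1 - a)) * ((1 - P * q / B) * I (p + 1 - b))
            * I (c - p) * e p)" by (simp only: mult_ac)
        finally show ?thesis unfolding t_def i1 i2 .
      qed
      have g0: "g p = - (C / P) * (1 - P / A) * (1 - P / B) * t c p"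
        unfolding g_def by (simp add: Q_diff P_def A_def B_def C_def)
      have key: "(1 - C / A) * (1 - C / B) - (1 - D * (C / A / B)) * (1 - C / P) =
         - (C / (P * q)) * (P * P * q / (A * B)) * (1 - C / P) * (1 - D / P)
         + (C / P) * (1 - P / A) * (1 - P / B)"
        using nz by (simp add: field_simps)
      have "(1 - Q (c - a)) * (1 - Q (c - b)) * t c p - (1 - D * Q (c - a - b)) * t (c - 1) p
         = ((1 - C / A) * (1 - C / B) - (1 - D * (C / A / B)) * (1 - C / P)) * t c p"
        unfolding tc by (simp only: Q_diff A_def B_def C_def P_def left_diff_distrib mult.assoc)
      also have "\<dots> = g (p + 1) - g p" unfolding key g1 g0 by (simp add: algebra_simps)
      finally show ?thesis .
    qed
    have S1: "S (c - 1) = (\<Sum>p\<in>{m..c}. t (c - 1) p)"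
      unfolding S_def using t0 by (intro sum.mono_neutral_left) auto
    have tele: "(\<Sum>p\<in>{m..c}. g (p + 1) - g p) = g (c + 1) - g m"
    proof -
      have "(\<Sum>p\<in>{m..m + int n}. g (p + 1) - g p) = g (m + int n + 1) - g m" for n
      proof (induction n)
        case (Suc n)
        have "{m..m + int (Suc n)} = insert (m + int n + 1) {m..m + int n}" by auto
        then show ?case using Suc by (simp add: algebra_simps)
      qed simp
      from this[of "nat (c - m)"] show ?thesis using that by simp
    qed
    \<comment> \<open>\<open>m\<close> is \<open>a\<close> or \<open>b\<close>, so one of the two
      factors \<open>1 - Q (m - a)\<close> and \<open>1 - Q (m - b)\<close> of the certificate is 0.
      At the upper end the summand vanishes, because \<open>I (c - p)\<close> has a negative
      index.\<close>
    have "g m = 0" by (auto simp: g_def m_def max_def)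
    moreover have "g (c + 1) = 0" using t0[of "c + 1" c] by (simp add: g_def)
    ultimately have "(\<Sum>p\<in>{m..c}. (1 - Q (c - a)) * (1 - Q (c - b)) * t c p
        - (1 - D * Q (c - a - b)) * t (c - 1) p) = 0"
      unfolding pt tele by simp
    then show ?thesis unfolding S1 by (simp add: S_def sum_subtractf sum_distrib_left)
  qed
  have main: "S (m + int n) * e (a + b - (m + int n)) = I (m + int n - a) * I (m + int n - b) * e a * e b" for n
  proof (induction n)
    case 0
    have "S m = t m m" by (simp add: S_def)
    then show ?case by (auto simp: t_def m_def max_def)
  next
    case (Suc n)
    define c where "c = m + int (Suc n)"
    have c: "c > m" "c - 1 = m + int n" by (auto simp: c_def)
    have nz: "1 - Q (c - a) \<noteq> 0" "1 - Q (c - b) \<noteq> 0"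
      using c(1) Q_inj[of "c - a"] Q_inj[of "c - b"] by (auto simp: m_def)
    have e1: "e (a + b - (c - 1)) = (1 - D * Q (c - a - b)) * e (a + b - c)"
      using e[of "a + b - c"] by (simp add: algebra_simps)
    have "(1 - Q (c - a)) * (1 - Q (c - b)) * (S c * e (a + b - c))
        = S (c - 1) * e (a + b - (c - 1))"
      using arg_cong[OF step[OF c(1)], of "\<lambda>x. x * e (a + b - c)"] unfolding e1 by (simp only: mult_ac)
    also have "\<dots> = I (c - 1 - a) * I (c - 1 - b) * e a * e b" using Suc c(2) by simp
    also have "\<dots> = (1 - Q (c - a)) * (1 - Q (c - b)) * (I (c - a) * I (c - b) * e a * e b)"
    proof -
      have "c - 1 - a = c - a - 1" "c - 1 - b = c - b - 1" by auto
      then show ?thesis by (simp only: I_pred mult_ac)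
    qed
    finally show ?case using nz unfolding c_def[symmetric] by simp
  qed
  have "S c * e (a + b - c) = I (c - a) * I (c - b) * e a * e b"
  proof (cases "c \<ge> m")
    case True
    then show ?thesis using main[of "nat (c - m)"] by simp
  next
    case False
    then have "S c = 0" "c - a < 0 \<or> c - b < 0" by (auto simp: S_def m_def)
    then show ?thesis by (auto simp: I_neg)
  qed
  then show ?thesis unfolding SJ[symmetric] t_def .
qed

lemma durfee_sum:
  assumes "finite J" "{max a b..c} \<subseteq> J"
  shows "(\<Sum>p\<in>J. Q ((p - a) * (p - b)) * I (p - a) * I (p - b) * I (c - p)) = I (c - a) * I (c - b)"
  using vandermonde_general[of "\<lambda>_. 1" 0 J a b c] assms by simp

text \<open>The product form can be divided by \<open>I (c + d - a - b)\<close> only if that is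
  nonzero. Otherwise \<open>c + d < a + b\<close>, the range of \<open>p\<close> is empty, and the
  right-hand side is 0 by the convention on division by 0.\<close>

lemma vandermonde_sum:
  assumes "finite J" "{max a b..min c d} \<subseteq> J"
  shows "(\<Sum>p\<in>J. Q ((p - a) * (p - b)) * I (p - a) * I (p - b) * I (c - p) * I (d - p))
           = I (c - a) * I (c - b) * I (d - a) * I (d - b) / I (c + d - a - b)"
    (is "(\<Sum>p\<in>J. ?t p) = _")
proof -
  have out: "?t p = 0" if "p \<notin> {max a b..min c d}" for p
  proof -
    have "p - a < 0 \<or> p - b < 0 \<or> c - p < 0 \<or> d - p < 0" using that by auto
    then show ?thesis by (auto simp: I_neg)
  qed
  show ?thesis
  proof (cases "c + d - a - b < 0")
    case True
    then have "?t p = 0" for p by (intro out) auto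
    then have "(\<Sum>p\<in>J. ?t p) = 0" by (rule sum.neutral[rule_format])
    then show ?thesis using True by (simp add: I_neg)
  next
    case False
    \<comment> \<open>The general form sums up to \<open>c\<close>. Here the additional factor
      \<open>I (d - p)\<close> already cuts the sum off at \<open>d\<close>, so the enlargement adds
      only zeros.\<close>
    define J' where "J' = J \<union> {max a b..c}"
    have rec: "I (d - (p + 1)) = (1 - Q d * Q (- p)) * I (d - p)" for p
      using I_pred[of "d - p"] by (simp add: Q_add[symmetric] algebra_simps)
    have "(\<Sum>p\<in>J'. ?t p) * I (d - (a + b - c)) = I (c - a) * I (c - b) * I (d - a) * I (d - b)"
      by (rule vandermonde_general[OF rec]) (use assms in \<open>auto simp: J'_def\<close>)
    moreover have "(\<Sum>p\<in>J'. ?t p) = (\<Sum>p\<in>J. ?t p)"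
    proof (rule sum.mono_neutral_right)
      show "\<forall>p\<in>J' - J. ?t p = 0" using assms(2) out by blast
    qed (use assms in \<open>auto simp: J'_def\<close>)
    moreover have "I (c + d - a - b) \<noteq> 0" using False by (intro I_nz) simp
    moreover have "d - (a + b - c) = c + d - a - b" by simp
    ultimately show ?thesis by (simp add: field_simps)
  qed
qed

text \<open>The reflection of \<open>p\<close> exchanges the pairs \<open>(a, b)\<close> and
  \<open>(c, d)\<close>. Two different weights with the same value are what permits expanding a
  product with one of them and reassembling it with the other.\<close>

lemma vandermonde_sum':
  assumes "finite J" "{max a b..min c d} \<subseteq> J"
  shows "(\<Sum>p\<in>J. Q ((c - p) * (d - p)) * I (p - a) * I (p - b) * I (c - p) * I (d - p))
           = I (c - a) * I (c - b) * I (d - a) * I (d - b) / I (c + d - a - b)"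
proof -
  have "(\<Sum>p\<in>J. Q ((c - p) * (d - p)) * I (p - a) * I (p - b) * I (c - p) * I (d - p))
    = (\<Sum>p\<in>uminus ` J. Q ((p - - c) * (p - - d)) * I (p - - c) * I (p - - d) * I (- a - p) * I (- b - p))"
    by (subst sum.reindex) (auto simp: algebra_simps intro!: sum.cong)
  also have "\<dots> = I (- a - - c) * I (- a - - d) * I (- b - - c) * I (- b - - d) / I (- a + - b - - c - - d)"
  proof (rule vandermonde_sum)
    show "{max (- c) (- d)..min (- a) (- b)} \<subseteq> uminus ` J"
    proof
      fix x assume "x \<in> {max (- c) (- d)..min (- a) (- b)}"
      then have "- x \<in> J" using assms(2) by (intro subsetD[OF assms(2)]) auto
      then show "x \<in> uminus ` J" by (metis imageI minus_minus)
    qed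
  qed (use assms in auto)
  finally show ?thesis by (simp add: algebra_simps)
qed

text \<open>\<open>1 / I\<close> is the \<open>q\<close>-factorial, and \<open>x / 0 = 0\<close> makes \<open>Phi\<close> vanish if \<open>fst r + snd r + t < 0\<close>.\<close>

definition Phi :: "int \<Rightarrow> int \<Rightarrow> int \<Rightarrow> int \<Rightarrow> int \<times> int \<Rightarrow> complex" where
  "Phi t a1 a2 a3 r =
     I (fst r - a1) * I (fst r - a2) * I (fst r - a3)
     * I (snd r + t + a1) * I (snd r + t + a2) * I (snd r + t + a3) / I (fst r + snd r + t)"

text \<open>Three integers with negative sum include a negative one, which makes a reciprocal
  factorial vanish. The criterion sees the parameters only through their sum, so it is uniform over
  all \<open>v\<close> in the later expansions.\<close>

lemma Phi_eq_0:
  assumes "3 * fst r < a1 + a2 + a3 \<or> 3 * snd r + 3 * t + a1 + a2 + a3 < 0"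
  shows "Phi t a1 a2 a3 r = 0"
proof -
  have "fst r - a1 < 0 \<or> fst r - a2 < 0 \<or> fst r - a3 < 0
    \<or> snd r + t + a1 < 0 \<or> snd r + t + a2 < 0 \<or> snd r + t + a3 < 0"
    using assms by linarith
  then show ?thesis by (auto simp: Phi_def I_neg)
qed

text \<open>The components of \<open>r\<close> are coupled by the term
  \<open>- fst r * snd r\<close> of \<open>halfvCv\<close> and by
  \<open>I (fst r + snd r + t)\<close>. The weight \<open>Q ((x - p) * (y + d - p))\<close> of the
  reflected Vandermonde sum removes both at once: it replaces the factorial and contributes the
  opposite mixed term. For fixed \<open>p\<close> the remaining exponent splits into exactly two
  Durfee weights, with base points \<open>a3\<close>, \<open>p\<close> for \<open>x\<close> and
  \<open>- t - a3\<close>, \<open>p - d\<close> for \<open>y\<close>.\<close>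

lemma Bailey_transform:
  assumes s: "a1 + a2 + a3 = s"
    and J1: "finite J1" "\<And>x. s \<le> 3 * x \<Longrightarrow> x \<le> L1 \<Longrightarrow> x \<in> J1"
    and J2: "finite J2" "\<And>y. 0 \<le> 3 * y + 3 * t + s \<Longrightarrow> y \<le> L2 \<Longrightarrow> y \<in> J2"
  shows "(\<Sum>r\<in>J1 \<times> J2. Q (halfvCv r - (s + t) * fst r + (2 * t + s) * snd r)
            * I (L1 - fst r) * I (L2 - snd r) * Phi t a1 a2 a3 r)
       = Q (- (a1 * a2 + a1 * a3 + a2 * a3) - t\<^sup>2 - t * s) * Phi t a1 a2 a3 (L1, L2)"
proof -
  \<comment> \<open>The boxes are enlarged so that they contain the complete range of both Durfee
    sums for every \<open>p\<close> in \<open>P\<close>; the added points contribute 0.\<close>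
  define K1 where "K1 = J1 \<union> {min a3 (min a1 a2)..L1}"
  define K2 where "K2 = J2 \<union> {min (- t - a3) (min (- t - a1) (- t - a2))..L2} \<union> {- t - \<bar>a1\<bar> - \<bar>a2\<bar> - \<bar>a3\<bar> - \<bar>L1\<bar> - \<bar>L2\<bar>..L2}"
  define P where "P = {max a1 a2..max L1 (L2 + t + a1 + a2)}"
  define d where "d = t + a1 + a2"
  have fin: "finite K1" "finite K2" "finite P" using J1 J2 by (auto simp: K1_def K2_def P_def)
  define E where "E = - (a1 * a2 + a1 * a3 + a2 * a3) - t\<^sup>2 - t * s"
  define w where "w r = Q (halfvCv r - (s + t) * fst r + (2 * t + s) * snd r)
            * I (L1 - fst r) * I (L2 - snd r)" for r
  have ext: "(\<Sum>r\<in>J1 \<times> J2. w r * Phi t a1 a2 a3 r) = (\<Sum>r\<in>K1 \<times> K2. w r * Phi t a1 a2 a3 r)"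
  proof (rule sum.mono_neutral_left)
    show "\<forall>r\<in>K1 \<times> K2 - J1 \<times> J2. w r * Phi t a1 a2 a3 r = 0"
    proof
      fix r assume r: "r \<in> K1 \<times> K2 - J1 \<times> J2"
      then consider "fst r \<notin> J1" | "snd r \<notin> J2" by (cases r) auto
      then show "w r * Phi t a1 a2 a3 r = 0"
      proof cases
        case 1
        then have "3 * fst r < s \<or> fst r > L1" using J1(2)[of "fst r"] by linarith
        then show ?thesis using Phi_eq_0[of r a1 a2 a3 t] s by (auto simp: w_def I_neg)
      next
        case 2
        then have "3 * snd r + 3 * t + s < 0 \<or> snd r > L2" using J2(2)[of "snd r"] by linarith
        then show ?thesis using Phi_eq_0[of r a1 a2 a3 t] s by (auto simp: w_def I_neg)
      qed
    qed
  qed (use fin in \<open>auto simp: K1_def K2_def\<close>)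
  have expand: "w (x, y) * Phi t a1 a2 a3 (x, y) =
     (\<Sum>p\<in>P. Q (E + (p - a1) * (p - a2)) * I (p - a1) * I (p - a2) *
        (Q ((x - a3) * (x - p)) * I (x - a3) * I (x - p) * I (L1 - x)) *
        (Q ((y - (- t - a3)) * (y - (p - d))) * I (y - (- t - a3)) * I (y - (p - d)) * I (L2 - y)))"
    if "x \<in> K1" "y \<in> K2" for x y
  proof (cases "x \<le> L1 \<and> y \<le> L2")
    case True
    have "I (x - a1) * I (x - a2) * I (y + t + a1) * I (y + t + a2) / I (x + y + t)
      = (\<Sum>p\<in>P. Q ((x - p) * (y + d - p)) * I (p - a1) * I (p - a2) * I (x - p) * I (y + d - p))"
      using vandermonde_sum'[of P a1 a2 x "y + d"] True fin
      by (force simp: P_def d_def algebra_simps)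
    moreover have "Phi t a1 a2 a3 (x, y) = (I (x - a3) * I (y + t + a3))
      * (I (x - a1) * I (x - a2) * I (y + t + a1) * I (y + t + a2) / I (x + y + t))"
      by (simp add: Phi_def mult_ac)
    ultimately have "w (x, y) * Phi t a1 a2 a3 (x, y) = w (x, y) * (I (x - a3) * I (y + t + a3))
      * (\<Sum>p\<in>P. Q ((x - p) * (y + d - p)) * I (p - a1) * I (p - a2) * I (x - p) * I (y + d - p))"
      by (simp only: mult.assoc)
    also have "\<dots> = (\<Sum>p\<in>P. Q (E + (p - a1) * (p - a2)) * I (p - a1) * I (p - a2) *
        (Q ((x - a3) * (x - p)) * I (x - a3) * I (x - p) * I (L1 - x)) *
        (Q ((y - (- t - a3)) * (y - (p - d))) * I (y - (- t - a3)) * I (y - (p - d)) * I (L2 - y)))"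
      unfolding sum_distrib_left
    proof (rule sum.cong[OF refl], goal_cases)
      case (1 p)
      have y3: "y - (- t - a3) = y + t + a3" and y4: "y - (p - d) = y + d - p" by auto
      have "halfvCv (x, y) - (s + t) * x + (2 * t + s) * y + (x - p) * (y + d - p)
        = E + (p - a1) * (p - a2) + (x - a3) * (x - p) + (y - (- t - a3)) * (y - (p - d))"
        unfolding s[symmetric] halfvCv_def E_def d_def by (simp add: algebra_simps power2_eq_square)
      then have "Q (halfvCv (x, y) - (s + t) * x + (2 * t + s) * y) * Q ((x - p) * (y + d - p))
        = Q (E + (p - a1) * (p - a2)) * Q ((x - a3) * (x - p)) * Q ((y + t + a3) * (y + d - p))"
        unfolding y3 y4 by (simp only: Q_add[symmetric])
      then show ?case
        unfolding y3 y4 w_def by (simp add: mult_ac)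
    qed
    finally show ?thesis .
  next
    case False
    then show ?thesis by (auto simp: w_def I_neg)
  qed
  have "(\<Sum>r\<in>K1 \<times> K2. w r * Phi t a1 a2 a3 r) =
    (\<Sum>x\<in>K1. \<Sum>y\<in>K2. \<Sum>p\<in>P. Q (E + (p - a1) * (p - a2)) * I (p - a1) * I (p - a2) *
        (Q ((x - a3) * (x - p)) * I (x - a3) * I (x - p) * I (L1 - x)) *
        (Q ((y - (- t - a3)) * (y - (p - d))) * I (y - (- t - a3)) * I (y - (p - d)) * I (L2 - y)))"
    unfolding sum.cartesian_product' by (intro sum.cong refl) (auto simp: expand)
  also have "\<dots> = (\<Sum>p\<in>P. \<Sum>x\<in>K1. \<Sum>y\<in>K2. Q (E + (p - a1) * (p - a2)) * I (p - a1) * I (p - a2) *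
        (Q ((x - a3) * (x - p)) * I (x - a3) * I (x - p) * I (L1 - x)) *
        (Q ((y - (- t - a3)) * (y - (p - d))) * I (y - (- t - a3)) * I (y - (p - d)) * I (L2 - y)))"
    by (subst sum.swap[of _ _ P], subst sum.swap[of _ _ P]) (rule refl)
  also have "\<dots> = (\<Sum>p\<in>P. Q (E + (p - a1) * (p - a2)) * I (p - a1) * I (p - a2) *
        (\<Sum>x\<in>K1. Q ((x - a3) * (x - p)) * I (x - a3) * I (x - p) * I (L1 - x)) *
        (\<Sum>y\<in>K2. Q ((y - (- t - a3)) * (y - (p - d))) * I (y - (- t - a3)) * I (y - (p - d)) * I (L2 - y)))"
    by (simp add: sum_distrib_left sum_distrib_right mult_ac)
  also have "\<dots> = (\<Sum>p\<in>P. Q (E + (p - a1) * (p - a2)) * I (p - a1) * I (p - a2) *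
        (I (L1 - a3) * I (L1 - p)) * (I (L2 + t + a3) * I (L2 + d - p)))"
  proof (rule sum.cong[OF refl], goal_cases)
    case (1 p)
    have 2: "(\<Sum>x\<in>K1. Q ((x - a3) * (x - p)) * I (x - a3) * I (x - p) * I (L1 - x)) = I (L1 - a3) * I (L1 - p)"
      using 1 fin by (intro durfee_sum) (auto simp: K1_def P_def)
    have "(\<Sum>y\<in>K2. Q ((y - (- t - a3)) * (y - (p - d))) * I (y - (- t - a3)) * I (y - (p - d)) * I (L2 - y))
        = I (L2 - (- t - a3)) * I (L2 - (p - d))"
      using 1 fin by (intro durfee_sum) (auto simp: K2_def P_def)
    then show ?case using 2 by (simp add: algebra_simps)
  qed
  also have "\<dots> = Q E * (I (L1 - a3) * I (L2 + t + a3)) *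
     (\<Sum>p\<in>P. Q ((p - a1) * (p - a2)) * I (p - a1) * I (p - a2) * I (L1 - p) * I (L2 + d - p))"
    by (simp add: sum_distrib_left Q_add mult_ac)
  also have "(\<Sum>p\<in>P. Q ((p - a1) * (p - a2)) * I (p - a1) * I (p - a2) * I (L1 - p) * I (L2 + d - p))
     = I (L1 - a1) * I (L1 - a2) * I (L2 + d - a1) * I (L2 + d - a2) / I (L1 + (L2 + d) - a1 - a2)"
    using fin by (intro vandermonde_sum) (auto simp: P_def d_def)
  also have "Q E * (I (L1 - a3) * I (L2 + t + a3)) * \<dots> = Q E * Phi t a1 a2 a3 (L1, L2)"
    by (simp add: Phi_def d_def algebra_simps)
  finally show ?thesis using ext unfolding w_def E_def by simp
qed

end

section \<open>Expansions of the initial functions\<close>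

definition tri :: "int \<Rightarrow> int" where "tri j = j * (j - 1) div 2"

lemma two_tri: "2 * tri j = j * (j - 1)"
  unfolding tri_def by (rule dvd_mult_div_cancel) simp

lemma tri_add: "tri (i + j) = tri i + tri j + i * j"
proof -
  have "2 * tri (i + j) = 2 * (tri i + tri j + i * j)"
    unfolding distrib_left two_tri by (simp add: algebra_simps)
  then show ?thesis by simp
qed

lemma tri_0 [simp]: "tri 0 = 0" and tri_1 [simp]: "tri 1 = 0"
  by (simp_all add: tri_def)

lemma tri_pred: "tri (j - 1) = tri j - (j - 1)"
  using tri_add[of "j - 1" 1] by simp

text \<open>A vector \<open>v\<close> stands for the point \<open>(v\<^sub>1, v\<^sub>2, v\<^sub>3)\<close> with \<open>v\<^sub>3 = - v\<^sub>1 - v\<^sub>2\<close> of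
  the \<open>A\<^sub>2\<close> root lattice, \<open>half_norm v\<close> is half its squared length, and \<open>eps v\<close> is the
  sign of \<open>(v\<^sub>1, v\<^sub>2, v\<^sub>3) mod 3\<close> as a permutation of \<open>(1, 0, 2)\<close>.\<close>

definition half_norm :: "int \<times> int \<Rightarrow> int" where
  "half_norm v = (fst v)\<^sup>2 + fst v * snd v + (snd v)\<^sup>2"

definition eps :: "int \<times> int \<Rightarrow> complex" where
  "eps v = (if (fst v - snd v) mod 3 = 0 then 0 else if (fst v - snd v) mod 3 = 1 then 1 else - 1)"

lemma eps_swap12: "eps (y, x) = - eps (x, y)"
proof -
  have "(y - x) mod 3 = (- (x - y)) mod 3" by simp
  then show ?thesis unfolding eps_def fst_conv snd_conv
    by (auto simp: zmod_zminus1_eq_if split: if_splits) presburger+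
qed

lemma eps_swap23: "eps (x, - x - y) = - eps (x, y)"
proof -
  have "(x - (- x - y)) mod 3 = (- (x - y)) mod 3" by presburger
  then show ?thesis unfolding eps_def fst_conv snd_conv
    by (auto simp: zmod_zminus1_eq_if split: if_splits) presburger+
qed

lemma half_norm_swap12: "half_norm (y, x) = half_norm (x, y)"
  and half_norm_swap23: "half_norm (x, - x - y) = half_norm (x, y)"
  by (simp_all add: half_norm_def algebra_simps power2_eq_square)

context qbase
begin

text \<open>These are the coefficients of the Macdonald product, see \<open>macdonald_A2\<close>.
  Where \<open>eps v\<close> is nonzero the division by 3 is exact (\<open>half_norm_mod_3\<close>),
  and elsewhere its rounding is hidden by the factor 0.\<close>

definition kappa :: "int \<times> int \<Rightarrow> complex" where
  "kappa v = eps v * Q ((half_norm v - 1) div 3)"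

lemma kappa_swap12: "kappa (y, x) = - kappa (x, y)"
  and kappa_swap23: "kappa (x, - x - y) = - kappa (x, y)"
  unfolding kappa_def eps_swap12[of y x] half_norm_swap12[of y x] eps_swap23[of x y] half_norm_swap23[of x y]
  by simp_all

text \<open>In three coordinates this is translation by \<open>(2, -1, -1)\<close>, the coefficient
  form of the quasi-periodicity of the Macdonald product in its first variable.\<close>

lemma kappa_shift: "kappa (x + 2, y - 1) = Q (x + 1) * kappa (x, y)"
proof -
  have "(x + 2 - (y - 1)) mod 3 = (x - y) mod 3" by presburger
  then have "eps (x + 2, y - 1) = eps (x, y)" by (simp add: eps_def)
  moreover have "half_norm (x + 2, y - 1) - 1 = half_norm (x, y) - 1 + (x + 1) * 3"
    by (simp add: half_norm_def algebra_simps power2_eq_square)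
  then have "(half_norm (x + 2, y - 1) - 1) div 3 = (x + 1) + (half_norm (x, y) - 1) div 3"
    by simp
  ultimately show ?thesis by (simp add: kappa_def Q_add)
qed

text \<open>Up to a factor, \<open>qcoeff N j\<close> is the coefficient of \<open>z ^ j\<close> in \<open>\<Prod>i<N. (1 - z * q ^ i)\<close>.
  Accordingly \<open>ct\<close> is the constant term of three such products against the \<open>A\<^sub>2\<close> Macdonald
  product and a monomial. It is antisymmetric, and the substitution \<open>z\<^sub>1 \<mapsto> q z\<^sub>1\<close> gives
  the relation \<open>ct_rel\<close> below. The two properties determine it.\<close>

definition qcoeff :: "int \<Rightarrow> int \<Rightarrow> complex" where
  "qcoeff N j = (- 1) powi j * Q (tri j) * I j * I (N - j)"

lemma qcoeff_0: "j < 0 \<or> N < j \<Longrightarrow> qcoeff N j = 0"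
  by (auto simp: qcoeff_def I_neg)

text \<open>For \<open>F z\<close> the product of the \<open>1 - z * q ^ i\<close> over
  \<open>i < N\<close> one has \<open>(1 - z * q ^ N) * F z = (1 - z) * F (q * z)\<close>. The lemma
  compares the coefficients of \<open>z ^ j\<close>.\<close>

lemma qcoeff_rec: "qcoeff N j - Q N * qcoeff N (j - 1) = Q j * qcoeff N j - Q (j - 1) * qcoeff N (j - 1)"
proof -
  define J M where "J = Q j" and "M = Q N"
  define s X Y where "s = (- 1 :: complex) powi j * Q (tri j)" and "X = I j" and "Y = I (N - (j - 1))"
  have J: "J \<noteq> 0" by (simp add: J_def)
  have eq: "N - j = N - (j - 1) - 1" by simp
  have c1: "qcoeff N j = s * X * ((1 - M / (J / q)) * Y)"
    unfolding qcoeff_def eq I_pred[of "N - (j - 1)"] s_def X_def Y_def J_def M_def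
    by (simp only: Q_diff power_int_1_right)
  have c0: "qcoeff N (j - 1) = - s / (J / q) * ((1 - J) * X) * Y"
    unfolding qcoeff_def tri_pred I_pred s_def X_def Y_def J_def
    by (simp add: Q_diff power_int_diff)
  have qj: "Q (j - 1) = J / q" by (simp add: Q_diff J_def)
  show ?thesis unfolding c1 c0 qj J_def[symmetric] M_def[symmetric]
    using J by (simp add: field_simps)
qed

section \<open>Constant terms: antisymmetry and the relation from quasi-periodicity\<close>

definition ct_summand :: "int \<Rightarrow> int \<Rightarrow> int \<Rightarrow> int \<Rightarrow> int \<times> int \<Rightarrow> complex" where
  "ct_summand N n1 n2 n3 v = kappa v * qcoeff N (fst v - n1) * qcoeff N (snd v - n2) * qcoeff N (- fst v - snd v - n3)"

text \<open>Only finitely many summands are nonzero. Summing over the whole lattice lets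
  permutations and translations act as bijections of the index set, with no ranges to
  adjust.\<close>

definition ct :: "int \<Rightarrow> int \<Rightarrow> int \<Rightarrow> int \<Rightarrow> complex" where
  "ct N n1 n2 n3 = infsum (ct_summand N n1 n2 n3) UNIV"

lemma ct_summand_has_sum: "(ct_summand N n1 n2 n3 has_sum ct N n1 n2 n3) UNIV"
proof -
  have "{v. ct_summand N n1 n2 n3 v \<noteq> 0} \<subseteq> {n1..n1 + N} \<times> {n2..n2 + N}"
  proof
    fix v assume "v \<in> {v. ct_summand N n1 n2 n3 v \<noteq> 0}"
    then have "qcoeff N (fst v - n1) \<noteq> 0" "qcoeff N (snd v - n2) \<noteq> 0" by (auto simp: ct_summand_def)
    then have "\<not> (fst v - n1 < 0 \<or> N < fst v - n1)" "\<not> (snd v - n2 < 0 \<or> N < snd v - n2)"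
      using qcoeff_0 by blast+
    then show "v \<in> {n1..n1 + N} \<times> {n2..n2 + N}" by (cases v) auto
  qed
  then have "finite {v. ct_summand N n1 n2 n3 v \<noteq> 0}" by (rule finite_subset) auto
  then have "ct_summand N n1 n2 n3 summable_on UNIV"
    by (intro finite_nonzero_values_imp_summable_on) simp
  then show ?thesis by (simp add: ct_def)
qed

lemma ct_eqI: "(ct_summand N n1 n2 n3 has_sum x) UNIV \<Longrightarrow> ct N n1 n2 n3 = x"
  using ct_summand_has_sum has_sum_unique by blast

lemma ct_swap12: "ct N n2 n1 n3 = - ct N n1 n2 n3"
proof (rule ct_eqI)
  have "((\<lambda>v. - ct_summand N n1 n2 n3 v) has_sum - ct N n1 n2 n3) UNIV"
    using ct_summand_has_sum by (rule has_sum_uminusI)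
  moreover have "ct_summand N n2 n1 n3 (prod.swap v) = - ct_summand N n1 n2 n3 v" for v
  proof -
    obtain a b where v: "v = (a, b)" by force
    have eq: "- b - a - n3 = - a - b - n3" by simp
    show ?thesis
      by (simp only: v ct_summand_def swap_simp fst_conv snd_conv eq kappa_swap12[of b a]
          mult_minus_left mult_minus_right minus_minus mult_ac)
  qed
  ultimately show "(ct_summand N n2 n1 n3 has_sum - ct N n1 n2 n3) UNIV"
    by (subst has_sum_reindex_bij_betw[of prod.swap UNIV UNIV, symmetric]) (auto simp: bij_swap)
qed

lemma ct_swap23: "ct N n1 n3 n2 = - ct N n1 n2 n3"
proof (rule ct_eqI)
  have "((\<lambda>v. - ct_summand N n1 n2 n3 v) has_sum - ct N n1 n2 n3) UNIV"
    using ct_summand_has_sum by (rule has_sum_uminusI)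
  moreover have "ct_summand N n1 n3 n2 (fst v, - fst v - snd v) = - ct_summand N n1 n2 n3 v" for v
    using kappa_swap23[of "fst v" "snd v"] by (cases v) (simp add: ct_summand_def mult_ac)
  moreover have "bij (\<lambda>v :: int \<times> int. (fst v, - fst v - snd v))"
    by (rule o_bij[of "\<lambda>v. (fst v, - fst v - snd v)"]) auto
  ultimately show "(ct_summand N n1 n3 n2 has_sum - ct N n1 n2 n3) UNIV"
    by (subst has_sum_reindex_bij_betw[of "\<lambda>v. (fst v, - fst v - snd v)" UNIV UNIV, symmetric]) simp_all
qed

lemma ct_eq_0: "n1 = n2 \<or> n2 = n3 \<or> n1 = n3 \<Longrightarrow> ct N n1 n2 n3 = 0"
proof -
  assume *: "n1 = n2 \<or> n2 = n3 \<or> n1 = n3"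
  have 1: "ct N n n m = 0" for n m using ct_swap12[of N n n m] by simp
  have 2: "ct N m n n = 0" for n m using ct_swap23[of N m n n] by simp
  have 3: "ct N n m n = 0" for n m using ct_swap12[of N n m n] by (simp add: 2)
  show ?thesis using * 1 2 3 by blast
qed

lemma ct_rotate: "ct N n1 n2 n3 = ct N n2 n3 n1"
  unfolding ct_swap23[of N n2 n3 n1] ct_swap12[of N n2 n1 n3] minus_minus ..

text \<open>Apply \<open>qcoeff_rec\<close> to the first coordinate. The factor \<open>Q j\<close>
  that it produces contains \<open>Q (fst v + 1)\<close>, which \<open>kappa_shift\<close> absorbs
  by translating \<open>v\<close>; the rest of it does not depend on \<open>v\<close>.\<close>

lemma ct_rel:
  "ct N (x - 2) (y + 1) (z + 1) - Q N * ct N (x - 1) (y + 1) (z + 1)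
     = Q (1 - x) * (ct N x y z - ct N (x + 1) y z / q)"
proof -
  have sh: "((\<lambda>v. Q (fst v + 1 + d) * kappa v * qcoeff N (fst v + 2 - n) * qcoeff N (snd v - (y + 1)) * qcoeff N (- fst v - snd v - (z + 1)))
      has_sum Q d * ct N n y z) UNIV" for n d
  proof -
    have "((\<lambda>v. Q d * ct_summand N n y z v) has_sum Q d * ct N n y z) UNIV"
      by (intro has_sum_cmult_right ct_summand_has_sum)
    moreover have "Q (fst v - 2 + 1 + d) * kappa (fst v - 2, snd v + 1) * qcoeff N (fst v - 2 + 2 - n)
        * qcoeff N (snd v + 1 - (y + 1)) * qcoeff N (- (fst v - 2) - (snd v + 1) - (z + 1)) = Q d * ct_summand N n y z v" for v
    proof -
      obtain a b where v: "v = (a, b)" by force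
      have "kappa (a, b) = Q (a - 1) * kappa (a - 2, b + 1)"
        using kappa_shift[of "a - 2" "b + 1"] by simp
      moreover have "- (a - 2) - (b + 1) - (z + 1) = - a - b - z" "a - 2 + 1 + d = d + (a - 1)"
        "a - 2 + 2 - n = a - n" "b + 1 - (y + 1) = b - y" by auto
      ultimately show ?thesis by (simp only: v ct_summand_def Q_add mult_ac fst_conv snd_conv)
    qed
    moreover have "bij (\<lambda>v :: int \<times> int. (fst v - 2, snd v + 1))"
      by (rule o_bij[of "\<lambda>v. (fst v + 2, snd v - 1)"]) auto
    ultimately show ?thesis
      by (subst has_sum_reindex_bij_betw[of "\<lambda>v. (fst v - 2, snd v + 1)" UNIV UNIV, symmetric]) simp_all
  qed
  have 1: "((\<lambda>v. ct_summand N (x - 2) (y + 1) (z + 1) v + - Q N * ct_summand N (x - 1) (y + 1) (z + 1) v) has_sum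
      (ct N (x - 2) (y + 1) (z + 1) + - Q N * ct N (x - 1) (y + 1) (z + 1))) UNIV"
    by (intro has_sum_add has_sum_cmult_right ct_summand_has_sum)
  have 2: "((\<lambda>v. Q (fst v + 1 + (1 - x)) * kappa v * qcoeff N (fst v + 2 - x) * qcoeff N (snd v - (y + 1)) * qcoeff N (- fst v - snd v - (z + 1))
     + - (Q (fst v + 1 + - x) * kappa v * qcoeff N (fst v + 2 - (x + 1)) * qcoeff N (snd v - (y + 1)) * qcoeff N (- fst v - snd v - (z + 1))))
     has_sum (Q (1 - x) * ct N x y z + - (Q (- x) * ct N (x + 1) y z))) UNIV"
    by (intro has_sum_add has_sum_uminusI sh)
  have eq: "ct_summand N (x - 2) (y + 1) (z + 1) v + - Q N * ct_summand N (x - 1) (y + 1) (z + 1) v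
    = Q (fst v + 1 + (1 - x)) * kappa v * qcoeff N (fst v + 2 - x) * qcoeff N (snd v - (y + 1)) * qcoeff N (- fst v - snd v - (z + 1))
     + - (Q (fst v + 1 + - x) * kappa v * qcoeff N (fst v + 2 - (x + 1)) * qcoeff N (snd v - (y + 1)) * qcoeff N (- fst v - snd v - (z + 1)))" for v
  proof -
    define j r where "j = fst v + 2 - x" and "r = kappa v * qcoeff N (snd v - (y + 1)) * qcoeff N (- fst v - snd v - (z + 1))"
    have eqs: "fst v - (x - 2) = j" "fst v - (x - 1) = j - 1" "fst v + 1 + (1 - x) = j"
      "fst v + 1 + - x = j - 1" "fst v + 2 - (x + 1) = j - 1" by (auto simp: j_def)
    have "ct_summand N (x - 2) (y + 1) (z + 1) v + - Q N * ct_summand N (x - 1) (y + 1) (z + 1) v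
      = (qcoeff N j - Q N * qcoeff N (j - 1)) * r"
      unfolding ct_summand_def eqs r_def by (simp add: algebra_simps)
    also have "\<dots> = (Q j * qcoeff N j - Q (j - 1) * qcoeff N (j - 1)) * r" by (simp only: qcoeff_rec)
    finally show ?thesis unfolding eqs j_def[symmetric] r_def by (simp add: algebra_simps del: minus_diff_eq)
  qed
  from has_sum_unique[OF 1[unfolded eq] 2]
  have "ct N (x - 2) (y + 1) (z + 1) + - Q N * ct N (x - 1) (y + 1) (z + 1)
     = Q (1 - x) * ct N x y z + - (Q (- x) * ct N (x + 1) y z)" .
  moreover have "Q (- x) = Q (1 - x) / q" using Q_diff[of "1 - x" 1] by simp
  ultimately show ?thesis by (simp add: algebra_simps)
qed

section \<open>Evaluation of the constant terms near rho = (1, 0, -1)\<close>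

lemma ct_rel':
  assumes "n1 = x - 2" "n1' = x - 1" "n2 = y + 1" "n3 = z + 1" "x' = x + 1" "e = 1 - x"
  shows "ct N n1 n2 n3 - Q N * ct N n1' n2 n3 = Q e * (ct N x y z - ct N x' y z / q)"
  using ct_rel[of N x y z] unfolding assms .

text \<open>The name records the arguments relative to \<open>- r\<close>. Here and in the next
  lemmas the instance of \<open>ct_rel\<close> is chosen so that some of its terms have a repeated
  argument, hence vanish, and others are permutations of terms already known.\<close>

lemma ct_2_0_m1: "ct N (2 - r) (- r) (- 1 - r) = q * (1 - Q (- r)) * ct N (1 - r) (- r) (- 1 - r)"
proof -
  have "ct N (- 1 - r) (1 - r) (- r) - Q N * ct N (- r) (1 - r) (- r)
      = Q r * (ct N (1 - r) (- r) (- 1 - r) - ct N (2 - r) (- r) (- 1 - r) / q)"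
    by (rule ct_rel') auto
  moreover have "ct N (- r) (1 - r) (- r) = 0" by (rule ct_eq_0) simp
  ultimately have "Q r * (ct N (1 - r) (- r) (- 1 - r) - ct N (2 - r) (- r) (- 1 - r) / q)
      = ct N (1 - r) (- r) (- 1 - r)"
    unfolding ct_rotate[of N "- 1 - r" "1 - r" "- r"] by simp
  then have "ct N (1 - r) (- r) (- 1 - r) - ct N (2 - r) (- r) (- 1 - r) / q = Q (- r) * ct N (1 - r) (- r) (- 1 - r)"
    by (metis nonzero_mult_div_cancel_left power_int_minus power_int_eq_0_iff q_nz divide_inverse mult.commute)
  then have "ct N (2 - r) (- r) (- 1 - r) / q = (1 - Q (- r)) * ct N (1 - r) (- r) (- 1 - r)"
    unfolding left_diff_distrib mult_1 by (metis diff_diff_eq2 add_diff_cancel_left' diff_add_cancel)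
  then show ?thesis by (metis q_nz nonzero_mult_div_cancel_left times_divide_eq_right mult.assoc)
qed

lemma ct_3_0_m1: "ct N (3 - r) (- r) (- 1 - r) = q * ct N (2 - r) (- r) (- 1 - r)"
proof -
  have "ct N (- r) (1 - r) (- r) - Q N * ct N (1 - r) (1 - r) (- r)
      = Q (r - 1) * (ct N (2 - r) (- r) (- 1 - r) - ct N (3 - r) (- r) (- 1 - r) / q)"
    by (rule ct_rel') auto
  moreover have "ct N (- r) (1 - r) (- r) = 0" "ct N (1 - r) (1 - r) (- r) = 0"
    by (auto intro: ct_eq_0)
  ultimately have "ct N (2 - r) (- r) (- 1 - r) - ct N (3 - r) (- r) (- 1 - r) / q = 0" by simp
  then show ?thesis by (metis eq_iff_diff_eq_0 q_nz nonzero_mult_div_cancel_left times_divide_eq_right)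
qed

lemma ct_2_1_m1: "ct N (2 - r) (1 - r) (- 1 - r) = - Q (1 - r) * ct N (2 - r) (- r) (- 1 - r)"
proof -
  have "ct N (- 1 - r) (3 - r) (- r) - Q N * ct N (- r) (3 - r) (- r)
      = Q r * (ct N (1 - r) (2 - r) (- 1 - r) - ct N (2 - r) (2 - r) (- 1 - r) / q)"
    by (rule ct_rel') auto
  moreover have "ct N (- r) (3 - r) (- r) = 0" "ct N (2 - r) (2 - r) (- 1 - r) = 0"
    by (auto intro: ct_eq_0)
  ultimately have "q * ct N (2 - r) (- r) (- 1 - r) = - Q r * ct N (2 - r) (1 - r) (- 1 - r)"
    unfolding ct_rotate[of N "- 1 - r" "3 - r" "- r"] ct_swap12[of N "2 - r" "1 - r" "- 1 - r"]
      ct_3_0_m1 by simp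
  moreover have "Q (1 - r) * ct N (2 - r) (- r) (- 1 - r) = Q (- r) * (q * ct N (2 - r) (- r) (- 1 - r))"
    using Q_add[of "- r" 1] by (simp add: mult_ac)
  ultimately have "Q (1 - r) * ct N (2 - r) (- r) (- 1 - r) = - (Q (- r) * Q r) * ct N (2 - r) (1 - r) (- 1 - r)"
    by (simp only: mult_minus_left mult_minus_right mult.assoc)
  then show ?thesis unfolding Q_add[symmetric] by simp
qed

lemma ct_2_1_m2: "ct N (2 - r) (1 - r) (- 2 - r) = Q N * ct N (2 - r) (1 - r) (- 1 - r)"
proof -
  have "ct N (- 2 - r) (2 - r) (1 - r) - Q N * ct N (- 1 - r) (2 - r) (1 - r)
      = Q (1 + r) * (ct N (- r) (1 - r) (- r) - ct N (1 - r) (1 - r) (- r) / q)"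
    by (rule ct_rel') auto
  moreover have "ct N (- r) (1 - r) (- r) = 0" "ct N (1 - r) (1 - r) (- r) = 0"
    by (auto intro: ct_eq_0)
  ultimately show ?thesis
    unfolding ct_rotate[of N "- 2 - r" "2 - r" "1 - r"] ct_rotate[of N "- 1 - r" "2 - r" "1 - r"]
    by simp
qed

text \<open>Apart from the two values at rho and terms already reduced to them, two instances of
  \<open>ct_rel\<close> involve only the weight \<open>(3, 1, -1)\<close>, named \<open>D\<close>.
  Eliminating \<open>D\<close> leaves a first order recursion in \<open>r\<close>.\<close>

lemma ct_rec:
  "(1 - Q (- r)) * Q (2 - r) * ct N (1 - r) (- r) (- 1 - r)
     = (Q (r - 1) - Q N) * ct N (1 - (r - 1)) (- (r - 1)) (- 1 - (r - 1))"
proof -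
  define A A' D where "A = ct N (1 - r) (- r) (- 1 - r)"
    and "A' = ct N (1 - (r - 1)) (- (r - 1)) (- 1 - (r - 1))"
    and "D = ct N (3 - r) (1 - r) (- 1 - r)"
  have eqs: "1 - (r - 1) = 2 - r" "- (r - 1) = 1 - r" "- 1 - (r - 1) = - r" "2 - (r - 1) = 3 - r"
    by auto
  have A': "A' = ct N (2 - r) (1 - r) (- r)" unfolding A'_def eqs ..
  have B': "ct N (3 - r) (1 - r) (- r) = q * (1 - Q (1 - r)) * A'"
    using ct_2_0_m1[of N "r - 1"] unfolding eqs A' .
  have C: "ct N (2 - r) (1 - r) (- 1 - r) = - Q (1 - r) * (q * (1 - Q (- r)) * A)"
    unfolding ct_2_1_m1 ct_2_0_m1 A_def by simp
  have swap: "ct N (1 - r) (2 - r) (- r) = - A'" unfolding A' by (rule ct_swap12)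
  have "ct N (- r) (2 - r) (- r) - Q N * ct N (1 - r) (2 - r) (- r)
      = Q (r - 1) * (ct N (2 - r) (1 - r) (- 1 - r) - ct N (3 - r) (1 - r) (- 1 - r) / q)"
    by (rule ct_rel') auto
  moreover have "ct N (- r) (2 - r) (- r) = 0" by (rule ct_eq_0) simp
  ultimately have 4: "Q N * A' = Q (r - 1) * (- Q (1 - r) * (q * (1 - Q (- r)) * A) - D / q)"
    unfolding C swap D_def by simp
  have "ct N (- 1 - r) (3 - r) (1 - r) - Q N * ct N (- r) (3 - r) (1 - r)
      = Q r * (ct N (1 - r) (2 - r) (- r) - ct N (2 - r) (2 - r) (- r) / q)"
    by (rule ct_rel') auto
  moreover have "ct N (2 - r) (2 - r) (- r) = 0" by (rule ct_eq_0) simp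
  ultimately have 5: "D - Q N * (q * (1 - Q (1 - r)) * A') = - Q r * A'"
    unfolding B'[symmetric] swap D_def ct_rotate[of N "- 1 - r" "3 - r" "1 - r"]
      ct_rotate[of N "- r" "3 - r" "1 - r"] by simp
  define R M where "R = Q r" and "M = Q N"
  have R: "R \<noteq> 0" by (simp add: R_def)
  have qs: "Q (r - 1) = R / q" "Q (1 - r) = q / R" "Q (- r) = 1 / R" "Q (2 - r) = q * q / R"
    by (simp_all add: Q_diff R_def power_int_minus power2_eq_square inverse_eq_divide)
  have D: "D = M * (q * (1 - q / R) * A') - R * A'"
    using 5 unfolding qs M_def[symmetric] R_def[symmetric] by (simp add: algebra_simps)
  have "M * A' = R / q * (- (q / R) * (q * (1 - 1 / R) * A) - D / q)"
    using 4 unfolding qs M_def[symmetric] by simp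
  also have "\<dots> = M * A' - q * (1 - 1 / R) * A + R / q * ((R / q - M) * A')"
    unfolding D using R by (simp add: field_simps)
  finally have "q * (1 - 1 / R) * A = R / q * ((R / q - M) * A')" by simp
  then have "q / R * (q * (1 - 1 / R) * A) = (R / q - M) * A'" using R by simp
  then show ?thesis unfolding A_def[symmetric] A'_def[symmetric] qs M_def[symmetric]
    by (simp add: mult_ac)
qed

text \<open>The three indices of the \<open>qcoeff\<close> factors add up to 0, so unless all are 0
  one of them is negative. Only the point \<open>(1, 0)\<close>, which is rho, survives.\<close>

lemma ct_0: "ct N 1 0 (- 1) = I N ^ 3"
proof (rule ct_eqI)
  have zero: "ct_summand N 1 0 (- 1) v = 0" if "v \<noteq> (1, 0)" for v
  proof -
    have "fst v - 1 < 0 \<or> snd v - 0 < 0 \<or> - fst v - snd v - - 1 < 0"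
      using that by (cases v) auto
    then show ?thesis by (auto simp: ct_summand_def qcoeff_0)
  qed
  have "ct_summand N 1 0 (- 1) (1, 0) = I N ^ 3"
    by (simp add: ct_summand_def kappa_def eps_def half_norm_def qcoeff_def power3_eq_cube)
  then show "(ct_summand N 1 0 (- 1) has_sum I N ^ 3) UNIV"
    using zero by (intro has_sum_finite_neutralI[of "{(1, 0)}"]) auto
qed

text \<open>The coefficient \<open>1 - Q (- r)\<close> in \<open>ct_rec\<close> is nonzero for
  \<open>r > 0\<close>, so each value determines the next. It vanishes at \<open>r = 0\<close>,
  where \<open>ct_0\<close> supplies the start.\<close>

lemma ct_rho:
  assumes "r \<ge> 0"
  shows "ct N (1 - r) (- r) (- 1 - r) = (- 1) powi r * Q (3 * tri r) * I r * I (N - r) * I N ^ 2"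
proof -
  have "ct N (1 - int n) (- int n) (- 1 - int n)
      = (- 1) powi int n * Q (3 * tri (int n)) * I (int n) * I (N - int n) * I N ^ 2" for n
  proof (induction n)
    case 0
    then show ?case using ct_0 by (simp add: power3_eq_cube power2_eq_square)
  next
    case (Suc n)
    define r where "r = int (Suc n)"
    have r1: "int n = r - 1" by (simp add: r_def)
    define R M where "R = Q r" and "M = Q N"
    have "R \<noteq> 1" using Q_inj[of r] by (simp add: R_def r_def)
    have "R \<noteq> 0" by (simp add: R_def)
    have qs: "Q (r - 1) = R / q" "Q (- r) = 1 / R" "Q (2 - r) = q * q / R"
      by (simp_all add: Q_diff R_def power_int_minus power2_eq_square inverse_eq_divide)
    define X Y s where "X = I r" and "Y = I (N - (r - 1))" and "s = (- 1 :: complex) powi r * Q (3 * tri r)"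
    have i1: "I (r - 1) = (1 - R) * X" by (simp add: I_pred X_def R_def)
    have i2: "I (N - r) = (1 - M / (R / q)) * Y"
      using I_pred[of "N - (r - 1)"] by (simp add: Q_diff Y_def R_def M_def)
    have "3 * tri (r - 1) = 3 * tri r - ((r - 1) + (r - 1) + (r - 1))" by (simp add: tri_pred)
    then have "Q (3 * tri (r - 1)) = Q (3 * tri r) / (R / q * (R / q) * (R / q))"
      by (simp only: Q_diff Q_add qs R_def power_int_1_right)
    then have s1: "(- 1) powi (r - 1) * Q (3 * tri (r - 1)) = - s / (R / q * (R / q) * (R / q))"
      by (simp add: s_def power_int_diff)
    have "(1 - 1 / R) * (q * q / R) * ct N (1 - r) (- r) (- 1 - r)
      = (R / q - M) * (- s / (R / q * (R / q) * (R / q)) * ((1 - R) * X) * Y * I N ^ 2)"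
      using ct_rec[of r N] Suc unfolding r1 s1 i1 qs M_def[symmetric] Y_def[symmetric]
      by simp
    also have "\<dots> = (1 - 1 / R) * (q * q / R) * (s * X * ((1 - M / (R / q)) * Y) * I N ^ 2)"
      using \<open>R \<noteq> 0\<close> by (simp add: field_simps)
    finally have "ct N (1 - r) (- r) (- 1 - r) = s * X * ((1 - M / (R / q)) * Y) * I N ^ 2"
      using \<open>R \<noteq> 0\<close> \<open>R \<noteq> 1\<close> by simp
    then show ?case unfolding r_def[symmetric] i2 s_def X_def .
  qed
  from this[of "nat r"] show ?thesis using assms by simp
qed

text \<open>In the coordinates \<open>u1\<close>, \<open>u2\<close>, \<open>u3\<close> the six
  factorials of \<open>Phi\<close> have the indices \<open>u + r\<close> and
  \<open>N - (u + r)\<close>, as in three factors \<open>qcoeff N\<close>. The sum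
  \<open>u1 + u2 + u3\<close> is constant, so the signs and the cross terms \<open>u * r\<close> of
  the exponents depend on \<open>r\<close> alone and leave the sum.\<close>

lemma Phi_has_sum_ct:
  assumes N: "N = fst x + snd x + t" "N \<ge> 0"
    and r: "r = fst x + d"
  shows "((\<lambda>v. kappa v * Q (tri (fst v - m1) + tri (snd v - m2) + tri (- fst v - snd v - m3))
            * Phi t (m1 - d - fst v) (m2 - d - snd v) (m3 - d + fst v + snd v) x)
      has_sum (- 1) powi (3 * r - (m1 + m2 + m3)) * Q ((m1 + m2 + m3) * r - 3 * tri r) / I N
              * ct N (m1 - r) (m2 - r) (m3 - r)) UNIV"
proof -
  define c where "c = (- 1) powi (3 * r - (m1 + m2 + m3)) * Q ((m1 + m2 + m3) * r - 3 * tri r) / I N"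
  have "((\<lambda>v. c * ct_summand N (m1 - r) (m2 - r) (m3 - r) v) has_sum c * ct N (m1 - r) (m2 - r) (m3 - r)) UNIV"
    by (intro has_sum_cmult_right ct_summand_has_sum)
  moreover have "c * ct_summand N (m1 - r) (m2 - r) (m3 - r) v =
     kappa v * Q (tri (fst v - m1) + tri (snd v - m2) + tri (- fst v - snd v - m3))
            * Phi t (m1 - d - fst v) (m2 - d - snd v) (m3 - d + fst v + snd v) x" for v
  proof -
    define u1 u2 u3 where "u1 = fst v - m1" and "u2 = snd v - m2" and "u3 = - fst v - snd v - m3"
    have u: "fst v - (m1 - r) = u1 + r" "snd v - (m2 - r) = u2 + r" "- fst v - snd v - (m3 - r) = u3 + r"
      by (auto simp: u1_def u2_def u3_def)
    have p: "fst x - (m1 - d - fst v) = u1 + r" "fst x - (m2 - d - snd v) = u2 + r"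
      "fst x - (m3 - d + fst v + snd v) = u3 + r"
      "snd x + t + (m1 - d - fst v) = N - (u1 + r)" "snd x + t + (m2 - d - snd v) = N - (u2 + r)"
      "snd x + t + (m3 - d + fst v + snd v) = N - (u3 + r)"
      by (auto simp: u1_def u2_def u3_def r N)
    have sg: "(- 1 :: complex) powi (3 * r - (m1 + m2 + m3))
       * ((- 1) powi (u1 + r) * (- 1) powi (u2 + r) * (- 1) powi (u3 + r)) = 1"
    proof -
      have "(u1 + r) + (u2 + r) + (u3 + r) = 3 * r - (m1 + m2 + m3)"
        by (simp add: u1_def u2_def u3_def)
      then have "(- 1 :: complex) powi (u1 + r) * (- 1) powi (u2 + r) * (- 1) powi (u3 + r) = (- 1) powi (3 * r - (m1 + m2 + m3))"
        by (metis power_int_add add.inverse_inverse one_neq_zero neg_equal_0_iff_equal)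
      then show ?thesis by (simp add: power_int_mult_distrib[symmetric])
    qed
    have "(m1 + m2 + m3) * r - 3 * tri r + (tri (u1 + r) + tri (u2 + r) + tri (u3 + r))
       = tri u1 + tri u2 + tri u3"
      unfolding tri_add by (simp add: u1_def u2_def u3_def algebra_simps)
    then have qs: "Q ((m1 + m2 + m3) * r - 3 * tri r) * (Q (tri (u1 + r)) * Q (tri (u2 + r)) * Q (tri (u3 + r)))
       = Q (tri u1 + tri u2 + tri u3)" by (simp only: Q_add[symmetric])
    have "c * ct_summand N (m1 - r) (m2 - r) (m3 - r) v =
      ((- 1) powi (3 * r - (m1 + m2 + m3)) * ((- 1) powi (u1 + r) * (- 1) powi (u2 + r) * (- 1) powi (u3 + r)))
      * kappa v
      * (Q ((m1 + m2 + m3) * r - 3 * tri r) * (Q (tri (u1 + r)) * Q (tri (u2 + r)) * Q (tri (u3 + r))))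
      * (I (u1 + r) * I (u2 + r) * I (u3 + r) * I (N - (u1 + r)) * I (N - (u2 + r)) * I (N - (u3 + r)) / I N)"
      unfolding c_def ct_summand_def qcoeff_def u by (simp add: mult_ac)
    then show ?thesis unfolding sg qs Phi_def p N(1)[symmetric] u1_def[symmetric] u2_def[symmetric] u3_def[symmetric]
      by simp
  qed
  ultimately show ?thesis unfolding c_def by simp
qed

lemma has_sum_zeroI: "(\<And>x. x \<in> A \<Longrightarrow> f x = 0) \<Longrightarrow> s = 0 \<Longrightarrow> (f has_sum s) A"
  using has_sum_0[of A f] by simp

text \<open>The instance with weight rho and \<open>t = d = 0\<close>. The evaluation
  \<open>ct_rho\<close> needs \<open>r \<ge> 0\<close> and the division by \<open>I N\<close> needs
  \<open>N \<ge> 0\<close>; in the excluded cases every \<open>Phi\<close> is 0, as is the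
  right-hand side.\<close>

lemma expansion_rho:
  "((\<lambda>v. kappa v * Q (half_norm v + 1 - (2 * fst v + snd v))
        * Phi 0 (1 - fst v) (- snd v) (- 1 + fst v + snd v) x)
     has_sum I (fst x) * I (snd x) * I (fst x + snd x)) UNIV"
proof (cases "fst x < 0 \<or> fst x + snd x < 0")
  case True
  have "Phi 0 (1 - fst v) (- snd v) (- 1 + fst v + snd v) x = 0" for v :: "int \<times> int"
    using True by (intro Phi_eq_0) auto
  then show ?thesis using True by (intro has_sum_zeroI) (auto simp: I_neg)
next
  case False
  define r N where "r = fst x" and "N = fst x + snd x"
  have ex: "tri (fst v - 1) + tri (snd v - 0) + tri (- fst v - snd v - - 1) = half_norm v + 1 - (2 * fst v + snd v)"
    for v :: "int \<times> int"
  proof -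
    have "2 * (tri (fst v - 1) + tri (snd v - 0) + tri (- fst v - snd v - - 1)) = 2 * (half_norm v + 1 - (2 * fst v + snd v))"
      unfolding distrib_left two_tri half_norm_def by (simp add: algebra_simps power2_eq_square)
    then show ?thesis by simp
  qed
  have "(- 1) powi (3 * r - (1 + 0 + - 1)) * Q ((1 + 0 + - 1) * r - 3 * tri r) / I N * ct N (1 - r) (0 - r) (- 1 - r)
     = I (fst x) * I (snd x) * I (fst x + snd x)"
  proof -
    have sgn: "(- 1 :: complex) powi (3 * r) * (- 1) powi r = 1"
    proof -
      have "(- 1 :: complex) powi (3 * r) * (- 1) powi r = (- 1) powi (2 * (2 * r))"
        by (subst power_int_add[symmetric]) simp_all
      then show ?thesis by (simp add: power_int_mult)
    qed
    have qq: "Q (- (3 * tri r)) * Q (3 * tri r) = 1" by (subst Q_add[symmetric]) simp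
    have iN: "I N \<noteq> 0" using False by (intro I_nz) (auto simp: N_def)
    have "N - r = snd x" by (simp add: N_def r_def)
    moreover have "ct N (1 - r) (0 - r) (- 1 - r) = (- 1) powi r * Q (3 * tri r) * I r * I (N - r) * I N ^ 2"
      using ct_rho[of r N] False by (simp add: r_def)
    ultimately have "(- 1) powi (3 * r) * Q (- (3 * tri r)) / I N * ct N (1 - r) (0 - r) (- 1 - r)
       = ((- 1) powi (3 * r) * (- 1) powi r) * (Q (- (3 * tri r)) * Q (3 * tri r)) * I r * I (snd x) * (I N ^ 2 / I N)"
      by simp
    also have "\<dots> = I r * I (snd x) * I N"
      using sgn qq iN by (simp add: power2_eq_square)
    finally show ?thesis by (simp add: r_def N_def)
  qed
  with Phi_has_sum_ct[of N x 0 r 0 1 0 "- 1"] False show ?thesis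
    unfolding ex by (simp add: r_def N_def)
qed

abbreviation G0 :: "int \<times> int \<Rightarrow> complex" where
  "G0 x \<equiv> I (fst x) * I (snd x) * I (fst x + snd x + 1)"

text \<open>The weight \<open>(2, 0, -1)\<close> brings the factor \<open>1 - Q (- r)\<close>, which
  up to a power of \<open>q\<close> lowers \<open>I r\<close> to \<open>I (r - 1)\<close>. Taking
  \<open>r\<close> one larger than \<open>fst x\<close> turns this into \<open>I (fst x)\<close>,
  while \<open>t = 1\<close> raises the index of the third factor to
  \<open>fst x + snd x + 1\<close>. Together they give the innermost factor
  \<open>G0\<close>.\<close>

lemma expansion_mu_aux:
  assumes "fst x \<ge> 0" "N = fst x + snd x + 1" "N \<ge> 0" and r: "r = fst x + 1"
  shows "(- 1) powi (3 * r - 1) * Q (r - 3 * tri r) / I N * ct N (2 - r) (- r) (- 1 - r) = q * G0 x"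
proof -
  have "(- 1 :: complex) powi (3 * r - 1) * (- 1) powi r = - 1"
  proof -
    have "(- 1 :: complex) powi (3 * r - 1) * (- 1) powi r = (- 1) powi (2 * (2 * r - 1) + 1)"
      by (subst power_int_add[symmetric]) (simp_all add: algebra_simps)
    then show ?thesis by (subst (asm) power_int_add) (simp_all add: power_int_mult)
  qed
  moreover have s2: "(- 1 :: complex) powi r * (- 1) powi r = 1"
    by (simp add: power_int_mult_distrib[symmetric])
  ultimately have sg: "(- 1 :: complex) powi (3 * r - 1) = - ((- 1) powi r)"
    by (metis mult.assoc mult_minus1 mult.right_neutral)
  have qs: "Q (r - 3 * tri r) = Q r / Q (3 * tri r)" by (simp add: Q_diff)
  have iN: "I N \<noteq> 0" using assms by (intro I_nz)
  have ir: "I (fst x) = (1 - Q r) * I r" using I_pred[of r] by (simp add: r)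
  have nr: "N - r = snd x" using assms by simp
  have "(- 1) powi (3 * r - 1) * Q (r - 3 * tri r) / I N * ct N (2 - r) (- r) (- 1 - r)
     = - ((- 1) powi r * (- 1) powi r) * (Q (r - 3 * tri r) * Q (3 * tri r))
        * (q * (1 - Q (- r))) * I r * I (snd x) * (I N ^ 2 / I N)"
    unfolding ct_2_0_m1 sg using ct_rho[of r N] assms by (simp add: nr)
  also have "\<dots> = - Q r * (q * (1 - Q (- r))) * I r * I (snd x) * I N"
    unfolding s2 qs using iN by (simp add: power2_eq_square)
  also have "\<dots> = q * G0 x"
    unfolding ir by (simp add: assms(2) power_int_minus field_simps)
  finally show ?thesis .
qed

lemma expansion_mu0:
  "((\<lambda>v. kappa v * Q (half_norm v - (3 * fst v + snd v) + 2)
        * Phi 1 (1 - fst v) (- 1 - snd v) (- 2 + fst v + snd v) x)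
     has_sum G0 x) UNIV"
proof (cases "fst x < 0 \<or> fst x + snd x + 1 < 0")
  case True
  have "Phi 1 (1 - fst v) (- 1 - snd v) (- 2 + fst v + snd v) x = 0" for v :: "int \<times> int"
    using True by (cases "fst x < 0"; intro Phi_eq_0) auto
  then show ?thesis using True by (intro has_sum_zeroI) (auto simp: I_neg)
next
  case False
  define r N where "r = fst x + 1" and "N = fst x + snd x + 1"
  have ex: "tri (fst v - 2) + tri (snd v - 0) + tri (- fst v - snd v - - 1) = half_norm v - (3 * fst v + snd v) + 2 + 1"
    for v :: "int \<times> int"
  proof -
    have "2 * (tri (fst v - 2) + tri (snd v - 0) + tri (- fst v - snd v - - 1)) = 2 * (half_norm v - (3 * fst v + snd v) + 2 + 1)"
      unfolding distrib_left two_tri half_norm_def by (simp add: algebra_simps power2_eq_square)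
    then show ?thesis by simp
  qed
  have "((\<lambda>v. kappa v * Q (half_norm v - (3 * fst v + snd v) + 2 + 1)
        * Phi 1 (1 - fst v) (- 1 - snd v) (- 2 + fst v + snd v) x)
     has_sum q * G0 x) UNIV"
    using Phi_has_sum_ct[of N x 1 r 1 2 0 "- 1"] False expansion_mu_aux[of x N r]
    unfolding ex by (simp add: r_def N_def)
  from has_sum_cmult_right[OF this[unfolded Q_add[where n = 1]], of "1 / q"] show ?thesis
    by (simp add: mult.assoc)
qed

text \<open>Passing from the weight \<open>(2, 0, -1)\<close> to \<open>(2, 1, -2)\<close> costs the
  factor \<open>- Q (N + 1 - r)\<close>, and \<open>N + 1 - r = snd x + 1\<close>. So the linear
  term in the second component for \<sigma> = 1 comes from the initial expansion and not from the
  Bailey steps.\<close>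

lemma expansion_mu1:
  "((\<lambda>v. - kappa v * Q (half_norm v - (4 * fst v + 3 * snd v) + 3)
        * Phi 1 (1 - fst v) (- snd v) (- 3 + fst v + snd v) x)
     has_sum Q (snd x) * G0 x) UNIV"
proof (cases "fst x < 0 \<or> fst x + snd x + 1 < 0")
  case True
  have "Phi 1 (1 - fst v) (- snd v) (- 3 + fst v + snd v) x = 0" for v :: "int \<times> int"
    using True by (cases "fst x < 0"; intro Phi_eq_0) auto
  then show ?thesis using True by (intro has_sum_zeroI) (auto simp: I_neg)
next
  case False
  define r N where "r = fst x + 1" and "N = fst x + snd x + 1"
  have ex: "tri (fst v - 2) + tri (snd v - 1) + tri (- fst v - snd v - - 2) = half_norm v - (4 * fst v + 3 * snd v) + 3 + 2"
    for v :: "int \<times> int"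
  proof -
    have "2 * (tri (fst v - 2) + tri (snd v - 1) + tri (- fst v - snd v - - 2)) = 2 * (half_norm v - (4 * fst v + 3 * snd v) + 3 + 2)"
      unfolding distrib_left two_tri half_norm_def by (simp add: algebra_simps power2_eq_square)
    then show ?thesis by simp
  qed
  have E: "ct N (2 - r) (1 - r) (- 2 - r) = - Q (snd x + 1) * ct N (2 - r) (- r) (- 1 - r)"
  proof -
    have "N + (1 - r) = snd x + 1" by (simp add: N_def r_def)
    then show ?thesis unfolding ct_2_1_m2 ct_2_1_m1 by (metis Q_add mult.assoc mult_minus_left mult_minus_right)
  qed
  have "((\<lambda>v. kappa v * Q (half_norm v - (4 * fst v + 3 * snd v) + 3 + 2)
        * Phi 1 (1 - fst v) (- snd v) (- 3 + fst v + snd v) x)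
     has_sum (- 1) powi (3 * r - 1) * Q (r - 3 * tri r) / I N * ct N (2 - r) (1 - r) (- 2 - r)) UNIV"
    using Phi_has_sum_ct[of N x 1 r 1 2 1 "- 2"] False
    unfolding ex by (simp add: r_def N_def)
  also have "(- 1) powi (3 * r - 1) * Q (r - 3 * tri r) / I N * ct N (2 - r) (1 - r) (- 2 - r)
     = - Q (snd x + 1) * ((- 1) powi (3 * r - 1) * Q (r - 3 * tri r) / I N * ct N (2 - r) (- r) (- 1 - r))"
    unfolding E by simp
  also have "\<dots> = - Q (snd x + 1) * (q * G0 x)"
    using False by (subst expansion_mu_aux[of x N r]) (auto simp: r_def N_def)
  finally have "((\<lambda>v. kappa v * Q (half_norm v - (4 * fst v + 3 * snd v) + 3 + 2)
        * Phi 1 (1 - fst v) (- snd v) (- 3 + fst v + snd v) x) has_sum - Q (snd x + 1) * (q * G0 x)) UNIV" .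
  from has_sum_cmult_right[OF this[unfolded Q_add[where n = 2] Q_add[where n = 1]], of "- 1 / Q 2"]
  show ?thesis by (simp add: power2_eq_square mult.assoc)
qed

end

section \<open>Conversion between the expansions and iteration\<close>

lemma has_sum_finite_sum:
  fixes f :: "'b \<Rightarrow> 'a \<Rightarrow> 'c :: {topological_comm_monoid_add}"
  assumes "finite J" "\<And>j. j \<in> J \<Longrightarrow> (f j has_sum s j) A"
  shows "((\<lambda>x. \<Sum>j\<in>J. f j x) has_sum (\<Sum>j\<in>J. s j)) A"
  using assms by (induction J rule: finite_induct) (auto intro: has_sum_add)

context qbase
begin

text \<open>Antisymmetrisation over the Weyl group of A2, which permutes the three coordinates
  \<open>x\<close>, \<open>y\<close>, \<open>- x - y\<close>.\<close>

definition alternate :: "(int \<times> int \<Rightarrow> complex) \<Rightarrow> int \<times> int \<Rightarrow> complex" where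
  "alternate f v = (case v of (x, y) \<Rightarrow>
     f (x, y) - f (y, x) - f (x, - x - y) + f (y, - x - y) + f (- x - y, x) - f (- x - y, y))"

lemma kappa_swap12_has_sum:
  assumes "((\<lambda>v. kappa v * w (half_norm v) * f v) has_sum S) UNIV"
  shows "((\<lambda>v. kappa v * w (half_norm v) * - f (snd v, fst v)) has_sum S) UNIV"
proof -
  have "((\<lambda>v. kappa (prod.swap v) * w (half_norm (prod.swap v)) * f (prod.swap v)) has_sum S) UNIV"
    using assms by (subst (asm) has_sum_reindex_bij_betw[of prod.swap UNIV UNIV, symmetric]) (auto simp: bij_swap)
  moreover have "kappa (prod.swap v) * w (half_norm (prod.swap v)) * f (prod.swap v)
      = kappa v * w (half_norm v) * - f (snd v, fst v)" for v
  proof -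
    obtain a b where v: "v = (a, b)" by force
    show ?thesis unfolding v swap_simp kappa_swap12[of b a] half_norm_swap12[of b a] by simp
  qed
  ultimately show ?thesis by simp
qed

lemma kappa_swap23_has_sum:
  assumes "((\<lambda>v. kappa v * w (half_norm v) * f v) has_sum S) UNIV"
  shows "((\<lambda>v. kappa v * w (half_norm v) * - f (fst v, - fst v - snd v)) has_sum S) UNIV"
proof -
  define g :: "int \<times> int \<Rightarrow> int \<times> int" where "g v = (fst v, - fst v - snd v)" for v
  have "bij g" by (rule o_bij[of g]) (auto simp: g_def)
  then have "((\<lambda>v. kappa (g v) * w (half_norm (g v)) * f (g v)) has_sum S) UNIV"
    using assms by (subst (asm) has_sum_reindex_bij_betw[of g UNIV UNIV, symmetric]) auto
  moreover have "kappa (g v) * w (half_norm (g v)) * f (g v) = kappa v * w (half_norm v) * - f (fst v, - fst v - snd v)" for v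
    unfolding g_def kappa_swap23 half_norm_swap23 by simp
  ultimately show ?thesis by simp
qed

text \<open>Since \<open>kappa\<close> is antisymmetric and \<open>half_norm\<close> invariant, each
  of the six signed permutations of \<open>f\<close> has the same sum.\<close>

lemma kappa_alternate_has_sum:
  assumes "((\<lambda>v. kappa v * w (half_norm v) * f v) has_sum S) UNIV"
  shows "((\<lambda>v. kappa v * w (half_norm v) * alternate f v) has_sum 6 * S) UNIV"
proof -
  note 1 = kappa_swap12_has_sum[OF assms] and 2 = kappa_swap23_has_sum[OF assms]
  note 12 = kappa_swap12_has_sum[OF 2] and 21 = kappa_swap23_has_sum[OF 1]
  note 121 = kappa_swap12_has_sum[OF 21]
  have "((\<lambda>v. kappa v * w (half_norm v) * f v + kappa v * w (half_norm v) * - f (snd v, fst v)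
     + kappa v * w (half_norm v) * - f (fst v, - fst v - snd v)
     + kappa v * w (half_norm v) * - (- f (snd v, - snd v - fst v))
     + kappa v * w (half_norm v) * - (- f (- fst v - snd v, fst v))
     + kappa v * w (half_norm v) * - (- (- f (- snd v - fst v, snd v)))) has_sum (S + S + S + S + S + S)) UNIV"
    using has_sum_add[OF has_sum_add[OF has_sum_add[OF has_sum_add[OF has_sum_add[OF assms 1] 2] 12] 21] 121]
    by simp
  moreover have "kappa v * w (half_norm v) * f v + kappa v * w (half_norm v) * - f (snd v, fst v)
     + kappa v * w (half_norm v) * - f (fst v, - fst v - snd v)
     + kappa v * w (half_norm v) * - (- f (snd v, - snd v - fst v))
     + kappa v * w (half_norm v) * - (- f (- fst v - snd v, fst v))
     + kappa v * w (half_norm v) * - (- (- f (- snd v - fst v, snd v))) = kappa v * w (half_norm v) * alternate f v" for v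
  proof -
    obtain x y where v: "v = (x, y)" by force
    have e: "- y - x = - x - y" by simp
    show ?thesis unfolding alternate_def v fst_conv snd_conv prod.case e
      by (simp only: ring_distribs mult_minus_left mult_minus_right minus_minus diff_conv_add_uminus minus_add_distrib)
  qed
  ultimately show ?thesis by simp
qed

text \<open>The Vandermonde determinant, or Weyl denominator, in the powers \<open>Q (- v)\<close>
  of the three coordinates.\<close>

definition delta :: "int \<times> int \<Rightarrow> complex" where
  "delta = alternate (\<lambda>v. Q (- (2 * fst v + snd v)))"

text \<open>In three coordinates the parameters are rho minus \<open>v\<close>, with sum 0.\<close>

definition PhiA :: "int \<times> int \<Rightarrow> int \<times> int \<Rightarrow> complex" where
  "PhiA v r = Phi 0 (1 - fst v) (- snd v) (- 1 + fst v + snd v) r"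

text \<open>All three parameters have the form \<open>- 1 - v\<close>, applied to each coordinate,
  so the function is symmetric. Its expansions therefore carry the antisymmetric
  \<open>delta\<close> besides \<open>kappa\<close>.\<close>

definition PhiB :: "int \<times> int \<Rightarrow> int \<times> int \<Rightarrow> complex" where
  "PhiB v r = Phi 2 (- 1 - fst v) (- 1 - snd v) (- 1 + fst v + snd v) r"

text \<open>The left-hand side is the 3 by 3 determinant of three quadratic polynomials at three
  points. Hence it is the determinant of their coefficients times the Vandermonde determinant of the
  points.\<close>

lemma determinant_identity:
  fixes A B p :: complex
  defines "g1 \<equiv> \<lambda>X. (X - A) * (X - A * p)" and "g0 \<equiv> \<lambda>X. (X - A) * (1 - B * X)"
    and "gm \<equiv> \<lambda>X. (1 - B * X) * (1 - B * X * p)"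
  shows "g1 X * g0 Y * gm Z - g1 Y * g0 X * gm Z - g1 X * g0 Z * gm Y
       + g1 Y * g0 Z * gm X + g1 Z * g0 X * gm Y - g1 Z * g0 Y * gm X
     = (1 - A * B) * (1 - A * B * p)\<^sup>2 *
       (X\<^sup>2 * Y - Y\<^sup>2 * X - X\<^sup>2 * Z + Y\<^sup>2 * Z + Z\<^sup>2 * X - Z\<^sup>2 * Y)"
  unfolding g1_def g0_def gm_def by algebra

text \<open>Every pair of factorials in \<open>PhiA\<close> is the corresponding symmetric pair
  \<open>u v\<close> of \<open>PhiB\<close> times \<open>g1\<close>, \<open>g0\<close> or
  \<open>gm\<close> at \<open>X v\<close>, up to powers of \<open>X v\<close> that
  \<open>Q (- (2 * fst v + snd v))\<close> cancels. Antisymmetrising thus affects only the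
  determinant.\<close>

lemma PhiA_alternate:
  assumes "fst r \<ge> 0" "snd r \<ge> 0"
  shows "alternate (\<lambda>v. Q (- (2 * fst v + snd v)) * PhiA v r) v
      = (1 - Q (fst r + snd r + 1)) * delta v * PhiB v r"
proof -
  obtain x y where v: "v = (x, y)" by force
  obtain m n where r: "r = (m, n)" by force
  define z where "z = - x - y"
  define A B p where "A = Q (m + 1)" and "B = Q (n + 1)" and "p = 1 / q"
  define X where "X = (\<lambda>v. Q (- v))"
  have Xnz: "X u \<noteq> 0" for u by (simp add: X_def)
  define u where "u = (\<lambda>v. I (m + 1 + v) * I (n + 1 - v))"
  define g1 g0 gm where "g1 = (\<lambda>X. (X - A) * (X - A * p))" and "g0 = (\<lambda>X. (X - A) * (1 - B * X))"
    and "gm = (\<lambda>X. (1 - B * X) * (1 - B * X * p))"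
  have qq: "Q (m + v + 1) = A / X v" "Q (m + v) = A * p / X v" "Q (n - v + 1) = B * X v" "Q (n - v) = B * X v * p" for v
    by (simp_all add: A_def B_def p_def X_def Q_add Q_diff power_int_minus field_simps)
  have Im: "I (m + v) = (1 - A / X v) * I (m + 1 + v)" for v
    using I_rec[of "m + v"] unfolding qq by (simp add: add_ac)
  have Im': "I (m + v - 1) = (1 - A * p / X v) * ((1 - A / X v) * I (m + 1 + v))" for v
    unfolding I_pred[of "m + v"] Im qq ..
  have In: "I (n - v) = (1 - B * X v) * I (n + 1 - v)" for v
    using I_rec[of "n - v"] unfolding qq by (simp add: algebra_simps)
  have In': "I (n - v - 1) = (1 - B * X v * p) * ((1 - B * X v) * I (n + 1 - v))" for v
    unfolding I_pred[of "n - v"] In qq ..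
  have s1: "I (m - (1 - v)) * I (n + 0 + (1 - v)) = g1 (X v) / (X v)\<^sup>2 * u v" for v
  proof -
    have e: "m - (1 - v) = m + v - 1" "n + 0 + (1 - v) = n + 1 - v" by auto
    show ?thesis unfolding g1_def u_def e Im' using Xnz[of v] by (simp add: field_simps power2_eq_square)
  qed
  have s0: "I (m - - v) * I (n + 0 + - v) = g0 (X v) / X v * u v" for v
    unfolding g0_def u_def using Xnz[of v] by (simp add: Im In field_simps)
  have sm: "I (m - (- 1 - v)) * I (n + 0 + (- 1 - v)) = gm (X v) * u v" for v
  proof -
    have e: "m - (- 1 - v) = m + 1 + v" "n + 0 + (- 1 - v) = n - v - 1" by auto
    show ?thesis unfolding gm_def u_def e In' by (simp only: mult_ac)
  qed
  have PA: "Q (- (2 * a + b)) * PhiA (a, b) r = g1 (X a) * g0 (X b) * gm (X c) * (u a * u b * u c / I (m + n))"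
    if "c = - a - b" for a b c
  proof -
    have c: "- 1 + a + b = - 1 - c" using that by simp
    have "- (2 * a + b) = - a + - a + - b" by simp
    then have Qe: "Q (- (2 * a + b)) = X a * X a * X b" by (simp only: Q_add X_def)
    have "PhiA (a, b) r = (I (m - (1 - a)) * I (n + 0 + (1 - a))) * (I (m - - b) * I (n + 0 + - b))
        * (I (m - (- 1 - c)) * I (n + 0 + (- 1 - c))) / I (m + n)"
      unfolding PhiA_def Phi_def fst_conv snd_conv c r by (simp add: mult_ac)
    also have "\<dots> = (g1 (X a) / (X a)\<^sup>2 * u a) * (g0 (X b) / X b * u b) * (gm (X c) * u c) / I (m + n)"
      unfolding s1 s0 sm ..
    finally show ?thesis unfolding Qe using Xnz[of a] Xnz[of b] by (simp add: power2_eq_square)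
  qed
  have d: "Q (- (2 * a + b)) = (X a)\<^sup>2 * X b" for a b
  proof -
    have "- (2 * a + b) = - a + - a + - b" by simp
    then show ?thesis by (simp only: Q_add X_def power2_eq_square)
  qed
  have delta: "delta v = (X x)\<^sup>2 * X y - (X y)\<^sup>2 * X x - (X x)\<^sup>2 * X z + (X y)\<^sup>2 * X z + (X z)\<^sup>2 * X x - (X z)\<^sup>2 * X y"
    unfolding delta_def alternate_def v prod.case fst_conv snd_conv d z_def[symmetric] ..
  have "alternate (\<lambda>v. Q (- (2 * fst v + snd v)) * PhiA v r) v
    = (g1 (X x) * g0 (X y) * gm (X z) - g1 (X y) * g0 (X x) * gm (X z) - g1 (X x) * g0 (X z) * gm (X y)
       + g1 (X y) * g0 (X z) * gm (X x) + g1 (X z) * g0 (X x) * gm (X y) - g1 (X z) * g0 (X y) * gm (X x))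
      * (u x * u y * u z / I (m + n))"
  proof -
    have zs: "z = - x - y" "z = - y - x" "y = - x - z" "x = - y - z" "y = - z - x" "x = - z - y"
      by (auto simp: z_def)
    show ?thesis
      unfolding alternate_def v prod.case fst_conv snd_conv z_def[symmetric]
        PA[OF zs(1)] PA[OF zs(2)] PA[OF zs(3)] PA[OF zs(4)] PA[OF zs(5)] PA[OF zs(6)]
      by (simp add: ring_distribs mult_ac)
  qed
  also have "\<dots> = (1 - A * B) * (1 - A * B * p)\<^sup>2 * delta v * (u x * u y * u z / I (m + n))"
    unfolding g1_def g0_def gm_def determinant_identity delta ..
  \<comment> \<open>Replacing \<open>I (m + n)\<close> in the denominator by
    \<open>I (m + n + 2)\<close> cancels \<open>1 - A * B\<close> and one of the two factors
    \<open>1 - A * B * p\<close>. The other one is the numerator factor of the first family.\<close>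
  also have "\<dots> = (1 - Q (m + n + 1)) * delta v * (u x * u y * u z / I (m + n + 2))"
  proof -
    have ab: "A * B = Q (m + n + 2)" "A * B * p = Q (m + n + 1)"
      by (simp_all add: A_def B_def p_def Q_add power2_eq_square)
    have "I (m + n) = (1 - Q (m + n + 1)) * ((1 - Q (m + n + 2)) * I (m + n + 2))"
      using I_rec[of "m + n"] I_rec[of "m + n + 1"] by (simp add: add.assoc)
    moreover have "1 - Q (m + n + 1) \<noteq> 0" "1 - Q (m + n + 2) \<noteq> 0"
      using assms Q_inj[of "m + n + 1"] Q_inj[of "m + n + 2"] by (auto simp: r)
    ultimately show ?thesis unfolding ab(2) unfolding ab(1) by (simp add: power2_eq_square)
  qed
  also have "u x * u y * u z / I (m + n + 2) = PhiB v r"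
  proof -
    have e: "m - (- 1 - x) = m + 1 + x" "m - (- 1 - y) = m + 1 + y" "m - (- 1 + x + y) = m + 1 + z"
      "n + 2 + (- 1 - x) = n + 1 - x" "n + 2 + (- 1 - y) = n + 1 - y" "n + 2 + (- 1 + x + y) = n + 1 - z"
      by (auto simp: z_def)
    show ?thesis unfolding PhiB_def Phi_def v r fst_conv snd_conv e u_def by (simp add: mult_ac)
  qed
  finally show ?thesis by (simp add: r)
qed

text \<open>The coordinates add up to 0, so for \<open>v \<noteq> (0, 0)\<close> one is at most -1
  and one at least 1, and some index is negative. At \<open>v = (0, 0)\<close> the function need not
  vanish, for example at \<open>r = (- 1, - 1)\<close>; there \<open>kappa\<close> does.\<close>

lemma kappa_PhiB_eq_0:
  assumes "fst r < 0 \<or> snd r < 0"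
  shows "kappa v * PhiB v r = 0"
proof (cases "v = (0, 0)")
  case True
  then show ?thesis by (simp add: kappa_def eps_def)
next
  case False
  then have *: "fst v < 0 \<or> snd v < 0 \<or> - fst v - snd v < 0" "fst v > 0 \<or> snd v > 0 \<or> - fst v - snd v > 0"
    by (cases v; auto)+
  have "fst r - (- 1 - fst v) < 0 \<or> fst r - (- 1 - snd v) < 0 \<or> fst r - (- 1 + fst v + snd v) < 0
    \<or> snd r + 2 + (- 1 - fst v) < 0 \<or> snd r + 2 + (- 1 - snd v) < 0 \<or> snd r + 2 + (- 1 + fst v + snd v) < 0"
    using assms * by linarith
  then show ?thesis by (auto simp: PhiB_def Phi_def I_neg)
qed

lemma PhiA_summable: "(\<lambda>v. c v * PhiA v r) summable_on UNIV"
proof (rule finite_nonzero_values_imp_summable_on)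
  have "{v. c v * PhiA v r \<noteq> 0} \<subseteq> {1 - fst r..2 * fst r + 1} \<times> {- fst r..2 * fst r}"
  proof
    fix v assume "v \<in> {v. c v * PhiA v r \<noteq> 0}"
    then have "I (fst r - (1 - fst v)) \<noteq> 0" "I (fst r - - snd v) \<noteq> 0" "I (fst r - (- 1 + fst v + snd v)) \<noteq> 0"
      by (auto simp: PhiA_def Phi_def)
    then have "fst r - (1 - fst v) \<ge> 0" "fst r - - snd v \<ge> 0" "fst r - (- 1 + fst v + snd v) \<ge> 0"
      using I_neg linorder_not_less by blast+
    then show "v \<in> {1 - fst r..2 * fst r + 1} \<times> {- fst r..2 * fst r}" by (cases v) auto
  qed
  then show "finite {v \<in> UNIV. c v * PhiA v r \<noteq> 0}" by (simp add: finite_subset)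
qed

text \<open>The change of functions in the middle of the chain. Antisymmetrising the unknown sum
  over \<open>PhiA\<close> gives six times that sum, and by \<open>PhiA_alternate\<close> it is also
  the given sum over \<open>PhiB\<close> times the numerator factor. If a component of
  \<open>r\<close> is negative, both sums vanish.\<close>

lemma PhiB_to_PhiA:
  assumes "((\<lambda>v. kappa v * delta v * w (half_norm v) * PhiB v r) has_sum 6 * S) UNIV"
  shows "((\<lambda>v. kappa v * w (half_norm v) * Q (- (2 * fst v + snd v)) * PhiA v r)
           has_sum (1 - Q (fst r + snd r + 1)) * S) UNIV"
proof (cases "fst r \<ge> 0 \<and> snd r \<ge> 0")
  case True
  define T where "T = infsum (\<lambda>v. kappa v * w (half_norm v) * (Q (- (2 * fst v + snd v)) * PhiA v r)) UNIV"
  have T: "((\<lambda>v. kappa v * w (half_norm v) * (Q (- (2 * fst v + snd v)) * PhiA v r)) has_sum T) UNIV"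
    unfolding T_def using PhiA_summable[of "\<lambda>v. kappa v * w (half_norm v) * Q (- (2 * fst v + snd v))"]
    by (simp add: mult.assoc)
  have "((\<lambda>v. kappa v * w (half_norm v) * ((1 - Q (fst r + snd r + 1)) * delta v * PhiB v r)) has_sum 6 * T) UNIV"
    using kappa_alternate_has_sum[OF T] unfolding PhiA_alternate[OF conjunct1[OF True] conjunct2[OF True]] .
  moreover have "((\<lambda>v. (1 - Q (fst r + snd r + 1)) * (kappa v * delta v * w (half_norm v) * PhiB v r))
      has_sum (1 - Q (fst r + snd r + 1)) * (6 * S)) UNIV"
    by (intro has_sum_cmult_right assms)
  ultimately have "6 * T = (1 - Q (fst r + snd r + 1)) * (6 * S)"
    by (intro has_sum_unique) (simp_all add: mult_ac)
  then have "T = (1 - Q (fst r + snd r + 1)) * S" by simp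
  then show ?thesis using T by (simp add: mult.assoc)
next
  case False
  then have z: "kappa v * PhiB v r = 0" for v by (intro kappa_PhiB_eq_0) auto
  have "kappa v * delta v * w (half_norm v) * PhiB v r = 0" for v
    using z[of v] by auto
  then have "6 * S = 0" using has_sum_unique[OF assms, of 0] by (simp add: has_sum_0)
  moreover have "PhiA v r = 0" for v
    unfolding PhiA_def using False by (intro Phi_eq_0) auto
  ultimately show ?thesis by (intro has_sum_zeroI) auto
qed

text \<open>Antisymmetrising \<open>expansion_rho\<close> produces the factor
  \<open>1 - Q (fst r + snd r + 1)\<close> on the side of \<open>PhiB\<close>. The same factor
  relates \<open>I (fst r + snd r)\<close> to the last factor of \<open>G0\<close>, so it
  cancels.\<close>

lemma expansion_PhiB:
  "((\<lambda>v. kappa v * delta v * Q (half_norm v + 1) * PhiB v r) has_sum 6 * G0 r) UNIV"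
proof (cases "fst r \<ge> 0 \<and> snd r \<ge> 0")
  case True
  let ?c = "1 - Q (fst r + snd r + 1)"
  have nz: "?c \<noteq> 0" using True Q_inj[of "fst r + snd r + 1"] by auto
  have IN: "I (fst r + snd r) = ?c * I (fst r + snd r + 1)" by (rule I_rec)
  have eq: "kappa v * Q (half_norm v + 1 - (2 * fst v + snd v)) = kappa v * Q (half_norm v + 1) * Q (- (2 * fst v + snd v))" for v
    by (simp only: diff_conv_add_uminus Q_add mult.assoc)
  have "((\<lambda>v. kappa v * Q (half_norm v + 1) * (Q (- (2 * fst v + snd v)) * PhiA v r)) has_sum ?c * G0 r) UNIV"
    using expansion_rho[of r] unfolding eq PhiA_def[symmetric] IN by (simp add: mult_ac)
  from kappa_alternate_has_sum[of "\<lambda>n. Q (n + 1)", OF this]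
  have "((\<lambda>v. kappa v * Q (half_norm v + 1) * (?c * delta v * PhiB v r)) has_sum 6 * (?c * G0 r)) UNIV"
    unfolding PhiA_alternate[OF conjunct1[OF True] conjunct2[OF True]] .
  from has_sum_cmult_right[OF this, of "1 / ?c"] show ?thesis
    using nz by (simp add: mult_ac)
next
  case False
  then have z: "kappa v * PhiB v r = 0" for v by (intro kappa_PhiB_eq_0) auto
  have "kappa v * delta v * Q (half_norm v + 1) * PhiB v r = 0" for v using z[of v] by auto
  then show ?thesis using False by (intro has_sum_zeroI) (auto simp: I_neg)
qed

text \<open>Because \<open>s\<close> does not depend on \<open>v\<close>, all summands share one
  weight in \<open>r\<close>. The bounds on \<open>s\<close> and \<open>t\<close> confine the
  supports to components at least -1, so for fixed \<open>L\<close> only a finite sum over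
  \<open>r\<close> is interchanged with the sum over \<open>v\<close>.\<close>

lemma Bailey_step:
  assumes s: "\<And>v. a1 v + a2 v + a3 v = s" and s3: "- 3 \<le> s" "3 * t + s \<le> 3"
    and G: "\<And>r. ((\<lambda>v. c v * Phi t (a1 v) (a2 v) (a3 v) r) has_sum G r) UNIV"
  shows "((\<lambda>v. c v * Q (- (a1 v * a2 v + a1 v * a3 v + a2 v * a3 v) - t\<^sup>2 - t * s)
              * Phi t (a1 v) (a2 v) (a3 v) L)
     has_sum (\<Sum>\<^sub>\<infinity>r. inv_qfac2 q (vdiff L r) *
                (Q (halfvCv r - (s + t) * fst r + (2 * t + s) * snd r) * G r))) UNIV"
proof -
  define J where "J = {- 1..fst L} \<times> {- 1..snd L}"
  define w where "w r = Q (halfvCv r - (s + t) * fst r + (2 * t + s) * snd r)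
            * I (fst L - fst r) * I (snd L - snd r)" for r
  have wG: "inv_qfac2 q (vdiff L r) * (Q (halfvCv r - (s + t) * fst r + (2 * t + s) * snd r) * G r) = w r * G r" for r
    by (simp add: w_def inv_qfac2_def vdiff_def mult_ac)
  have G0: "G r = 0" if "fst r < - 1 \<or> snd r < - 1" for r
  proof -
    have "Phi t (a1 v) (a2 v) (a3 v) r = 0" for v
      using that s[of v] s3 by (intro Phi_eq_0) linarith
    then show ?thesis using has_sum_unique[OF G[of r], of 0] by (simp add: has_sum_0)
  qed
  have "(\<Sum>\<^sub>\<infinity>r. w r * G r) = (\<Sum>\<^sub>\<infinity>r\<in>J. w r * G r)"
  proof (rule infsum_cong_neutral)
    fix r assume "r \<in> UNIV - J"
    then have "fst r < - 1 \<or> snd r < - 1 \<or> fst L - fst r < 0 \<or> snd L - snd r < 0"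
      by (cases r) (auto simp: J_def)
    then have "G r = 0 \<or> I (fst L - fst r) = 0 \<or> I (snd L - snd r) = 0"
      using G0[of r] I_neg by blast
    then show "w r * G r = 0" by (auto simp: w_def)
  qed auto
  also have "\<dots> = (\<Sum>r\<in>J. w r * G r)" by (rule infsum_finite) (simp add: J_def)
  finally have inf: "(\<Sum>\<^sub>\<infinity>r. w r * G r) = (\<Sum>r\<in>J. w r * G r)" .
  have "((\<lambda>v. \<Sum>r\<in>J. w r * (c v * Phi t (a1 v) (a2 v) (a3 v) r)) has_sum (\<Sum>r\<in>J. w r * G r)) UNIV"
    by (intro has_sum_finite_sum has_sum_cmult_right G) (simp add: J_def)
  moreover have "(\<Sum>r\<in>J. w r * (c v * Phi t (a1 v) (a2 v) (a3 v) r)) =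
     c v * Q (- (a1 v * a2 v + a1 v * a3 v + a2 v * a3 v) - t\<^sup>2 - t * s) * Phi t (a1 v) (a2 v) (a3 v) L" for v
  proof -
    have "(\<Sum>r\<in>J. w r * Phi t (a1 v) (a2 v) (a3 v) r)
      = Q (- (a1 v * a2 v + a1 v * a3 v + a2 v * a3 v) - t\<^sup>2 - t * s) * Phi t (a1 v) (a2 v) (a3 v) (fst L, snd L)"
      unfolding J_def w_def using s3 by (intro Bailey_transform s) auto
    then show ?thesis by (simp add: sum_distrib_left[symmetric] mult_ac)
  qed
  ultimately show ?thesis unfolding wG inf by simp
qed

end

section \<open>Limits and the Jacobi triple product\<close>

text \<open>Tannery's theorem for unordered sums. A finite set that carries the dominating sum up to
  \<open>e / 4\<close> bounds both tails, and on the finite set termwise limits suffice.\<close>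

lemma tannery_infsum:
  fixes f :: "nat \<Rightarrow> 'a \<Rightarrow> complex"
  assumes lim: "\<And>x. x \<in> A \<Longrightarrow> (\<lambda>n. f n x) \<longlonglongrightarrow> g x"
    and le: "\<And>n x. x \<in> A \<Longrightarrow> norm (f n x) \<le> h x"
    and h: "h summable_on A"
  shows "(\<lambda>n. infsum (f n) A) \<longlonglongrightarrow> infsum g A" "g summable_on A"
proof -
  have gle: "norm (g x) \<le> h x" if "x \<in> A" for x
    using lim[OF that] le[OF that] by (intro tendsto_upperbound[OF tendsto_norm]) auto
  have sumA: "k summable_on B" if "B \<subseteq> A" "\<And>x. x \<in> A \<Longrightarrow> norm (k x) \<le> h x" for k :: "'a \<Rightarrow> complex" and B
  proof -
    have hB: "h summable_on B" using h that(1) by (rule summable_on_subset_banach)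
    have "(\<lambda>x. norm (k x)) summable_on B"
      by (rule summable_on_comparison_test[OF hB]) (use that in auto)
    then show ?thesis by (rule abs_summable_summable)
  qed
  show "g summable_on A" using gle by (intro sumA) auto
  show "(\<lambda>n. infsum (f n) A) \<longlonglongrightarrow> infsum g A"
  proof (rule metric_LIMSEQ_I)
    fix e :: real assume "e > 0"
    obtain F where F: "finite F" "F \<subseteq> A" "dist (sum h F) (infsum h A) \<le> e / 4"
      using has_sum_finite_approximation[OF has_sum_infsum[OF h], of "e / 4"] \<open>e > 0\<close> by auto
    have hd: "infsum h (A - F) \<le> e / 4"
    proof -
      have "infsum h (F \<union> (A - F)) = infsum h F + infsum h (A - F)"
        using F h by (intro infsum_Un_disjoint summable_on_subset_banach[OF h]) auto
      moreover have "F \<union> (A - F) = A" using F by auto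
      ultimately have "infsum h A = sum h F + infsum h (A - F)" using F by simp
      then show ?thesis using F(3) by (simp add: dist_real_def)
    qed
    have tail: "norm (infsum k A - sum k F) \<le> e / 4" if "\<And>x. x \<in> A \<Longrightarrow> norm (k x) \<le> h x" for k :: "'a \<Rightarrow> complex"
    proof -
      have "infsum k (F \<union> (A - F)) = infsum k F + infsum k (A - F)"
        using F that by (intro infsum_Un_disjoint sumA) auto
      moreover have "F \<union> (A - F) = A" using F by auto
      ultimately have "infsum k A - sum k F = infsum k (A - F)" using F by simp
      also have "norm \<dots> \<le> infsum h (A - F)"
        using that by (intro norm_infsum_le[OF has_sum_infsum has_sum_infsum] sumA summable_on_subset_banach[OF h]) auto
      finally show ?thesis using hd by simp
    qed
    have "(\<lambda>n. sum (f n) F) \<longlonglongrightarrow> sum g F" using F lim by (intro tendsto_sum) auto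
    then obtain N where N: "\<And>n. n \<ge> N \<Longrightarrow> dist (sum (f n) F) (sum g F) < e / 4"
      using \<open>e > 0\<close> by (metis metric_LIMSEQ_D zero_less_divide_iff zero_less_numeral)
    show "\<exists>N. \<forall>n\<ge>N. dist (infsum (f n) A) (infsum g A) < e"
    proof (intro exI[of _ N] allI impI)
      fix n assume "n \<ge> N"
      have "norm (infsum (f n) A - sum (f n) F) \<le> e / 4" by (rule tail) (rule le)
      moreover have "norm (infsum g A - sum g F) \<le> e / 4" by (rule tail) (rule gle)
      moreover have "norm (sum (f n) F - sum g F) < e / 4" using N[OF \<open>n \<ge> N\<close>] by (simp add: dist_norm)
      moreover have "norm (infsum (f n) A - infsum g A)
          = norm ((infsum (f n) A - sum (f n) F) + (sum (f n) F - sum g F) - (infsum g A - sum g F))"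
        by simp
      ultimately have "norm (infsum (f n) A - infsum g A) < e"
        using norm_triangle_ineq4[of "(infsum (f n) A - sum (f n) F) + (sum (f n) F - sum g F)" "infsum g A - sum g F"]
          norm_triangle_ineq[of "infsum (f n) A - sum (f n) F" "sum (f n) F - sum g F"] \<open>e > 0\<close>
        by linarith
      then show "dist (infsum (f n) A) (infsum g A) < e" by (simp add: dist_norm)
    qed
  qed
qed

lemma has_sum_product:
  fixes f :: "'a \<Rightarrow> complex" and g :: "'b \<Rightarrow> complex"
  assumes f: "(f has_sum a) A" and g: "(g has_sum b) B"
  shows "((\<lambda>(x, y). f x * g y) has_sum a * b) (A \<times> B)"
proof (rule has_sum_SigmaI)
  show "((\<lambda>y. case (x, y) of (x, y) \<Rightarrow> f x * g y) has_sum f x * b) B" for x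
    using has_sum_cmult_right[OF g] by simp
  show "((\<lambda>x. f x * b) has_sum a * b) A" by (rule has_sum_cmult_left[OF f])
  have f': "(\<lambda>x. norm (f x)) summable_on A" and g': "(\<lambda>x. norm (g x)) summable_on B"
    using f g summable_on_iff_abs_summable_on_complex has_sum_imp_summable by blast+
  have "(\<lambda>z. norm (case z of (x, y) \<Rightarrow> f x * g y)) summable_on A \<times> B"
  proof (rule iffD2[OF Infinite_Sum.abs_summable_on_Sigma_iff], intro conjI ballI)
    show "(\<lambda>y. norm (case (x, y) of (x, y) \<Rightarrow> f x * g y)) summable_on B" for x
      using summable_on_cmult_right[OF g', of "norm (f x)"] by (simp add: norm_mult)
    have "(\<lambda>x. norm (f x) * infsum (\<lambda>y. norm (g y)) B) summable_on A"
      by (rule summable_on_cmult_left[OF f'])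
    moreover have "infsum (\<lambda>y. norm (case (x, y) of (x, y) \<Rightarrow> f x * g y)) B = norm (f x) * infsum (\<lambda>y. norm (g y)) B" for x
      by (simp add: norm_mult infsum_cmult_right')
    moreover have "infsum (\<lambda>y. norm (g y)) B \<ge> 0" by (intro infsum_nonneg) simp
    ultimately show "(\<lambda>x. norm (infsum (\<lambda>y. norm (case (x, y) of (x, y) \<Rightarrow> f x * g y)) B)) summable_on A"
      by (simp add: abs_mult)
  qed
  then show "(\<lambda>(x, y). f x * g y) summable_on A \<times> B" by (rule abs_summable_summable)
qed

lemma summable_on_geometric_int:
  fixes c :: real
  assumes "0 \<le> c" "c < 1"
  shows "(\<lambda>n :: int. c ^ nat \<bar>n\<bar>) summable_on UNIV"
proof -
  have nat: "(\<lambda>n :: nat. c ^ n) summable_on UNIV"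
    using assms by (subst summable_on_UNIV_nonneg_real_iff) (auto intro: summable_geometric)
  have "(\<lambda>n :: int. c ^ nat \<bar>n\<bar>) summable_on range int"
    by (subst summable_on_reindex) (use nat in \<open>auto simp: o_def\<close>)
  moreover have "(\<lambda>n :: int. c ^ nat \<bar>n\<bar>) summable_on range (\<lambda>n. - int n)"
    by (subst summable_on_reindex) (use nat in \<open>auto simp: o_def inj_on_def\<close>)
  moreover have "range int \<union> range (\<lambda>n. - int n) = UNIV"
    by (auto simp: image_iff) (metis int_cases2)
  ultimately show ?thesis using summable_on_union by metis
qed

section \<open>Infinite q-products\<close>

lemma prod_qpoch_LIMSEQ:
  fixes x p :: complex
  assumes "norm p < 1"
  shows "(\<lambda>n. \<Prod>j<n. 1 - x * p ^ j) \<longlonglongrightarrow> qpoch_inf x p"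
    and "(\<And>j. x * p ^ j \<noteq> 1) \<Longrightarrow> qpoch_inf x p \<noteq> 0"
proof -
  have "summable (\<lambda>j. norm x * norm p ^ j)"
    using assms by (intro summable_mult summable_geometric) simp
  then have "abs_convergent_prod (\<lambda>j. 1 - x * p ^ j)"
    unfolding abs_convergent_prod_conv_summable by (simp add: norm_mult norm_power)
  then have c: "convergent_prod (\<lambda>j. 1 - x * p ^ j)" by (rule abs_convergent_prod_imp_convergent_prod)
  show "(\<lambda>n. \<Prod>j<n. 1 - x * p ^ j) \<longlonglongrightarrow> qpoch_inf x p"
    using convergent_prod_LIMSEQ[OF c] unfolding qpoch_inf_def
    by (subst LIMSEQ_lessThan_iff_atMost[of "\<lambda>A. \<Prod>j\<in>A. 1 - x * p ^ j"])
  show "(\<And>j. x * p ^ j \<noteq> 1) \<Longrightarrow> qpoch_inf x p \<noteq> 0"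
  proof -
    assume nz: "\<And>j. x * p ^ j \<noteq> 1"
    have "1 - x * p ^ j \<noteq> 0" for j using nz[of j] by auto
    then show ?thesis unfolding qpoch_inf_def by (intro prodinf_nonzero c)
  qed
qed

lemma qpoch_inf_split:
  assumes "norm p < 1"
  shows "qpoch_inf x p = (1 - x) * qpoch_inf (x * p) p"
proof -
  have "(\<lambda>n. \<Prod>j<Suc n. 1 - x * p ^ j) \<longlonglongrightarrow> qpoch_inf x p"
    using prod_qpoch_LIMSEQ(1)[OF assms] by (rule LIMSEQ_Suc)
  moreover have "(\<Prod>j<Suc n. 1 - x * p ^ j) = (1 - x) * (\<Prod>j<n. 1 - x * p * p ^ j)" for n
    by (subst prod.lessThan_Suc_shift) (simp add: mult_ac)
  moreover have "(\<lambda>n. (1 - x) * (\<Prod>j<n. 1 - x * p * p ^ j)) \<longlonglongrightarrow> (1 - x) * qpoch_inf (x * p) p"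
    by (intro tendsto_mult tendsto_const prod_qpoch_LIMSEQ(1) assms)
  ultimately show ?thesis using LIMSEQ_unique by simp
qed

lemma qpoch_inf_trisect:
  assumes "norm p < 1"
  shows "qpoch_inf p p = qpoch_inf (p ^ 3) (p ^ 3) * qpoch_inf p (p ^ 3) * qpoch_inf (p ^ 2) (p ^ 3)"
proof -
  have p3: "norm (p ^ 3) < 1" using assms by (simp add: norm_power power_less_one_iff)
  have "(\<lambda>n. \<Prod>j<3 * n. 1 - p * p ^ j) \<longlonglongrightarrow> qpoch_inf p p"
    by (rule LIMSEQ_subseq_LIMSEQ[OF prod_qpoch_LIMSEQ(1)[OF assms], of "\<lambda>n. 3 * n", unfolded o_def])
       (simp add: strict_mono_def)
  moreover have "(\<Prod>j<3 * n. 1 - p * p ^ j)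
      = (\<Prod>j<n. 1 - p ^ 3 * (p ^ 3) ^ j) * (\<Prod>j<n. 1 - p * (p ^ 3) ^ j) * (\<Prod>j<n. 1 - p ^ 2 * (p ^ 3) ^ j)" for n
  proof (induction n)
    case (Suc n)
    have "3 * Suc n = Suc (Suc (Suc (3 * n)))" by simp
    then have "(\<Prod>j<3 * Suc n. 1 - p * p ^ j) = (\<Prod>j<3 * n. 1 - p * p ^ j)
        * (1 - p * p ^ (3 * n)) * (1 - p * p ^ (3 * n + 1)) * (1 - p * p ^ (3 * n + 2))"
      by (simp only: prod.lessThan_Suc) simp
    moreover have "p ^ 3 * (p ^ 3) ^ n = p * p ^ (3 * n + 2)" "p * (p ^ 3) ^ n = p * p ^ (3 * n)"
      "p ^ 2 * (p ^ 3) ^ n = p * p ^ (3 * n + 1)"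
      by (simp_all add: power_mult power_add power2_eq_square power3_eq_cube)
    ultimately show ?case unfolding Suc by (simp only: prod.lessThan_Suc mult_ac)
  qed simp
  moreover have "(\<lambda>n. (\<Prod>j<n. 1 - p ^ 3 * (p ^ 3) ^ j) * (\<Prod>j<n. 1 - p * (p ^ 3) ^ j) * (\<Prod>j<n. 1 - p ^ 2 * (p ^ 3) ^ j))
     \<longlonglongrightarrow> qpoch_inf (p ^ 3) (p ^ 3) * qpoch_inf p (p ^ 3) * qpoch_inf (p ^ 2) (p ^ 3)"
    by (intro tendsto_mult prod_qpoch_LIMSEQ(1) p3)
  ultimately show ?thesis using LIMSEQ_unique by simp
qed

context qbase
begin

section \<open>Limits and bounds for factorials and for \<open>Phi\<close>\<close>

abbreviation P :: complex where "P \<equiv> qpoch_inf q q"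

definition theta :: "complex \<Rightarrow> complex" where
  "theta z = qpoch_inf z q * qpoch_inf (q / z) q"

lemma P_nz: "P \<noteq> 0"
proof (rule prod_qpoch_LIMSEQ(2)[OF q_lt1])
  show "q * q ^ j \<noteq> 1" for j
    using Q_inj[of "int j + 1"] by (simp add: power_int_def nat_add_distrib)
qed

lemma I_int: "I (int n) = 1 / (\<Prod>j<n. 1 - q * q ^ j)"
  by (simp add: inv_qfac_def)

lemma I_LIMSEQ: "(\<lambda>n. I (int n)) \<longlonglongrightarrow> 1 / P"
  unfolding I_int by (intro tendsto_divide tendsto_const prod_qpoch_LIMSEQ q_lt1 P_nz)

lemma I_tendsto: "(I \<longlongrightarrow> 1 / P) at_top"
proof -
  have "((\<lambda>n. I (int (nat n))) \<longlongrightarrow> 1 / P) at_top"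
  proof (rule filterlim_compose[OF I_LIMSEQ])
    show "filterlim nat sequentially at_top" by (rule filterlim_nat_sequentially)
  qed
  moreover have "\<forall>\<^sub>F n in at_top. I (int (nat n)) = I n"
    using eventually_ge_at_top[of "0 :: int"] by eventually_elim simp
  ultimately show ?thesis by (rule Lim_transform_eventually)
qed

lemma I_shift_LIMSEQ:
  assumes "c > 0"
  shows "(\<lambda>n. I (c * int n + d)) \<longlonglongrightarrow> 1 / P"
proof (rule filterlim_compose[OF I_tendsto])
  show "filterlim (\<lambda>n. c * int n + d) at_top sequentially"
    unfolding filterlim_at_top
  proof
    fix Z :: int
    show "\<forall>\<^sub>F n in sequentially. Z \<le> c * int n + d"
    proof (rule eventually_sequentiallyI)
      fix n assume n: "nat (\<bar>Z\<bar> + \<bar>d\<bar>) \<le> n"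
      have "int n \<le> c * int n" using assms by (simp add: mult_le_cancel_right1)
      then show "Z \<le> c * int n + d" using n by linarith
    qed
  qed
qed

lemma I_bounded: "\<exists>K > 0. \<forall>n. norm (I n) \<le> K"
proof -
  obtain K where K: "K > 0" "\<And>n. norm (I (int n)) \<le> K"
    using convergent_imp_Bseq[OF convergentI[OF I_LIMSEQ]] unfolding Bseq_def by blast
  have "norm (I n) \<le> K" for n
    using K(1) K(2)[of "nat n"] by (cases "n \<ge> 0") (auto simp: I_neg)
  with K(1) show ?thesis by blast
qed

lemma inverse_I_bounded: "\<exists>K > 0. \<forall>n. norm (1 / I n) \<le> K"
proof -
  have *: "(\<lambda>n. 1 / I (int n)) \<longlonglongrightarrow> 1 / (1 / P)"
    using P_nz by (intro tendsto_divide tendsto_const I_LIMSEQ) simp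
  obtain K where K: "K > 0" "\<And>n. norm (1 / I (int n)) \<le> K"
    using convergent_imp_Bseq[OF convergentI[OF *]] unfolding Bseq_def by blast
  have "norm (1 / I n) \<le> K" for n
    using K(1) K(2)[of "nat n"] by (cases "n \<ge> 0") (auto simp: I_neg)
  with K(1) show ?thesis by blast
qed

lemma Phi_LIMSEQ: "(\<lambda>n. Phi t a1 a2 a3 (int n, int n)) \<longlonglongrightarrow> 1 / P ^ 5"
proof -
  have "Phi t a1 a2 a3 (int n, int n) = I (1 * int n + - a1) * I (1 * int n + - a2) * I (1 * int n + - a3)
     * I (1 * int n + (t + a1)) * I (1 * int n + (t + a2)) * I (1 * int n + (t + a3)) / I (2 * int n + t)" for n
    by (simp add: Phi_def add.assoc)
  moreover have "(\<lambda>n. I (1 * int n + - a1) * I (1 * int n + - a2) * I (1 * int n + - a3)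
     * I (1 * int n + (t + a1)) * I (1 * int n + (t + a2)) * I (1 * int n + (t + a3)) / I (2 * int n + t))
     \<longlonglongrightarrow> 1 / P * (1 / P) * (1 / P) * (1 / P) * (1 / P) * (1 / P) / (1 / P)"
    using P_nz by (intro tendsto_mult tendsto_divide I_shift_LIMSEQ) auto
  moreover have "1 / P * (1 / P) * (1 / P) * (1 / P) * (1 / P) * (1 / P) / (1 / P) = 1 / P ^ 5"
    by (simp add: eval_nat_numeral)
  ultimately show ?thesis by simp
qed

lemma Phi_bounded: "\<exists>K > 0. \<forall>t a1 a2 a3 r. norm (Phi t a1 a2 a3 r) \<le> K"
proof -
  obtain K where K: "K > 0" "\<And>n. norm (I n) \<le> K" using I_bounded by blast
  obtain K' where K': "K' > 0" "\<And>n. norm (1 / I n) \<le> K'" using inverse_I_bounded by blast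
  have "norm (Phi t a1 a2 a3 r) \<le> K * K * K * K * K * K * K'" for t a1 a2 a3 r
  proof -
    have "norm (Phi t a1 a2 a3 r) = norm (I (fst r - a1)) * norm (I (fst r - a2)) * norm (I (fst r - a3))
     * norm (I (snd r + t + a1)) * norm (I (snd r + t + a2)) * norm (I (snd r + t + a3)) * norm (1 / I (fst r + snd r + t))"
      by (simp add: Phi_def norm_mult norm_divide)
    also have "\<dots> \<le> K * K * K * K * K * K * K'"
      using K K' by (intro mult_mono mult_nonneg_nonneg norm_ge_zero) (auto intro: less_imp_le)
    finally show ?thesis .
  qed
  then show ?thesis using K K' by (intro exI[of _ "K * K * K * K * K * K * K'"]) auto
qed

section \<open>Absolute convergence of theta-like sums\<close>

lemma norm_Q_powr: "norm (Q n) = norm q powr n"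
  using q_nz by (simp add: norm_power_int powr_real_of_int')

text \<open>An exponent with at least linear growth is dominated by a product of two geometric
  series, whose ratio is the real root of \<open>norm q\<close> of order \<open>D\<close>.\<close>

lemma Q_summable:
  assumes "D > 0" and e: "\<And>v :: int \<times> int. D * e v \<ge> \<bar>fst v\<bar> + \<bar>snd v\<bar> - c"
  shows "(\<lambda>v. norm (Q (e v))) summable_on UNIV"
proof -
  define \<rho> where "\<rho> = norm q powr (1 / D)"
  have q0: "norm q > 0" by simp
  have \<rho>: "0 < \<rho>" "\<rho> < 1"
    using q_lt1 assms(1) q0 powr_less_mono2[of "1 / D" "norm q" 1] unfolding \<rho>_def by auto
  have \<rho>n: "\<rho> ^ nat \<bar>x\<bar> = norm q powr (\<bar>x\<bar> / D)" for x :: int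
    using \<rho>(1) by (subst powr_realpow[symmetric]) (simp_all add: \<rho>_def powr_powr)
  have "((\<lambda>(x, y). complex_of_real (\<rho> ^ nat \<bar>x\<bar>) * complex_of_real (\<rho> ^ nat \<bar>y\<bar>))
      has_sum (\<Sum>\<^sub>\<infinity>x :: int. complex_of_real (\<rho> ^ nat \<bar>x\<bar>)) * (\<Sum>\<^sub>\<infinity>x :: int. complex_of_real (\<rho> ^ nat \<bar>x\<bar>))) (UNIV \<times> UNIV)"
    using \<rho> by (intro has_sum_product has_sum_infsum summable_on_of_real summable_on_geometric_int) auto
  then have "(\<lambda>z. norm (case z of (x, y) \<Rightarrow> complex_of_real (\<rho> ^ nat \<bar>x\<bar>) * complex_of_real (\<rho> ^ nat \<bar>y\<bar>)))
      summable_on (UNIV \<times> UNIV :: (int \<times> int) set)"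
    using summable_on_iff_abs_summable_on_complex has_sum_imp_summable by blast
  then have "(\<lambda>v :: int \<times> int. \<rho> ^ nat \<bar>fst v\<bar> * \<rho> ^ nat \<bar>snd v\<bar>) summable_on UNIV"
    using \<rho> by (simp add: case_prod_unfold norm_mult norm_power)
  then have s: "(\<lambda>v :: int \<times> int. norm q powr (- c / D) * (\<rho> ^ nat \<bar>fst v\<bar> * \<rho> ^ nat \<bar>snd v\<bar>)) summable_on UNIV"
    by (rule summable_on_cmult_right)
  show ?thesis
  proof (rule summable_on_comparison_test[OF s])
    fix v :: "int \<times> int"
    have "real_of_int (D * e v) \<ge> real_of_int (\<bar>fst v\<bar> + \<bar>snd v\<bar> - c)" using e by (simp only: of_int_le_iff)
    then have "(real_of_int \<bar>fst v\<bar> + real_of_int \<bar>snd v\<bar> - c) / D \<le> real_of_int (e v)"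
      using assms(1) by (subst pos_divide_le_eq) (simp_all add: mult.commute)
    then have "real_of_int (e v) \<ge> - c / D + (\<bar>fst v\<bar> / D + \<bar>snd v\<bar> / D)"
      by (simp add: diff_divide_distrib add_divide_distrib)
    then have "norm (Q (e v)) \<le> norm q powr (- c / D + (\<bar>fst v\<bar> / D + \<bar>snd v\<bar> / D))"
      unfolding norm_Q_powr using q0 q_lt1 by (intro powr_mono') auto
    then show "norm (Q (e v)) \<le> norm q powr (- c / D) * (\<rho> ^ nat \<bar>fst v\<bar> * \<rho> ^ nat \<bar>snd v\<bar>)"
      unfolding \<rho>n powr_add .
  qed simp
qed

lemma weight_summable:
  assumes "l1 \<in> {0, 1}" "l2 \<in> {0, 1}"
  shows "(\<lambda>v. norm (Q (halfvCv v + l1 * fst v + l2 * snd v))) summable_on UNIV"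
\<comment> \<open>Twice the form dominates the sum of the two squares, and a square is at least
  \<open>3 * |x| - 4\<close>. The doubled linear terms cost at most
  \<open>2 * |x| + 2 * |y|\<close>, which leaves \<open>|x| + |y| - 8\<close>.\<close>
proof (rule Q_summable[where D = 2 and c = 8])
  fix v :: "int \<times> int"
  obtain x y where v: "v = (x, y)" by force
  have "2 * halfvCv v = x\<^sup>2 + y\<^sup>2 + (x - y)\<^sup>2"
    by (simp add: v halfvCv_def power2_eq_square algebra_simps)
  then have h: "2 * halfvCv v \<ge> x\<^sup>2 + y\<^sup>2" by simp
  have sq: "x\<^sup>2 \<ge> 3 * \<bar>x\<bar> - 4" for x :: int
  proof -
    have "0 \<le> (\<bar>x\<bar> - 2) * (\<bar>x\<bar> - 2) + \<bar>x\<bar>" by (intro add_nonneg_nonneg zero_le_square abs_ge_zero)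
    also have "\<dots> = x\<^sup>2 - 3 * \<bar>x\<bar> + 4" by (simp add: power2_eq_square algebra_simps)
    finally show ?thesis by simp
  qed
  have "2 * (l1 * x) \<ge> - 2 * \<bar>x\<bar>" "2 * (l2 * y) \<ge> - 2 * \<bar>y\<bar>" using assms by auto
  then show "\<bar>fst v\<bar> + \<bar>snd v\<bar> - 8 \<le> 2 * (halfvCv v + l1 * fst v + l2 * snd v)"
    using h sq[of x] sq[of y] by (simp add: v)
qed simp

lemma triple_product_summable:
  assumes "z \<noteq> 0"
  shows "(\<lambda>n :: int. norm (z powi n * Q (tri n))) summable_on UNIV"
proof -
  have q0: "norm q > 0" by simp
  obtain k1 where k1: "norm q ^ k1 < norm z" using real_arch_pow_inv[of "norm z" "norm q"] q_lt1 assms by auto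
  obtain k2 where k2: "norm q ^ k2 < 1 / norm z" using real_arch_pow_inv[of "1 / norm z" "norm q"] q_lt1 assms by auto
  define k where "k = k1 + k2"
  have k: "norm q ^ k \<le> norm z" "norm q ^ k \<le> 1 / norm z"
  proof -
    have "norm q ^ k \<le> norm q ^ k1" "norm q ^ k \<le> norm q ^ k2"
      using q_lt1 by (intro power_decreasing; simp add: k_def)+
    then show "norm q ^ k \<le> norm z" "norm q ^ k \<le> 1 / norm z" using k1 k2 by linarith+
  qed
  have zn: "norm (z powi n) \<le> (1 / norm q ^ k) ^ nat \<bar>n\<bar>" for n :: int
  proof (cases "n \<ge> 0")
    case True
    have "norm z \<le> 1 / norm q ^ k" using k(2) assms q0 by (simp add: field_simps)
    then show ?thesis using True by (simp add: norm_power norm_inverse power_int_def power_mono)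
  next
    case False
    have "inverse (norm z) \<le> 1 / norm q ^ k" using k(1) assms q0 by (simp add: field_simps)
    then show ?thesis using False by (simp add: norm_power norm_inverse power_int_def power_mono)
  qed
  \<comment> \<open>The powers of \<open>z\<close> cost at most \<open>k * |n|\<close> in the
    exponent of \<open>norm q\<close>, and one more \<open>|n|\<close> is kept for a geometric
    series. Completing a square centred at \<open>2 * k + 3\<close> shows that \<open>tri n\<close>
    affords both up to this constant.\<close>
  define c where "c = (2 * int k + 3)\<^sup>2"
  have tri: "tri n \<ge> int k * \<bar>n\<bar> + \<bar>n\<bar> - c" for n
  proof -
    have "0 \<le> (\<bar>n\<bar> - (2 * int k + 3))\<^sup>2 + \<bar>n\<bar> * (2 * int k + 3) + (2 * int k + 3)\<^sup>2 + (\<bar>n\<bar> - n)"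
      by (intro add_nonneg_nonneg) auto
    also have "\<dots> = n * (n - 1) - 2 * (int k * \<bar>n\<bar> + \<bar>n\<bar> - (2 * int k + 3)\<^sup>2)"
      by (simp add: power2_eq_square algebra_simps)
    finally show ?thesis using two_tri[of n] by (simp add: c_def)
  qed
  have bound: "norm (z powi n * Q (tri n)) \<le> norm (Q (- c)) * norm q ^ nat \<bar>n\<bar>" for n
  proof -
    have "norm (z powi n * Q (tri n)) \<le> (1 / norm q ^ k) ^ nat \<bar>n\<bar> * norm (Q (int k * \<bar>n\<bar> + (- c + \<bar>n\<bar>)))"
      unfolding norm_mult using tri[of n] by (intro mult_mono zn norm_Q_le) auto
    also have "norm (Q (int k * \<bar>n\<bar> + (- c + \<bar>n\<bar>))) = (norm q ^ k) ^ nat \<bar>n\<bar> * (norm (Q (- c)) * norm q ^ nat \<bar>n\<bar>)"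
    proof -
      have "Q (int k * \<bar>n\<bar>) = (q ^ k) ^ nat \<bar>n\<bar>"
        by (metis abs_ge_zero nat_0_le power_int_mult power_int_of_nat)
      moreover have "Q \<bar>n\<bar> = q ^ nat \<bar>n\<bar>" by (simp add: power_int_def)
      ultimately show ?thesis by (simp only: Q_add norm_mult norm_power)
    qed
    also have "(1 / norm q ^ k) ^ nat \<bar>n\<bar> * \<dots> = norm (Q (- c)) * norm q ^ nat \<bar>n\<bar>"
      using q0 by (simp add: power_divide)
    finally show ?thesis .
  qed
  have "(\<lambda>n :: int. norm (Q (- c)) * norm q ^ nat \<bar>n\<bar>) summable_on UNIV"
    using q_lt1 by (intro summable_on_cmult_right summable_on_geometric_int) auto
  then show ?thesis by (rule summable_on_comparison_test) (use bound in auto)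
qed

text \<open>Each of \<open>stepN\<close> and \<open>stepM\<close> appends one factor to the product:
  multiply the sum by it, shift the summation index in the second part and combine termwise. The
  factor \<open>1 - Q L\<close> so obtained moves the index of \<open>I (int M + int N)\<close> up
  by one.\<close>

lemma finite_triple_product:
  assumes z: "z \<noteq> 0"
  shows "((\<lambda>n. (- 1) powi n * Q (tri n) * z powi n * I (int M + n) * I (int N - n)) has_sum
     I (int M + int N) * (\<Prod>j<N. 1 - z * q ^ j) * (\<Prod>j<M. 1 - q / z * q ^ j)) UNIV"
proof -
  define u where "u n = (- 1) powi n * Q (tri n) * z powi n" for n
  have pm: "(- 1 :: complex) powi (n - 1) = - ((- 1) powi n)" "z powi (n - 1) = z powi n / z"
    "(- 1 :: complex) powi (n + 1) = - ((- 1) powi n)" "z powi (n + 1) = z powi n * z" for n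
    using z by (simp_all add: power_int_diff power_int_add)
  have u_pred: "u (n - 1) = - u n / (z * Q (n - 1))" for n
    unfolding u_def tri_pred Q_diff[of "tri n" "n - 1"] pm by simp
  have tri_suc: "tri (n + 1) = tri n + n" for n by (simp add: tri_add)
  have u_suc: "u (n + 1) = - u n * z * Q n" for n
    unfolding u_def tri_suc Q_add pm by simp
  have shift: "((\<lambda>n. c * f (n + d)) has_sum c * S) UNIV" if "(f has_sum S) UNIV"
    for f :: "int \<Rightarrow> complex" and S c and d :: int
  proof -
    have "bij (\<lambda>n. n + d)" by (rule o_bij[of "\<lambda>n. n - d"]) auto
    then have "((\<lambda>n. f (n + d)) has_sum S) UNIV"
      using that has_sum_reindex_bij_betw[of "\<lambda>n. n + d" UNIV UNIV f S] by simp
    then show ?thesis by (rule has_sum_cmult_right)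
  qed
  have stepN: "((\<lambda>n. u n * I (int M + n) * I (int (Suc N) - n)) has_sum
      I (int M + int (Suc N)) * (\<Prod>j<Suc N. 1 - z * q ^ j) * X) UNIV"
    if h: "((\<lambda>n. u n * I (int M + n) * I (int N - n)) has_sum I (int M + int N) * (\<Prod>j<N. 1 - z * q ^ j) * X) UNIV"
    for M N X
  proof -
    define L where "L = int M + int N + 1"
    define S where "S = I (int M + int N) * (\<Prod>j<N. 1 - z * q ^ j) * X"
    have nz: "1 - Q L \<noteq> 0" using Q_inj[of L] by (simp add: L_def)
    have "((\<lambda>n. u n * I (int M + n) * I (int N - n)
        + - (z * Q (int N)) * (u (n + - 1) * I (int M + (n + - 1)) * I (int N - (n + - 1))))
       has_sum (S + - (z * Q (int N)) * S)) UNIV"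
      unfolding S_def by (intro has_sum_add h shift[OF h])
    moreover have "u n * I (int M + n) * I (int N - n)
        + - (z * Q (int N)) * (u (n + - 1) * I (int M + (n + - 1)) * I (int N - (n + - 1)))
        = (1 - Q L) * (u n * I (int M + n) * I (int (Suc N) - n))" for n
    proof -
      define Z T R where "Z = Q (int N)" and "T = Q n" and "R = Q (int M)"
      have T: "T \<noteq> 0" by (simp add: T_def)
      have e: "n + - 1 = n - 1" "int M + (n - 1) = int M + n - 1" "int N - (n - 1) = int (Suc N) - n"
        "int N - n = int (Suc N) - n - 1" by auto
      have qs: "Q (int M + n) = R * T" "Q (int (Suc N) - n) = Z * q / T" "Q (n - 1) = T / q" "Q L = R * Z * q"
        by (simp_all add: Z_def T_def R_def L_def Q_add Q_diff)
      show ?thesis unfolding e I_pred u_pred qs Z_def[symmetric] using z T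
        by (simp add: field_simps)
    qed
    ultimately have "((\<lambda>n. (1 - Q L) * (u n * I (int M + n) * I (int (Suc N) - n))) has_sum (S + - (z * Q (int N)) * S)) UNIV"
      by simp
    from has_sum_cmult_right[OF this, of "1 / (1 - Q L)"]
    have "((\<lambda>n. u n * I (int M + n) * I (int (Suc N) - n)) has_sum (S + - (z * Q (int N)) * S) / (1 - Q L)) UNIV"
      using nz by (simp add: mult.assoc)
    moreover have "(S + - (z * Q (int N)) * S) / (1 - Q L) = I (int M + int (Suc N)) * (\<Prod>j<Suc N. 1 - z * q ^ j) * X"
    proof -
      have rec: "I (int M + int N) = (1 - Q L) * I (int M + int (Suc N))"
        using I_rec[of "int M + int N"] by (simp add: L_def add_ac)
      have "S + - (z * Q (int N)) * S = (1 - Q L) * (I (int M + int (Suc N)) * (\<Prod>j<Suc N. 1 - z * q ^ j) * X)"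
        unfolding S_def rec by (simp add: algebra_simps)
      then show ?thesis using nz by simp
    qed
    ultimately show ?thesis by simp
  qed
  have stepM: "((\<lambda>n. u n * I (int (Suc M) + n) * I (int N - n)) has_sum
      I (int (Suc M) + int N) * X * (\<Prod>j<Suc M. 1 - q / z * q ^ j)) UNIV"
    if h: "((\<lambda>n. u n * I (int M + n) * I (int N - n)) has_sum I (int M + int N) * X * (\<Prod>j<M. 1 - q / z * q ^ j)) UNIV"
    for M N X
  proof -
    define L where "L = int M + int N + 1"
    define S where "S = I (int M + int N) * X * (\<Prod>j<M. 1 - q / z * q ^ j)"
    have nz: "1 - Q L \<noteq> 0" using Q_inj[of L] by (simp add: L_def)
    have "((\<lambda>n. u n * I (int M + n) * I (int N - n)
        + - (q / z * Q (int M)) * (u (n + 1) * I (int M + (n + 1)) * I (int N - (n + 1))))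
       has_sum (S + - (q / z * Q (int M)) * S)) UNIV"
      unfolding S_def by (intro has_sum_add h shift[OF h])
    moreover have "u n * I (int M + n) * I (int N - n)
        + - (q / z * Q (int M)) * (u (n + 1) * I (int M + (n + 1)) * I (int N - (n + 1)))
        = (1 - Q L) * (u n * I (int (Suc M) + n) * I (int N - n))" for n
    proof -
      define Z T R where "Z = Q (int N)" and "T = Q n" and "R = Q (int M)"
      have T: "T \<noteq> 0" by (simp add: T_def)
      have e: "int M + (n + 1) = int (Suc M) + n" "int N - (n + 1) = int N - n - 1"
        "int M + n = int (Suc M) + n - 1" by auto
      have qs: "Q (int (Suc M) + n) = R * q * T" "Q (int N - n) = Z / T" "Q L = R * Z * q"
        by (simp_all add: Z_def T_def R_def L_def Q_add Q_diff)
      show ?thesis unfolding e unfolding I_pred u_suc qs R_def[symmetric] T_def[symmetric] using z T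
        by (simp add: field_simps)
    qed
    ultimately have "((\<lambda>n. (1 - Q L) * (u n * I (int (Suc M) + n) * I (int N - n))) has_sum (S + - (q / z * Q (int M)) * S)) UNIV"
      by simp
    from has_sum_cmult_right[OF this, of "1 / (1 - Q L)"]
    have "((\<lambda>n. u n * I (int (Suc M) + n) * I (int N - n)) has_sum (S + - (q / z * Q (int M)) * S) / (1 - Q L)) UNIV"
      using nz by (simp add: mult.assoc)
    moreover have "(S + - (q / z * Q (int M)) * S) / (1 - Q L) = I (int (Suc M) + int N) * X * (\<Prod>j<Suc M. 1 - q / z * q ^ j)"
    proof -
      have rec: "I (int M + int N) = (1 - Q L) * I (int (Suc M) + int N)"
        using I_rec[of "int M + int N"] by (simp add: L_def add_ac)
      have "S + - (q / z * Q (int M)) * S = (1 - Q L) * (I (int (Suc M) + int N) * X * (\<Prod>j<Suc M. 1 - q / z * q ^ j))"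
        unfolding S_def rec by (simp add: algebra_simps diff_divide_distrib add_divide_distrib)
      then show ?thesis using nz by simp
    qed
    ultimately show ?thesis by simp
  qed
  have base: "((\<lambda>n. u n * I (int 0 + n) * I (int 0 - n)) has_sum I (int 0 + int 0) * 1 * (\<Prod>j<0. 1 - q / z * q ^ j)) UNIV"
  proof (rule has_sum_finite_neutralI[of "{0}"])
    fix n :: int assume "n \<in> UNIV - {0}"
    then have "n < 0 \<or> - n < 0" by auto
    then show "u n * I (int 0 + n) * I (int 0 - n) = 0" by (auto simp: I_neg)
  qed (auto simp: u_def)
  have M0: "((\<lambda>n. u n * I (int M + n) * I (int 0 - n)) has_sum I (int M + int 0) * 1 * (\<Prod>j<M. 1 - q / z * q ^ j)) UNIV" for M
  proof (induction M)
    case 0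
    show ?case by (rule base)
  next
    case (Suc M)
    then show ?case by (rule stepM)
  qed
  have "((\<lambda>n. u n * I (int M + n) * I (int N - n)) has_sum I (int M + int N) * (\<Prod>j<N. 1 - z * q ^ j) * (\<Prod>j<M. 1 - q / z * q ^ j)) UNIV"
  proof (induction N)
    case 0
    then show ?case using M0[of M] by simp
  next
    case (Suc N)
    then show ?case by (rule stepN)
  qed
  then show ?thesis unfolding u_def .
qed

lemma jacobi_triple_product:
  assumes z: "z \<noteq> 0"
  shows "((\<lambda>n. (- 1) powi n * Q (tri n) * z powi n) has_sum P * theta z) UNIV"
proof -
  obtain K where K: "K > 0" "\<And>n. norm (I n) \<le> K" using I_bounded by blast
  define u where "u n = (- 1) powi n * Q (tri n) * z powi n" for n
  define f where "f N n = u n * I (int N + n) * I (int N - n)" for N n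
  have nu: "norm (u n) = norm (z powi n * Q (tri n))" for n
    by (simp add: u_def norm_mult norm_power_int)
  have su: "u summable_on UNIV"
    using triple_product_summable[OF z] unfolding nu[symmetric] by (rule abs_summable_summable)
  have sh: "(\<lambda>n. norm (z powi n * Q (tri n)) * (K * K)) summable_on UNIV"
    by (intro summable_on_cmult_left triple_product_summable z)
  have "(\<lambda>N. infsum (f N) UNIV) \<longlonglongrightarrow> infsum (\<lambda>n. u n * (1 / P) * (1 / P)) UNIV"
  proof (rule tannery_infsum(1)[OF _ _ sh])
    fix n :: int
    have "(\<lambda>N. u n * I (1 * int N + n) * I (1 * int N + - n)) \<longlonglongrightarrow> u n * (1 / P) * (1 / P)"
      by (intro tendsto_mult tendsto_const I_shift_LIMSEQ) auto
    then show "(\<lambda>N. f N n) \<longlonglongrightarrow> u n * (1 / P) * (1 / P)" by (simp add: f_def)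
  next
    fix N :: nat and n :: int
    have "norm (f N n) = norm (u n) * (norm (I (int N + n)) * norm (I (int N - n)))"
      by (simp add: f_def norm_mult)
    also have "\<dots> \<le> norm (u n) * (K * K)" using K by (intro mult_left_mono mult_mono) (auto intro: less_imp_le)
    finally show "norm (f N n) \<le> norm (z powi n * Q (tri n)) * (K * K)" by (simp add: nu)
  qed
  moreover have "infsum (f N) UNIV = I (2 * int N + 0) * (\<Prod>j<N. 1 - z * q ^ j) * (\<Prod>j<N. 1 - q / z * q ^ j)" for N
  proof -
    have "infsum (f N) UNIV = (\<Sum>\<^sub>\<infinity>n. (- 1) powi n * Q (tri n) * z powi n * I (int N + n) * I (int N - n))"
      by (rule infsum_cong) (simp add: f_def u_def)
    then show ?thesis using infsumI[OF finite_triple_product[OF z, of N N]] by simp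
  qed
  moreover have "(\<lambda>N. I (2 * int N + 0) * (\<Prod>j<N. 1 - z * q ^ j) * (\<Prod>j<N. 1 - q / z * q ^ j))
      \<longlonglongrightarrow> 1 / P * qpoch_inf z q * qpoch_inf (q / z) q"
    by (intro tendsto_mult I_shift_LIMSEQ prod_qpoch_LIMSEQ q_lt1) simp
  ultimately have "infsum (\<lambda>n. u n * (1 / P) * (1 / P)) UNIV = 1 / P * qpoch_inf z q * qpoch_inf (q / z) q"
    using LIMSEQ_unique by simp
  moreover have "infsum (\<lambda>n. u n * (1 / P) * (1 / P)) UNIV = infsum u UNIV * (1 / P * (1 / P))"
    unfolding mult.assoc by (rule infsum_cmult_left') 
  ultimately have "infsum u UNIV = P * theta z"
    using P_nz by (simp add: theta_def field_simps)
  with su show ?thesis unfolding u_def[symmetric] by (metis has_sum_infsum)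
qed

end

section \<open>The A2 Macdonald identity\<close>

context qbase
begin

section \<open>The pentagonal number series and its shifts\<close>

lemma minus_one_powi_even: "even n \<Longrightarrow> (- 1 :: complex) powi n = 1"
  by (auto elim!: evenE simp: power_int_mult)

lemma minus_one_powi_minus: "(- 1 :: complex) powi (- n) = (- 1) powi n"
proof -
  have "(- 1 :: complex) powi (- n) = (- 1) powi (n + 2 * (- n))" by simp
  also have "\<dots> = (- 1) powi n" by (subst power_int_add) (simp_all add: minus_one_powi_even)
  finally show ?thesis .
qed

lemma qbase_power: "m > 0 \<Longrightarrow> qbase (q ^ m)"
  using q_lt1 by unfold_locales (auto simp: norm_power power_less_one_iff)

lemma Q_power: "(q ^ m) powi n = Q (int m * n)"
  by (simp add: power_int_mult)

text \<open>In the product of three theta series, \<open>s\<close> will be the sum of the exponents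
  of \<open>a\<close> and \<open>b\<close>. Shift and reflection reduce it to its residue modulo
  3.\<close>

definition tau :: "int \<Rightarrow> complex" where
  "tau s = (\<Sum>\<^sub>\<infinity>n. (- 1) powi n * Q (3 * tri n + (2 - s) * n))"

lemma tau_triple_product:
  "((\<lambda>n. (- 1) powi n * Q (3 * tri n + (2 - s) * n)) has_sum
     qpoch_inf (q ^ 3) (q ^ 3) * qbase.theta (q ^ 3) (Q (2 - s))) UNIV"
proof -
  interpret c: qbase "q ^ 3" by (rule qbase_power) simp
  have "(q ^ 3) powi tri n * Q (2 - s) powi n = Q (3 * tri n + (2 - s) * n)" for n
    by (simp add: Q_add power_int_mult)
  then show ?thesis using c.jacobi_triple_product[of "Q (2 - s)"] by (simp add: mult.assoc)
qed

lemma tau_has_sum: "((\<lambda>n. (- 1) powi n * Q (3 * tri n + (2 - s) * n)) has_sum tau s) UNIV"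
  unfolding tau_def by (rule has_sum_infsum, rule has_sum_imp_summable, rule tau_triple_product)

text \<open>Euler's pentagonal number theorem: the exponent is \<open>n * (3 * n - 1) / 2\<close>,
  and the triple product in base \<open>q ^ 3\<close> is the trisection of \<open>P\<close>.\<close>

lemma tau_1: "tau 1 = P"
proof -
  interpret c: qbase "q ^ 3" by (rule qbase_power) simp
  have "tau 1 = qpoch_inf (q ^ 3) (q ^ 3) * c.theta (Q (2 - 1))"
    by (rule has_sum_unique[OF tau_has_sum tau_triple_product])
  also have "c.theta (Q (2 - 1)) = qpoch_inf q (q ^ 3) * qpoch_inf (q ^ 2) (q ^ 3)"
  proof -
    have "q ^ 3 / q = q ^ 2" by (simp add: power3_eq_cube power2_eq_square)
    then show ?thesis by (simp add: c.theta_def)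
  qed
  finally show ?thesis using qpoch_inf_trisect[OF q_lt1] by (simp add: mult.assoc)
qed

lemma tau_reflect: "tau (1 - s) = tau s"
proof -
  have "bij (uminus :: int \<Rightarrow> int)" by (rule o_bij[of uminus]) auto
  then have "((\<lambda>n. (- 1) powi (- n) * Q (3 * tri (- n) + (2 - s) * - n)) has_sum tau s) UNIV"
    using tau_has_sum[of s] has_sum_reindex_bij_betw[of uminus UNIV UNIV "\<lambda>n. (- 1) powi n * Q (3 * tri n + (2 - s) * n)"]
    by simp
  moreover have "(- 1) powi (- n) * Q (3 * tri (- n) + (2 - s) * - n)
      = (- 1) powi n * Q (3 * tri n + (2 - (1 - s)) * n)" for n :: int
  proof -
    have "2 * tri (- n) = 2 * (tri n + n)"
      unfolding distrib_left two_tri by (simp add: algebra_simps)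
    then have "3 * tri (- n) + (2 - s) * - n = 3 * tri n + (2 - (1 - s)) * n"
      by (simp add: algebra_simps)
    then show ?thesis by (simp only: minus_one_powi_minus)
  qed
  ultimately show ?thesis using has_sum_unique[OF tau_has_sum] by simp
qed

lemma tau_shift: "tau (s + 3 * m) = (- 1) powi m * Q (3 * tri m - 3 * m * m + (2 - s) * m) * tau s"
proof -
  have bij: "bij (\<lambda>n. n + m)" by (rule o_bij[of "\<lambda>n. n - m"]) auto
  have "((\<lambda>n. (- 1) powi (n + m) * Q (3 * tri (n + m) + (2 - (s + 3 * m)) * (n + m))) has_sum tau (s + 3 * m)) UNIV"
    by (rule iffD2[OF has_sum_reindex_bij_betw[OF bij, of "\<lambda>n. (- 1) powi n * Q (3 * tri n + (2 - (s + 3 * m)) * n)"]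
          tau_has_sum])
  moreover have "(- 1) powi (n + m) * Q (3 * tri (n + m) + (2 - (s + 3 * m)) * (n + m))
     = ((- 1) powi m * Q (3 * tri m - 3 * m * m + (2 - s) * m)) * ((- 1) powi n * Q (3 * tri n + (2 - s) * n))" for n
  proof -
    have "3 * tri (n + m) + (2 - (s + 3 * m)) * (n + m)
      = (3 * tri m - 3 * m * m + (2 - s) * m) + (3 * tri n + (2 - s) * n)"
      unfolding tri_add by (simp add: algebra_simps)
    then have "Q (3 * tri (n + m) + (2 - (s + 3 * m)) * (n + m))
      = Q (3 * tri m - 3 * m * m + (2 - s) * m) * Q (3 * tri n + (2 - s) * n)"
      by (simp only: Q_add)
    then show ?thesis by (simp add: power_int_add)
  qed
  ultimately show ?thesis
    using has_sum_unique[OF has_sum_cmult_right[OF tau_has_sum[of s], of "(- 1) powi m * Q (3 * tri m - 3 * m * m + (2 - s) * m)"]]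
    by simp
qed

lemma tau_0: "tau 0 = P"
  using tau_reflect[of 1] tau_1 by simp

lemma tau_2: "tau 2 = 0"
proof -
  have "tau 2 = tau (- 1 + 3 * 1)" by simp
  also have "\<dots> = - tau (- 1)" unfolding tau_shift by simp
  also have "tau (- 1) = tau 2" using tau_reflect[of 2] by simp
  finally show ?thesis by simp
qed

text \<open>Multiplying three Jacobi triple products and summing over
  the diagonal direction leaves an instance of \<open>tau\<close>, which the pentagonal number theorem
  evaluates to plus or minus a power of \<open>q\<close> times \<open>P\<close>, or to 0.\<close>

lemma macdonald_A2:
  assumes a: "a \<noteq> 0" and b: "b \<noteq> 0"
  shows "((\<lambda>v. kappa v * a powi (1 - fst v) * b powi (1 - fst v - snd v))
     has_sum P ^ 2 * theta a * theta b * theta (a * b)) UNIV"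
proof -
  define u where "u z n = (- 1) powi n * Q (tri n) * z powi n" for z n
  have jtp: "(u z has_sum P * theta z) UNIV" if "z \<noteq> 0" for z
    using jacobi_triple_product[OF that] unfolding u_def .
  have "((\<lambda>((l, m), n). u a l * u b m * u (a * b) n) has_sum
      (P * theta a) * (P * theta b) * (P * theta (a * b))) ((UNIV \<times> UNIV) \<times> UNIV)"
    using has_sum_product[OF has_sum_product[OF jtp[OF a] jtp[OF b]] jtp[of "a * b"]] a b
    by (simp add: case_prod_unfold)
  \<comment> \<open>\<open>A\<close> and \<open>B\<close> are the total exponents of
    \<open>a\<close> and \<open>b\<close>; for fixed \<open>A\<close> and \<open>B\<close>,
    \<open>n\<close> runs along the diagonal direction.\<close>
  moreover have "bij (\<lambda>((A, B), n). ((A - n, B - n), n) :: (int \<times> int) \<times> int)"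
    by (rule o_bij[of "\<lambda>((A, B), n). ((A + n, B + n), n)"]) (auto simp: fun_eq_iff)
  ultimately have 1: "((\<lambda>((A, B), n). u a (A - n) * u b (B - n) * u (a * b) n) has_sum
      (P * theta a) * (P * theta b) * (P * theta (a * b))) (UNIV \<times> UNIV)"
    using has_sum_reindex_bij_betw[of "\<lambda>((A, B), n). ((A - n, B - n), n)" UNIV UNIV
      "\<lambda>((l, m), n). u a l * u b m * u (a * b) n"]
    by (simp add: case_prod_unfold)
  have 2: "((\<lambda>n. u a (A - n) * u b (B - n) * u (a * b) n) has_sum
      (- 1) powi (A + B) * Q (tri A + tri B) * a powi A * b powi B * tau (A + B)) UNIV" for A B
  proof -
    have "u a (A - n) * u b (B - n) * u (a * b) n =
       (- 1) powi (A + B) * Q (tri A + tri B) * a powi A * b powi B *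
       ((- 1) powi n * Q (3 * tri n + (2 - (A + B)) * n))" for n
    proof -
      have "2 * (tri (A - n) + tri (B - n) + tri n) = 2 * (tri A + tri B + (3 * tri n + (2 - (A + B)) * n))"
        unfolding distrib_left mult.left_commute[of 2 3] two_tri by (simp add: algebra_simps)
      then have "tri (A - n) + tri (B - n) + tri n = tri A + tri B + (3 * tri n + (2 - (A + B)) * n)" by simp
      then have q: "Q (tri (A - n)) * Q (tri (B - n)) * Q (tri n) = Q (tri A + tri B) * Q (3 * tri n + (2 - (A + B)) * n)"
        by (simp only: Q_add[symmetric])
      have s: "(- 1 :: complex) powi (A - n) * (- 1) powi (B - n) * (- 1) powi n = (- 1) powi (A + B) * (- 1) powi n"
      proof -
        have "(- 1 :: complex) powi (A - n) * (- 1) powi (B - n) = (- 1) powi (A + B + 2 * (- n))"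
          by (subst power_int_add[symmetric]) (simp_all add: algebra_simps)
        also have "\<dots> = (- 1) powi (A + B)"
          by (subst power_int_add) (simp_all add: minus_one_powi_even)
        finally show ?thesis by simp
      qed
      have z: "a powi (A - n) * b powi (B - n) * (a * b) powi n = a powi A * b powi B"
        using a b by (simp add: power_int_diff power_int_mult_distrib)
      have "u a (A - n) * u b (B - n) * u (a * b) n =
         ((- 1) powi (A - n) * (- 1) powi (B - n) * (- 1) powi n)
         * (Q (tri (A - n)) * Q (tri (B - n)) * Q (tri n)) * (a powi (A - n) * b powi (B - n) * (a * b) powi n)"
        unfolding u_def by (simp only: mult_ac)
      then show ?thesis unfolding q s z by (simp only: mult_ac)
    qed
    then show ?thesis using has_sum_cmult_right[OF tau_has_sum[of "A + B"]] by simp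
  qed
  have 3: "((\<lambda>(A, B). (- 1) powi (A + B) * Q (tri A + tri B) * a powi A * b powi B * tau (A + B)) has_sum
      (P * theta a) * (P * theta b) * (P * theta (a * b))) UNIV"
    by (rule has_sum_SigmaD[OF 1]) (use 2 in auto)
  \<comment> \<open>With this substitution \<open>A + B\<close> is congruent to
    \<open>2 + fst v - snd v\<close> modulo 3. So the residues 0, 1, 2 that define
    \<open>eps\<close> lead to \<open>tau 2 = 0\<close>, \<open>tau 0 = P\<close> and, through a
    further sign, \<open>tau 1 = P\<close>.\<close>
  have bij: "bij (\<lambda>v. (1 - fst v, 1 - fst v - snd v) :: int \<times> int)"
    by (rule o_bij[of "\<lambda>w. (1 - fst w, fst w - snd w)"]) auto
  have 4: "((\<lambda>v. (- 1) powi (1 - fst v + (1 - fst v - snd v)) * Q (tri (1 - fst v) + tri (1 - fst v - snd v))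
       * a powi (1 - fst v) * b powi (1 - fst v - snd v) * tau (1 - fst v + (1 - fst v - snd v))) has_sum
      (P * theta a) * (P * theta b) * (P * theta (a * b))) UNIV"
    using 3 has_sum_reindex_bij_betw[OF bij, of "\<lambda>(A, B). (- 1) powi (A + B) * Q (tri A + tri B) * a powi A * b powi B * tau (A + B)"]
    by simp
  have 5: "(- 1) powi (1 - fst v + (1 - fst v - snd v)) * Q (tri (1 - fst v) + tri (1 - fst v - snd v))
       * tau (1 - fst v + (1 - fst v - snd v)) = P * kappa v" for v
  proof -
    obtain x y where v: "v = (x, y)" by force
    define k where "k = (x - y) div 3"
    have "(x - y) mod 3 \<in> {0, 1, 2}" by auto
    moreover have xy: "x - y = 3 * k + (x - y) mod 3" by (simp add: k_def)
    ultimately consider (0) "x = y + 3 * k" "(x - y) mod 3 = 0" | (1) "x = y + 1 + 3 * k" "(x - y) mod 3 = 1"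
      | (2) "x = y + 2 + 3 * k" "(x - y) mod 3 = 2" by fastforce
    then show ?thesis
    proof cases
      case 0
      have s: "1 - x + (1 - x - y) = 2 + 3 * (- y - 2 * k)" by (simp add: 0)
      have "tau (1 - x + (1 - x - y)) = 0" unfolding s tau_shift tau_2 by simp
      then show ?thesis using 0(2) by (simp add: v kappa_def eps_def)
    next
      case 1
      define m where "m = - y - 2 * k"
      have s: "1 - x + (1 - x - y) = 0 + 3 * m" by (simp add: 1 m_def)
      have "2 * (half_norm (x, y) - 1) = 3 * (2 * tri (1 - x) + 2 * tri (1 - x - y) + 3 * (2 * tri m) - 6 * m * m + 2 * (2 - 0) * m)"
        unfolding two_tri by (simp add: half_norm_def m_def 1 algebra_simps power2_eq_square)
      then have "half_norm (x, y) - 1 = (tri (1 - x) + tri (1 - x - y) + (3 * tri m - 3 * m * m + (2 - 0) * m)) * 3"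
        by (simp add: algebra_simps)
      then have h: "(half_norm (x, y) - 1) div 3 = tri (1 - x) + tri (1 - x - y) + (3 * tri m - 3 * m * m + (2 - 0) * m)" by simp
      have sg: "(- 1 :: complex) powi (0 + 3 * m) * (- 1) powi m = 1"
        by (subst power_int_add[symmetric]) (simp_all add: minus_one_powi_even)
      have "(- 1) powi (0 + 3 * m) * Q (tri (1 - x) + tri (1 - x - y)) * tau (0 + 3 * m)
        = ((- 1) powi (0 + 3 * m) * (- 1) powi m) * (P * (Q (tri (1 - x) + tri (1 - x - y)) * Q (3 * tri m - 3 * m * m + (2 - 0) * m)))"
        unfolding tau_shift tau_0 by (simp only: mult_ac)
      then have "(- 1) powi (0 + 3 * m) * Q (tri (1 - x) + tri (1 - x - y)) * tau (0 + 3 * m)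
        = P * Q (tri (1 - x) + tri (1 - x - y) + (3 * tri m - 3 * m * m + (2 - 0) * m))"
        unfolding sg Q_add[of "tri (1 - x) + tri (1 - x - y)"] by simp
      then show ?thesis using 1(2) unfolding v fst_conv snd_conv s h kappa_def eps_def by simp
    next
      case 2
      define m where "m = - y - 2 * k - 1"
      have s: "1 - x + (1 - x - y) = 1 + 3 * m" by (simp add: 2 m_def)
      have "2 * (half_norm (x, y) - 1) = 3 * (2 * tri (1 - x) + 2 * tri (1 - x - y) + 3 * (2 * tri m) - 6 * m * m + 2 * (2 - 1) * m)"
        unfolding two_tri by (simp add: half_norm_def m_def 2 algebra_simps power2_eq_square)
      then have "half_norm (x, y) - 1 = (tri (1 - x) + tri (1 - x - y) + (3 * tri m - 3 * m * m + (2 - 1) * m)) * 3"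
        by (simp add: algebra_simps)
      then have h: "(half_norm (x, y) - 1) div 3 = tri (1 - x) + tri (1 - x - y) + (3 * tri m - 3 * m * m + (2 - 1) * m)" by simp
      have sg: "(- 1 :: complex) powi (1 + 3 * m) * (- 1) powi m = - 1"
      proof -
        have "(- 1 :: complex) powi (1 + 3 * m) * (- 1) powi m = (- 1) powi (1 + 2 * (2 * m))"
          by (subst power_int_add[symmetric]) simp_all
        also have "\<dots> = - 1" by (subst power_int_add) (simp_all add: minus_one_powi_even)
        finally show ?thesis .
      qed
      have "(- 1) powi (1 + 3 * m) * Q (tri (1 - x) + tri (1 - x - y)) * tau (1 + 3 * m)
        = ((- 1) powi (1 + 3 * m) * (- 1) powi m) * (P * (Q (tri (1 - x) + tri (1 - x - y)) * Q (3 * tri m - 3 * m * m + (2 - 1) * m)))"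
        unfolding tau_shift tau_1 by (simp only: mult_ac)
      then have "(- 1) powi (1 + 3 * m) * Q (tri (1 - x) + tri (1 - x - y)) * tau (1 + 3 * m)
        = - P * Q (tri (1 - x) + tri (1 - x - y) + (3 * tri m - 3 * m * m + (2 - 1) * m))"
        unfolding sg Q_add[of "tri (1 - x) + tri (1 - x - y)"] by simp
      then show ?thesis using 2(2) unfolding v fst_conv snd_conv s h kappa_def eps_def by simp
    qed
  qed
  have "((\<lambda>v. P * (kappa v * a powi (1 - fst v) * b powi (1 - fst v - snd v))) has_sum
      (P * theta a) * (P * theta b) * (P * theta (a * b))) UNIV"
  proof -
    have eq: "(- 1) powi (1 - fst v + (1 - fst v - snd v)) * Q (tri (1 - fst v) + tri (1 - fst v - snd v))
       * a powi (1 - fst v) * b powi (1 - fst v - snd v) * tau (1 - fst v + (1 - fst v - snd v))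
      = P * (kappa v * a powi (1 - fst v) * b powi (1 - fst v - snd v))" for v
      using arg_cong[OF 5[of v], of "\<lambda>t. t * (a powi (1 - fst v) * b powi (1 - fst v - snd v))"] by (simp only: mult_ac)
    show ?thesis using 4 unfolding eq .
  qed
  from has_sum_cmult_right[OF this, of "1 / P"] show ?thesis
    using P_nz by (simp add: power2_eq_square mult_ac)
qed

end

section \<open>Sums over chains\<close>

definition partial_tuples :: "nat \<Rightarrow> nat \<Rightarrow> (nat \<Rightarrow> int \<times> int) set" where
  "partial_tuples m n = {r. \<forall>j. j \<notin> {m..n} \<longrightarrow> r j = (0, 0)}"

lemma partial_tuples_empty: "n < m \<Longrightarrow> partial_tuples m n = {\<lambda>_. (0, 0)}"
  by (auto simp: partial_tuples_def intro!: ext)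

lemma bij_betw_partial_tuples:
  assumes "m \<le> n"
  shows "bij_betw (\<lambda>(v, r). r(m := v)) (UNIV \<times> partial_tuples (Suc m) n) (partial_tuples m n)"
proof (rule bij_betw_byWitness[of _ "\<lambda>r. (r m, r(m := (0, 0)))"])
  show "\<forall>a\<in>UNIV \<times> partial_tuples (Suc m) n. (((\<lambda>(v, r). r(m := v)) a) m, ((\<lambda>(v, r). r(m := v)) a)(m := (0, 0))) = a"
    by (auto simp: partial_tuples_def fun_eq_iff)
  show "(\<lambda>(v, r). r(m := v)) ` (UNIV \<times> partial_tuples (Suc m) n) \<subseteq> partial_tuples m n"
  proof clarify
    fix v and r :: "nat \<Rightarrow> int \<times> int" assume r: "r \<in> partial_tuples (Suc m) n"
    have "(r(m := v)) j = (0, 0)" if "j \<notin> {m..n}" for j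
      using r that assms by (cases "j = m") (auto simp: partial_tuples_def)
    then show "r(m := v) \<in> partial_tuples m n" by (simp add: partial_tuples_def)
  qed
  show "(\<lambda>r. (r m, r(m := (0, 0)))) ` partial_tuples m n \<subseteq> UNIV \<times> partial_tuples (Suc m) n"
    by (auto simp: partial_tuples_def)
qed auto

lemma prod_summable_on_partial_tuples:
  fixes w :: "nat \<Rightarrow> int \<times> int \<Rightarrow> complex"
  assumes "\<And>j. w j summable_on UNIV"
  shows "(\<lambda>r. \<Prod>j\<in>{m..n}. w j (r j)) summable_on partial_tuples m n"
proof (induction "Suc n - m" arbitrary: m)
  case 0
  then have "n < m" by simp
  then show ?case by (simp add: partial_tuples_empty)
next
  case (Suc d)
  then have mn: "m \<le> n" by simp
  have IH: "(\<lambda>r. \<Prod>j\<in>{Suc m..n}. w j (r j)) summable_on partial_tuples (Suc m) n"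
    using Suc by simp
  have "(\<lambda>(v, r). w m v * (\<Prod>j\<in>{Suc m..n}. w j (r j))) summable_on UNIV \<times> partial_tuples (Suc m) n"
    using has_sum_product[OF has_sum_infsum[OF assms[of m]] has_sum_infsum[OF IH]] by (rule has_sum_imp_summable)
  moreover have "w m v * (\<Prod>j\<in>{Suc m..n}. w j (r j)) = (\<Prod>j\<in>{m..n}. w j ((r(m := v)) j))" for v r
  proof -
    have "(\<Prod>j\<in>{m..n}. w j ((r(m := v)) j)) = w m v * (\<Prod>j\<in>{Suc m..n}. w j ((r(m := v)) j))"
      using mn by (simp add: prod.atLeast_Suc_atMost)
    also have "(\<Prod>j\<in>{Suc m..n}. w j ((r(m := v)) j)) = (\<Prod>j\<in>{Suc m..n}. w j (r j))"
      by (intro prod.cong) auto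
    finally show ?thesis by simp
  qed
  ultimately have "(\<lambda>a. \<Prod>j\<in>{m..n}. w j ((case a of (v, r) \<Rightarrow> r(m := v)) j)) summable_on UNIV \<times> partial_tuples (Suc m) n"
    by (simp add: case_prod_unfold)
  then show ?case using summable_on_reindex_bij_betw[OF bij_betw_partial_tuples[OF mn], of "\<lambda>r. \<Prod>j\<in>{m..n}. w j (r j)"] by simp
qed

text \<open>Weights and innermost function are left open because the two families differ only there.
  \<open>G\<close> collects the factors that depend on the last vector alone, including its linear
  term for \<sigma> = 1, and \<open>n\<close> is \<open>k - 1\<close>.\<close>

locale bailey_chain = qbase +
  fixes w :: "nat \<Rightarrow> int \<times> int \<Rightarrow> complex" and G :: "int \<times> int \<Rightarrow> complex" and n :: nat
  assumes w_summable: "\<And>j. w j summable_on UNIV"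
    and G_bounded: "\<exists>K. \<forall>v. norm (G v) \<le> K"
    and n_pos: "n \<ge> 1"
begin

definition chain :: "nat \<Rightarrow> (nat \<Rightarrow> int \<times> int) \<Rightarrow> complex" where
  "chain m r = (\<Prod>j\<in>{m..n}. w j (r j)) * (\<Prod>j\<in>{m..<n}. inv_qfac2 q (vdiff (r j) (r (Suc j)))) * G (r n)"

text \<open>\<open>U m L\<close> is the sum over \<open>r\<^sup>(\<^sup>m\<^sup>)\<close>, ..., \<open>r\<^sup>(\<^sup>n\<^sup>)\<close> with \<open>r\<^sup>(\<^sup>m\<^sup>-\<^sup>1\<^sup>)\<close> fixed to be \<open>L\<close>; for \<open>m = 1\<close> this
  introduces a cutoff that is removed at the end.\<close>

definition U :: "nat \<Rightarrow> int \<times> int \<Rightarrow> complex" where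
  "U m L = (if m > n then G L else \<Sum>\<^sub>\<infinity>r\<in>partial_tuples m n. inv_qfac2 q (vdiff L (r m)) * chain m r)"

lemma inv_qfac2_bounded: "\<exists>K > 0. \<forall>v. norm (inv_qfac2 q v) \<le> K"
proof -
  obtain K where K: "K > 0" "\<And>n. norm (I n) \<le> K" using I_bounded by blast
  have "norm (inv_qfac2 q v) \<le> K * K" for v
    unfolding inv_qfac2_def norm_mult using K by (intro mult_mono) (auto intro: less_imp_le)
  then show ?thesis using K(1) by (intro exI[of _ "K * K"]) auto
qed

text \<open>The linking factors and \<open>G\<close> are bounded, so the product of the weights
  dominates, and that is a product of independent absolutely convergent sums.\<close>

lemma chain_summable: "(\<lambda>r. norm (chain m r)) summable_on partial_tuples m n"
proof -
  obtain K where K: "K > 0" "\<And>v. norm (inv_qfac2 q v) \<le> K" using inv_qfac2_bounded by blast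
  obtain B where B: "\<And>v. norm (G v) \<le> B" using G_bounded by blast
  have "(\<lambda>r. norm (\<Prod>j\<in>{m..n}. w j (r j))) summable_on partial_tuples m n"
    by (rule iffD1[OF summable_on_iff_abs_summable_on_complex prod_summable_on_partial_tuples[OF w_summable]])
  then have s: "(\<lambda>r. norm (\<Prod>j\<in>{m..n}. w j (r j)) * (K ^ card {m..<n} * B)) summable_on partial_tuples m n"
    by (rule summable_on_cmult_left)
  show ?thesis
  proof (rule summable_on_comparison_test[OF s])
    fix r
    have "norm (\<Prod>j\<in>{m..<n}. inv_qfac2 q (vdiff (r j) (r (Suc j)))) \<le> (\<Prod>j\<in>{m..<n}. K)"
      unfolding prod_norm[symmetric] by (intro prod_mono) (use K in auto)
    then have "norm (\<Prod>j\<in>{m..<n}. inv_qfac2 q (vdiff (r j) (r (Suc j)))) * norm (G (r n)) \<le> K ^ card {m..<n} * B"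
      using B K(1) by (intro mult_mono) auto
    then show "norm (chain m r) \<le> norm (\<Prod>j\<in>{m..n}. w j (r j)) * (K ^ card {m..<n} * B)"
      unfolding chain_def norm_mult mult.assoc by (intro mult_left_mono) auto
  qed simp
qed

lemma U_summable: "(\<lambda>r. inv_qfac2 q (vdiff L (r m)) * chain m r) summable_on partial_tuples m n"
proof -
  obtain K where K: "K > 0" "\<And>v. norm (inv_qfac2 q v) \<le> K" using inv_qfac2_bounded by blast
  have s: "(\<lambda>r. K * norm (chain m r)) summable_on partial_tuples m n"
    by (intro summable_on_cmult_right chain_summable)
  have "(\<lambda>r. norm (inv_qfac2 q (vdiff L (r m)) * chain m r)) summable_on partial_tuples m n"
    by (rule summable_on_comparison_test[OF s])
       (simp_all only: norm_mult mult_right_mono[OF K(2)] norm_ge_zero mult_nonneg_nonneg)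
  then show ?thesis by (rule abs_summable_summable)
qed

lemma chain_upd:
  assumes "m < n"
  shows "chain m (r(m := v)) = w m v * (inv_qfac2 q (vdiff v (r (Suc m))) * chain (Suc m) r)"
proof -
  have "(\<Prod>j\<in>{m..n}. w j ((r(m := v)) j)) = w m v * (\<Prod>j\<in>{Suc m..n}. w j (r j))"
  proof -
    have "(\<Prod>j\<in>{Suc m..n}. w j ((r(m := v)) j)) = (\<Prod>j\<in>{Suc m..n}. w j (r j))" by (intro prod.cong) auto
    then show ?thesis using assms by (simp add: prod.atLeast_Suc_atMost)
  qed
  moreover have "(\<Prod>j\<in>{m..<n}. inv_qfac2 q (vdiff ((r(m := v)) j) ((r(m := v)) (Suc j))))
     = inv_qfac2 q (vdiff v (r (Suc m))) * (\<Prod>j\<in>{Suc m..<n}. inv_qfac2 q (vdiff (r j) (r (Suc j))))"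
  proof -
    have "(\<Prod>j\<in>{Suc m..<n}. inv_qfac2 q (vdiff ((r(m := v)) j) ((r(m := v)) (Suc j))))
      = (\<Prod>j\<in>{Suc m..<n}. inv_qfac2 q (vdiff (r j) (r (Suc j))))" by (intro prod.cong) auto
    then show ?thesis using assms by (simp add: prod.atLeast_Suc_lessThan)
  qed
  moreover have "(r(m := v)) n = r n" using assms by simp
  ultimately show ?thesis unfolding chain_def by (simp only: mult_ac)
qed

lemma U_rec:
  assumes "m \<le> n"
  shows "U m L = (\<Sum>\<^sub>\<infinity>v. inv_qfac2 q (vdiff L v) * (w m v * U (Suc m) v))"
proof -
  define F where "F r = inv_qfac2 q (vdiff L (r m)) * chain m r" for r
  have F: "F = (\<lambda>r. inv_qfac2 q (vdiff L (r m)) * chain m r)" by (rule ext) (simp add: F_def)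
  have "U m L = infsum F (partial_tuples m n)" using assms by (simp add: U_def F)
  also have "\<dots> = infsum (\<lambda>(v, r). F (r(m := v))) (UNIV \<times> partial_tuples (Suc m) n)"
    using infsum_reindex_bij_betw[OF bij_betw_partial_tuples[OF assms], of F] by (simp add: case_prod_unfold)
  also have "\<dots> = (\<Sum>\<^sub>\<infinity>v. \<Sum>\<^sub>\<infinity>r\<in>partial_tuples (Suc m) n. F (r(m := v)))"
  proof -
    have "F summable_on partial_tuples m n" unfolding F by (rule U_summable)
    then have "(\<lambda>a. F (case a of (v, r) \<Rightarrow> r(m := v))) summable_on (UNIV \<times> partial_tuples (Suc m) n)"
      using summable_on_reindex_bij_betw[OF bij_betw_partial_tuples[OF assms], of F] by simp
    then have "(\<lambda>(v, r). F (r(m := v))) summable_on (UNIV \<times> partial_tuples (Suc m) n)"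
      by (simp add: case_prod_unfold)
    from infsum_Sigma_banach[OF this] show ?thesis by simp
  qed
  also have "\<dots> = (\<Sum>\<^sub>\<infinity>v. inv_qfac2 q (vdiff L v) * (w m v * U (Suc m) v))"
  proof (rule infsum_cong)
    fix v
    show "(\<Sum>\<^sub>\<infinity>r\<in>partial_tuples (Suc m) n. F (r(m := v))) = inv_qfac2 q (vdiff L v) * (w m v * U (Suc m) v)"
    proof (cases "m < n")
      case True
      have "F (r(m := v)) = inv_qfac2 q (vdiff L v) * w m v * (inv_qfac2 q (vdiff v (r (Suc m))) * chain (Suc m) r)" for r
        unfolding F_def chain_upd[OF True] by (simp add: mult_ac)
      then have "(\<Sum>\<^sub>\<infinity>r\<in>partial_tuples (Suc m) n. F (r(m := v))) = inv_qfac2 q (vdiff L v) * w m v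
         * (\<Sum>\<^sub>\<infinity>r\<in>partial_tuples (Suc m) n. inv_qfac2 q (vdiff v (r (Suc m))) * chain (Suc m) r)"
        by (simp add: infsum_cmult_right')
      then show ?thesis using True by (simp add: U_def mult.assoc)
    next
      case False
      then have "m = n" using assms by simp
      then show ?thesis by (simp add: partial_tuples_empty F_def chain_def U_def mult_ac)
    qed
  qed
  finally show ?thesis .
qed

lemma U_LIMSEQ: "(\<lambda>N. U 1 (int N, int N)) \<longlonglongrightarrow> infsum (chain 1) (partial_tuples 1 n) / P ^ 2"
proof -
  obtain K where K: "K > 0" "\<And>v. norm (inv_qfac2 q v) \<le> K" using inv_qfac2_bounded by blast
  have "(\<lambda>N. infsum (\<lambda>r. inv_qfac2 q (vdiff (int N, int N) (r 1)) * chain 1 r) (partial_tuples 1 n))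
     \<longlonglongrightarrow> infsum (\<lambda>r. 1 / P * (1 / P) * chain 1 r) (partial_tuples 1 n)"
  proof (rule tannery_infsum(1))
    show "(\<lambda>r. K * norm (chain 1 r)) summable_on partial_tuples 1 n"
      by (intro summable_on_cmult_right chain_summable)
    show "norm (inv_qfac2 q (vdiff (int N, int N) (r 1)) * chain 1 r) \<le> K * norm (chain 1 r)" for N r
      using K by (simp add: norm_mult mult_right_mono)
    fix r
    have "(\<lambda>N. I (1 * int N + - fst (r 1)) * I (1 * int N + - snd (r 1)) * chain 1 r) \<longlonglongrightarrow> 1 / P * (1 / P) * chain 1 r"
      by (intro tendsto_mult tendsto_const I_shift_LIMSEQ) auto
    then show "(\<lambda>N. inv_qfac2 q (vdiff (int N, int N) (r 1)) * chain 1 r) \<longlonglongrightarrow> 1 / P * (1 / P) * chain 1 r"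
      by (simp add: inv_qfac2_def vdiff_def)
  qed
  moreover have "infsum (\<lambda>r. 1 / P * (1 / P) * chain 1 r) (partial_tuples 1 n) = infsum (chain 1) (partial_tuples 1 n) / P ^ 2"
    unfolding infsum_cmult_right' by (simp add: power2_eq_square)
  ultimately show ?thesis using n_pos by (simp add: U_def)
qed

text \<open>At \<open>L = (N, N)\<close> every \<open>Phi\<close> tends to \<open>1 / P ^ 5\<close>,
  whereas removing the cutoff costs only \<open>1 / P ^ 2\<close>; the quotient explains
  \<open>P ^ 3\<close>. \<open>V\<close> is kept apart from \<open>U 1\<close> because for
  \<open>i = 1\<close> the expanded function carries an extra factor that tends to 1.\<close>

lemma chain_has_sum:
  assumes exp: "\<And>L. ((\<lambda>v. c v * Phi t (a1 v) (a2 v) (a3 v) L) has_sum V L) UNIV"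
    and V: "(\<lambda>N. V (int N, int N)) \<longlonglongrightarrow> infsum (chain 1) (partial_tuples 1 n) / P ^ 2"
    and c: "(c has_sum S) UNIV"
  shows "(chain 1 has_sum S / P ^ 3) (partial_tuples 1 n)"
proof -
  obtain K where K: "K > 0" "\<And>t a1 a2 a3 r. norm (Phi t a1 a2 a3 r) \<le> K" using Phi_bounded by blast
  have cs: "(\<lambda>v. norm (c v)) summable_on UNIV"
    using c has_sum_imp_summable summable_on_iff_abs_summable_on_complex by blast
  have "(\<lambda>N. infsum (\<lambda>v. c v * Phi t (a1 v) (a2 v) (a3 v) (int N, int N)) UNIV) \<longlonglongrightarrow> infsum (\<lambda>v. c v * (1 / P ^ 5)) UNIV"
  proof (rule tannery_infsum(1))
    show "(\<lambda>v. norm (c v) * K) summable_on UNIV" by (rule summable_on_cmult_left[OF cs])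
    show "norm (c v * Phi t (a1 v) (a2 v) (a3 v) (int N, int N)) \<le> norm (c v) * K" for N v
      using K by (simp add: norm_mult mult_left_mono)
    show "(\<lambda>N. c v * Phi t (a1 v) (a2 v) (a3 v) (int N, int N)) \<longlonglongrightarrow> c v * (1 / P ^ 5)" for v
      by (intro tendsto_mult tendsto_const Phi_LIMSEQ)
  qed
  moreover have "infsum (\<lambda>v. c v * Phi t (a1 v) (a2 v) (a3 v) (int N, int N)) UNIV = V (int N, int N)" for N
    using exp by (rule infsumI)
  moreover have "infsum (\<lambda>v. c v * (1 / P ^ 5)) UNIV = S * (1 / P ^ 5)"
    by (rule infsumI[OF has_sum_cmult_left[OF c]])
  ultimately have "infsum (chain 1) (partial_tuples 1 n) / P ^ 2 = S * (1 / P ^ 5)"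
    using V LIMSEQ_unique by simp
  then have "infsum (chain 1) (partial_tuples 1 n) = S / P ^ 3"
    using P_nz by (simp add: field_simps eval_nat_numeral)
  moreover have "chain 1 summable_on partial_tuples 1 n"
    using chain_summable by (rule abs_summable_summable)
  ultimately show ?thesis by (metis has_sum_infsum)
qed

end

section \<open>The Macdonald identity in base \<open>q ^ (3 * k + 1)\<close>\<close>

context qbase
begin

text \<open>For \<open>v = (x, y)\<close> the form equals
  \<open>(x - y)\<^sup>2 + 3 * x * y\<close>, which is 1 modulo 3 unless 3 divides
  \<open>x - y\<close>.\<close>

lemma half_norm_mod_3:
  assumes "eps v \<noteq> 0"
  shows "3 * ((half_norm v - 1) div 3) = half_norm v - 1"
proof -
  obtain x y where v: "v = (x, y)" by force
  define k where "k = (x - y) div 3"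
  have "(x - y) mod 3 = 1 \<or> (x - y) mod 3 = 2"
    using assms by (auto simp: eps_def v split: if_splits)
  moreover have "x - y = 3 * k + (x - y) mod 3" by (simp add: k_def)
  ultimately consider "x = y + 1 + 3 * k" | "x = y + 2 + 3 * k" by fastforce
  then show ?thesis
  proof cases
    case 1
    have "half_norm v - 1 = 3 * (3 * k * k + 3 * k * y + y * y + 2 * k + y)"
      by (simp add: v half_norm_def 1 power2_eq_square algebra_simps)
    then show ?thesis by simp
  next
    case 2
    have "half_norm v - 1 = 3 * (3 * k * k + 3 * k * y + y * y + 4 * k + 2 * y + 1)"
      by (simp add: v half_norm_def 2 power2_eq_square algebra_simps)
    then show ?thesis by simp
  qed
qed

lemma theta_q_mult:
  assumes "z \<noteq> 0"
  shows "theta (q * z) = - theta z / z"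
proof -
  have 1: "qpoch_inf z q = (1 - z) * qpoch_inf (q * z) q"
    using qpoch_inf_split[OF q_lt1, of z] by (simp add: mult.commute)
  have 2: "qpoch_inf (1 / z) q = (1 - 1 / z) * qpoch_inf (q / z) q"
    using qpoch_inf_split[OF q_lt1, of "1 / z"] by simp
  have 3: "q / (q * z) = 1 / z" by simp
  show ?thesis unfolding theta_def 3 1 2 using assms by (simp add: field_simps)
qed

lemma theta_Q:
  fixes e k :: nat
  assumes "e \<le> 3 * k + 1"
  shows "qbase.theta (q ^ (3 * k + 1)) (Q (int e))
    = qpoch_inf (q ^ e) (q ^ (3 * k + 1)) * qpoch_inf (q ^ (3 * k + 1 - e)) (q ^ (3 * k + 1))"
proof -
  interpret p: qbase "q ^ (3 * k + 1)" by (rule qbase_power) simp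
  have "q ^ (3 * k + 1) / q ^ e = q ^ (3 * k + 1 - e)"
    using assms by (subst power_diff) auto
  then show ?thesis unfolding p.theta_def by simp
qed

text \<open>The origin of the modulus: \<open>kappa\<close> contributes a third of
  \<open>half_norm v - 1\<close> and the \<open>k - 1\<close> Bailey steps together with the initial
  expansion contribute \<open>k\<close> times it, hence \<open>(3 * k + 1) / 3\<close> in total.
  This is \<open>kappa\<close> in base \<open>p\<close>.\<close>

lemma macdonald_specialised:
  fixes k :: nat and A B :: int
  defines "p \<equiv> q ^ (3 * k + 1)"
  shows "((\<lambda>v. kappa v * Q (int k * (half_norm v - 1) + A * (1 - fst v) + B * (1 - fst v - snd v))) has_sum
     qpoch_inf p p ^ 2 * qbase.theta p (Q A) * qbase.theta p (Q B) * qbase.theta p (Q (A + B))) UNIV"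
proof -
  interpret p: qbase p unfolding p_def by (rule qbase_power) simp
  have "p.kappa v * Q A powi (1 - fst v) * Q B powi (1 - fst v - snd v)
     = kappa v * Q (int k * (half_norm v - 1) + A * (1 - fst v) + B * (1 - fst v - snd v))" for v
  proof (cases "eps v = 0")
    case False
    define e where "e = (half_norm v - 1) div 3"
    have "p powi e = Q (int (3 * k + 1) * e)" unfolding p_def by (rule Q_power)
    also have "int (3 * k + 1) * e = e + int k * (3 * e)" by (simp add: algebra_simps)
    also have "3 * e = half_norm v - 1" unfolding e_def by (rule half_norm_mod_3[OF False])
    finally show ?thesis
      unfolding p.kappa_def kappa_def e_def[symmetric] Q_add power_int_mult by (simp add: mult_ac)
  qed (simp add: kappa_def p.kappa_def)
  then show ?thesis using p.macdonald_A2[of "Q A" "Q B"] by (simp add: Q_add)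
qed

lemma weight_summable_complex: "l1 \<in> {0, 1} \<Longrightarrow> l2 \<in> {0, 1} \<Longrightarrow> (\<lambda>v. Q (halfvCv v + l1 * fst v + l2 * snd v)) summable_on UNIV"
  by (rule abs_summable_summable[OF weight_summable])

lemma G0_bounded: "\<exists>K. \<forall>v. norm (G0 v) \<le> K"
proof -
  obtain K where K: "K > 0" "\<And>n. norm (I n) \<le> K" using I_bounded by blast
  have "norm (G0 v) \<le> K * K * K" for v
    unfolding norm_mult using K by (intro mult_mono mult_nonneg_nonneg) (auto intro: less_imp_le)
  then show ?thesis by blast
qed

lemma QG0_bounded: "\<exists>K. \<forall>v. norm (Q (int \<sigma> * snd v) * G0 v) \<le> K"
proof -
  obtain K where K: "\<And>v. norm (G0 v) \<le> K" using G0_bounded by blast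
  have "norm (Q (int \<sigma> * snd v) * G0 v) \<le> K" for v
  proof (cases "snd v < 0")
    case True
    then show ?thesis using K[of v] by (simp add: I_neg)
  next
    case False
    then have "norm (Q (int \<sigma> * snd v)) \<le> norm (Q 0)" by (intro norm_Q_le) auto
    then have "norm (Q (int \<sigma> * snd v)) * norm (G0 v) \<le> 1 * norm (G0 v)" by (intro mult_right_mono) auto
    then show ?thesis using K[of v] unfolding norm_mult by linarith
  qed
  then show ?thesis by blast
qed

end

section \<open>The two families of identities\<close>

context qbase
begin

lemma Q_prod: "finite A \<Longrightarrow> (\<Prod>j\<in>A. Q (f j)) = Q (\<Sum>j\<in>A. f j)"
  by (induction A rule: finite_induct) (simp_all add: Q_add)

lemma tuples_eq_partial_tuples: "tuples k = partial_tuples 1 (k - 1)"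
  by (simp add: tuples_def partial_tuples_def)

lemma denom_inv_eq:
  assumes "k \<ge> 2"
  shows "denom_inv q k r = (\<Prod>j\<in>{1..<k - 1}. inv_qfac2 q (vdiff (r j) (r (Suc j)))) * G0 (r (k - 1))"
proof -
  have "{1..k - 2} = {1..<k - 1}" using assms by auto
  then show ?thesis by (simp add: denom_inv_def inv_qfac2_def vabs_def mult_ac)
qed

lemma Q_double_LIMSEQ: "(\<lambda>N. 1 - Q (int N + int N + 1)) \<longlonglongrightarrow> 1"
proof -
  have "(\<lambda>N. q ^ N) \<longlonglongrightarrow> 0" using q_lt1 by (rule LIMSEQ_power_zero)
  then have "(\<lambda>N. 1 - q ^ N * q ^ N * q) \<longlonglongrightarrow> 1 - 0 * 0 * q"
    by (intro tendsto_diff tendsto_mult tendsto_const)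
  moreover have "Q (int N + int N + 1) = q ^ N * q ^ N * q" for N
    by (simp only: Q_add power_int_of_nat power_int_1_right)
  ultimately show ?thesis by simp
qed

lemma PhiB_step:
  assumes "\<And>r. ((\<lambda>v. c v * PhiB v r) has_sum V r) UNIV"
  shows "((\<lambda>v. c v * Q (half_norm v - 1) * PhiB v L) has_sum
     (\<Sum>\<^sub>\<infinity>r. inv_qfac2 q (vdiff L r) * (Q (halfvCv r + vabs r) * V r))) UNIV"
proof -
  have e: "- ((- 1 - fst v) * (- 1 - snd v) + (- 1 - fst v) * (- 1 + fst v + snd v)
      + (- 1 - snd v) * (- 1 + fst v + snd v)) - 2\<^sup>2 - 2 * (- 3) = half_norm v - 1" for v :: "int \<times> int"
    by (simp add: half_norm_def power2_eq_square algebra_simps)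
  have x: "halfvCv r - (- 3 + 2) * fst r + (2 * 2 + - 3) * snd r = halfvCv r + vabs r" for r
    by (simp add: vabs_def)
  show ?thesis
    using Bailey_step[of "\<lambda>v. - 1 - fst v" "\<lambda>v. - 1 - snd v" "\<lambda>v. - 1 + fst v + snd v" "- 3" 2 c V L]
      assms unfolding PhiB_def e x by simp
qed

lemma PhiA_step:
  assumes "\<And>r. ((\<lambda>v. c v * PhiA v r) has_sum V r) UNIV"
  shows "((\<lambda>v. c v * Q (half_norm v + 1 - (2 * fst v + snd v)) * PhiA v L) has_sum
     (\<Sum>\<^sub>\<infinity>r. inv_qfac2 q (vdiff L r) * (Q (halfvCv r) * V r))) UNIV"
proof -
  have e: "- ((1 - fst v) * (- snd v) + (1 - fst v) * (- 1 + fst v + snd v)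
      + (- snd v) * (- 1 + fst v + snd v)) - 0\<^sup>2 - 0 * 0 = half_norm v + 1 - (2 * fst v + snd v)" for v :: "int \<times> int"
    by (simp add: half_norm_def power2_eq_square algebra_simps)
  have x: "halfvCv r - (0 + 0) * fst r + (2 * 0 + 0) * snd r = halfvCv r" for r
    by simp
  show ?thesis
    using Bailey_step[of "\<lambda>v. 1 - fst v" "\<lambda>v. - snd v" "\<lambda>v. - 1 + fst v + snd v" 0 0 c V L]
      assms unfolding PhiA_def e x by simp
qed

lemma term1_has_sum:
  fixes k i :: nat
  assumes k: "k \<ge> 2" and i: "1 \<le> i" "i \<le> k"
  defines "p \<equiv> q ^ (3 * k + 1)"
  shows "(term1 q k i has_sum qpoch_inf p p ^ 2 * qbase.theta p (Q (int i)) * qbase.theta p (Q (int i))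
     * qbase.theta p (Q (int i + int i)) / P ^ 3) (tuples k)"
proof -
  define n where "n = k - 1"
  \<comment> \<open>The numerator factor is made part of the weight of the vector with index
    \<open>i - 1\<close>. For \<open>i = 1\<close> that index is 0, outside the chain, in agreement
    with the convention that the factor is then 1.\<close>
  define w where "w j v = Q (halfvCv v + (if i \<le> j then vabs v else 0)) * (if Suc j = i then 1 - Q (vabs v + 1) else 1)"
    for j v
  have n: "n \<ge> 1" "i \<le> Suc n" using k i by (auto simp: n_def)
  interpret bailey_chain q w G0 n
  proof
    show "w j summable_on UNIV" for j
    proof -
      have eqs: "Q (halfvCv v) = Q (halfvCv v + 0 * fst v + 0 * snd v)"
        "Q (halfvCv v + vabs v) = Q (halfvCv v + 1 * fst v + 1 * snd v)" for v
        by (simp_all add: vabs_def add_ac)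
      have s0: "(\<lambda>v. Q (halfvCv v)) summable_on UNIV" and s1: "(\<lambda>v. Q (halfvCv v + vabs v)) summable_on UNIV"
        unfolding eqs by (rule weight_summable_complex; simp)+
      consider (a) "i \<le> j" | (b) "Suc j = i" | (c) "Suc j < i" by linarith
      then show ?thesis
      proof cases
        case a
        then have "w j = (\<lambda>v. Q (halfvCv v + vabs v))" by (auto simp: w_def)
        then show ?thesis using s1 by simp
      next
        case b
        then have "w j = (\<lambda>v. Q (halfvCv v) + - q * Q (halfvCv v + vabs v))"
          by (auto simp: w_def Q_add algebra_simps)
        then show ?thesis using summable_on_add[OF s0 summable_on_cmult_right[OF s1, of "- q"]] by simp
      next
        case c
        then have "w j = (\<lambda>v. Q (halfvCv v))" by (auto simp: w_def)
        then show ?thesis using s0 by simp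
      qed
    qed
    show "\<exists>K. \<forall>v. norm (G0 v) \<le> K" by (rule G0_bounded)
    show "1 \<le> n" by (rule n(1))
  qed
  have "chain 1 r = term1 q k i r" for r
  proof -
    have "(\<Prod>j\<in>{1..n}. w j (r j)) = Q (\<Sum>j\<in>{1..n}. halfvCv (r j) + (if i \<le> j then vabs (r j) else 0))
        * (\<Prod>j\<in>{1..n}. if Suc j = i then 1 - Q (vabs (r j) + 1) else 1)"
      unfolding w_def prod.distrib by (simp add: Q_prod)
    moreover have "(\<Sum>j\<in>{1..n}. if i \<le> j then vabs (r j) else 0) = (\<Sum>j\<in>{i..n}. vabs (r j))"
      using i by (intro sum.mono_neutral_cong_right) auto
    moreover have "(\<Prod>j\<in>{1..n}. if Suc j = i then 1 - Q (vabs (r j) + 1) else 1)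
        = (if i = 1 then 1 else 1 - Q (vabs (r (i - 1)) + 1))"
    proof (cases "i = 1")
      case False
      then have "Suc j = i \<longleftrightarrow> j = i - 1" for j using i by auto
      moreover have "i - 1 \<in> {1..n}" using False i n by auto
      ultimately show ?thesis using False by (simp add: prod.delta)
    qed simp
    ultimately show ?thesis
      unfolding chain_def term1_def denom_inv_eq[OF k] n_def[symmetric] by (simp add: sum.distrib mult_ac)
  qed
  then have chain: "chain 1 = term1 q k i" by (rule ext)
  \<comment> \<open>\<open>d\<close> counts the steps taken with \<open>PhiB\<close>; each of them
    adds \<open>half_norm v - 1\<close> to the initial exponent
    \<open>half_norm v + 1\<close>.\<close>
  define E1 where "E1 d h = Q (h + 1 + int d * (h - 1))" for d :: nat and h :: int
  have B: "((\<lambda>v. kappa v * delta v * E1 d (half_norm v) * PhiB v L) has_sum 6 * U (Suc n - d) L) UNIV"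
    if "d \<le> Suc n - i" for d L
    using that
  proof (induction d arbitrary: L)
    case 0
    show ?case using expansion_PhiB[of L] by (simp add: E1_def U_def)
  next
    case (Suc d)
    define m where "m = Suc n - Suc d"
    have m: "Suc m = Suc n - d" "m \<le> n" "i \<le> m" using Suc.prems i by (auto simp: m_def)
    have IH: "((\<lambda>v. kappa v * delta v * E1 d (half_norm v) * PhiB v r) has_sum 6 * U (Suc m) r) UNIV" for r
      unfolding m(1) using Suc by simp
    have ww: "w m v = Q (halfvCv v + vabs v)" for v using m(3) by (simp add: w_def)
    have "(\<Sum>\<^sub>\<infinity>r. inv_qfac2 q (vdiff L r) * (Q (halfvCv r + vabs r) * (6 * U (Suc m) r)))
        = (\<Sum>\<^sub>\<infinity>r. 6 * (inv_qfac2 q (vdiff L r) * (w m r * U (Suc m) r)))"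
      unfolding ww by (simp only: mult_ac)
    also have "\<dots> = 6 * U m L" unfolding infsum_cmult_right' U_rec[OF m(2)] ..
    finally have "((\<lambda>v. kappa v * delta v * E1 d (half_norm v) * Q (half_norm v - 1) * PhiB v L) has_sum 6 * U m L) UNIV"
      using PhiB_step[OF IH, of L] by simp
    moreover have "E1 d h * Q (h - 1) = E1 (Suc d) h" for h
      unfolding E1_def Q_add[symmetric] by (simp add: algebra_simps)
    ultimately show ?case unfolding m_def[symmetric] by (simp add: mult.assoc)
  qed
  define d where "d = Suc n - i"
  have Ui: "((\<lambda>v. kappa v * E1 d (half_norm v) * Q (- (2 * fst v + snd v)) * PhiA v L)
      has_sum (1 - Q (vabs L + 1)) * U i L) UNIV" for L
    using PhiB_to_PhiA[of "E1 d" L "U i L"] B[of d L] n by (simp add: d_def vabs_def)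
  \<comment> \<open>After the change of functions, what is expanded in \<open>PhiA\<close> is not
    \<open>U i\<close> but its product with the numerator factor. This is just the product that
    \<open>w (i - 1)\<close> and \<open>U i\<close> form in the next step.\<close>
  define H where "H m L = (if m = i then (1 - Q (vabs L + 1)) * U i L else U m L)" for m L
  define c where "c e v = kappa v * E1 d (half_norm v) * Q (- (2 * fst v + snd v)) * Q (int e * (half_norm v + 1 - (2 * fst v + snd v)))"
    for e :: nat and v
  have A: "((\<lambda>v. c e v * PhiA v L) has_sum H (i - e) L) UNIV" if "e < i" for e L
    using that
  proof (induction e arbitrary: L)
    case 0
    show ?case using Ui by (simp add: c_def H_def)
  next
    case (Suc e)
    define m where "m = i - Suc e"
    have m: "Suc m = i - e" "m \<le> n" "m < i" using Suc.prems n by (auto simp: m_def)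
    have IH: "((\<lambda>v. c e v * PhiA v r) has_sum H (Suc m) r) UNIV" for r
      unfolding m(1) using Suc by simp
    have ww: "w m v * U (Suc m) v = Q (halfvCv v) * H (Suc m) v" for v
      using m(3) by (auto simp: w_def H_def)
    have "(\<Sum>\<^sub>\<infinity>r. inv_qfac2 q (vdiff L r) * (Q (halfvCv r) * H (Suc m) r)) = H m L"
      using m(3) unfolding ww[symmetric] U_rec[OF m(2), symmetric] by (simp add: H_def)
    then have "((\<lambda>v. c e v * Q (half_norm v + 1 - (2 * fst v + snd v)) * PhiA v L) has_sum H m L) UNIV"
      using PhiA_step[OF IH, of L] by simp
    moreover have "c e v * Q (half_norm v + 1 - (2 * fst v + snd v)) = c (Suc e) v" for v
    proof -
      have "int (Suc e) * (half_norm v + 1 - (2 * fst v + snd v))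
         = int e * (half_norm v + 1 - (2 * fst v + snd v)) + (half_norm v + 1 - (2 * fst v + snd v))"
        by (simp add: algebra_simps)
      then show ?thesis unfolding c_def by (simp only: Q_add mult.assoc)
    qed
    ultimately show ?case unfolding m_def[symmetric] by simp
  qed
  have exp: "((\<lambda>v. c (i - 1) v * Phi 0 (1 - fst v) (- snd v) (- 1 + fst v + snd v) L) has_sum H 1 L) UNIV" for L
    using A[of "i - 1" L] i unfolding PhiA_def by simp
  have lim: "(\<lambda>N. H 1 (int N, int N)) \<longlonglongrightarrow> infsum (chain 1) (partial_tuples 1 n) / P ^ 2"
  proof (cases "i = 1")
    case True
    have "(\<lambda>N. (1 - Q (int N + int N + 1)) * U 1 (int N, int N)) \<longlonglongrightarrow> 1 * (infsum (chain 1) (partial_tuples 1 n) / P ^ 2)"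
      by (intro tendsto_mult Q_double_LIMSEQ U_LIMSEQ)
    then show ?thesis using True by (simp add: H_def vabs_def)
  next
    case False
    then show ?thesis using U_LIMSEQ by (simp add: H_def)
  qed
  have "c (i - 1) v = kappa v * Q (int k * (half_norm v - 1) + int i * (1 - fst v) + int i * (1 - fst v - snd v))" for v
  proof -
    \<comment> \<open>The exponent collects the initial expansion, \<open>k - i\<close> steps with
      \<open>PhiB\<close>, the change of functions and \<open>i - 1\<close> steps with
      \<open>PhiA\<close>. The last two account for \<open>i\<close> copies of
      \<open>- (2 * fst v + snd v)\<close>.\<close>
    have "half_norm v + 1 + int d * (half_norm v - 1) + - (2 * fst v + snd v) + int (i - 1) * (half_norm v + 1 - (2 * fst v + snd v))
      = int k * (half_norm v - 1) + int i * (1 - fst v) + int i * (1 - fst v - snd v)"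
    proof -
      have "int d = int k - int i" "int (i - 1) = int i - 1" using i k by (auto simp: d_def n_def)
      then show ?thesis by (simp only:) (simp add: algebra_simps)
    qed
    then show ?thesis unfolding c_def E1_def by (simp only: Q_add[symmetric] mult.assoc)
  qed
  then have "c (i - 1) = (\<lambda>v. kappa v * Q (int k * (half_norm v - 1) + int i * (1 - fst v) + int i * (1 - fst v - snd v)))"
    by (rule ext)
  then have "(c (i - 1) has_sum qpoch_inf p p ^ 2 * qbase.theta p (Q (int i)) * qbase.theta p (Q (int i))
     * qbase.theta p (Q (int i + int i))) UNIV"
    using macdonald_specialised[of k "int i" "int i"] unfolding p_def by (simp only:)
  from chain_has_sum[OF exp lim this] show ?thesis
    unfolding tuples_eq_partial_tuples n_def[symmetric] chain .
qed

section \<open>The second family\<close>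

lemma Phi1_step:
  assumes s: "\<And>v. a1 v + a2 v + a3 v = - 2"
    and G: "\<And>r. ((\<lambda>v. c v * Phi 1 (a1 v) (a2 v) (a3 v) r) has_sum V r) UNIV"
  shows "((\<lambda>v. c v * Q (1 - (a1 v * a2 v + a1 v * a3 v + a2 v * a3 v)) * Phi 1 (a1 v) (a2 v) (a3 v) L) has_sum
     (\<Sum>\<^sub>\<infinity>r. inv_qfac2 q (vdiff L r) * (Q (halfvCv r + fst r) * V r))) UNIV"
proof -
  have e: "- (a1 v * a2 v + a1 v * a3 v + a2 v * a3 v) - 1\<^sup>2 - 1 * (- 2) = 1 - (a1 v * a2 v + a1 v * a3 v + a2 v * a3 v)" for v
    by simp
  have x: "halfvCv r - (- 2 + 1) * fst r + (2 * 1 + - 2) * snd r = halfvCv r + fst r" for r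
    by simp
  show ?thesis using Bailey_step[OF s _ _ G, of L] unfolding e x by simp
qed

text \<open>Every vector has the same linear term, so one kind of function with \<open>t = 1\<close>
  serves the whole chain, and \<sigma> enters only through the initial expansion.\<close>

lemma term2_has_sum_aux:
  fixes k \<sigma> :: nat
  assumes k: "k \<ge> 2" and s: "\<And>v. a1 v + a2 v + a3 v = - 2"
    and exp: "\<And>r. ((\<lambda>v. c v * Phi 1 (a1 v) (a2 v) (a3 v) r) has_sum Q (int \<sigma> * snd r) * G0 r) UNIV"
    and S: "((\<lambda>v. c v * Q (int (k - 1) * (1 - (a1 v * a2 v + a1 v * a3 v + a2 v * a3 v)))) has_sum S) UNIV"
  shows "(term2 q k \<sigma> has_sum S / P ^ 3) (tuples k)"
proof -
  define n where "n = k - 1"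
  define w where "w j v = Q (halfvCv v + fst v)" for j :: nat and v
  define e where "e v = 1 - (a1 v * a2 v + a1 v * a3 v + a2 v * a3 v)" for v
  have n: "n \<ge> 1" using k by (simp add: n_def)
  interpret bailey_chain q w "\<lambda>v. Q (int \<sigma> * snd v) * G0 v" n
  proof
    have "Q (halfvCv v + fst v) = Q (halfvCv v + 1 * fst v + 0 * snd v)" for v by simp
    then have "(\<lambda>v. Q (halfvCv v + fst v)) summable_on UNIV"
      using weight_summable_complex[of 1 0] by simp
    then show "w j summable_on UNIV" for j by (simp add: w_def[abs_def])
    show "\<exists>K. \<forall>v. norm (Q (int \<sigma> * snd v) * G0 v) \<le> K" by (rule QG0_bounded)
    show "1 \<le> n" by (rule n)
  qed
  have "chain 1 r = term2 q k \<sigma> r" for r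
  proof -
    have "(\<Prod>j\<in>{1..n}. w j (r j)) = Q (\<Sum>j\<in>{1..n}. halfvCv (r j) + fst (r j))"
      unfolding w_def by (simp add: Q_prod)
    then show ?thesis
      unfolding chain_def term2_def denom_inv_eq[OF k] n_def[symmetric] Q_add by (simp add: mult_ac)
  qed
  then have chain: "chain 1 = term2 q k \<sigma>" by (rule ext)
  have A: "((\<lambda>v. c v * Q (int d * e v) * Phi 1 (a1 v) (a2 v) (a3 v) L) has_sum U (Suc n - d) L) UNIV"
    if "d \<le> n" for d L
    using that
  proof (induction d arbitrary: L)
    case 0
    show ?case using exp[of L] by (simp add: U_def)
  next
    case (Suc d)
    define m where "m = Suc n - Suc d"
    have m: "Suc m = Suc n - d" "m \<le> n" using Suc.prems by (auto simp: m_def)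
    have IH: "((\<lambda>v. c v * Q (int d * e v) * Phi 1 (a1 v) (a2 v) (a3 v) r) has_sum U (Suc m) r) UNIV" for r
      unfolding m(1) using Suc by simp
    have "((\<lambda>v. c v * Q (int d * e v) * Q (e v) * Phi 1 (a1 v) (a2 v) (a3 v) L) has_sum U m L) UNIV"
      using Phi1_step[OF s IH, of L] unfolding U_rec[OF m(2)] w_def e_def .
    moreover have "Q (int d * e v) * Q (e v) = Q (int (Suc d) * e v)" for v
      unfolding Q_add[symmetric] by (simp add: algebra_simps)
    ultimately show ?case unfolding m_def[symmetric] by (simp only: mult.assoc)
  qed
  have "((\<lambda>v. c v * Q (int n * e v) * Phi 1 (a1 v) (a2 v) (a3 v) L) has_sum U 1 L) UNIV" for L
    using A[of n L] by simp
  moreover have "((\<lambda>v. c v * Q (int n * e v)) has_sum S) UNIV"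
    using S unfolding n_def e_def .
  ultimately have "(chain 1 has_sum S / P ^ 3) (partial_tuples 1 n)"
    by (rule chain_has_sum[OF _ U_LIMSEQ])
  then show ?thesis unfolding tuples_eq_partial_tuples n_def[symmetric] chain .
qed

lemma term2_has_sum_0:
  fixes k :: nat
  assumes k: "k \<ge> 2"
  defines "p \<equiv> q ^ (3 * k + 1)"
  shows "(term2 q k 0 has_sum qpoch_inf p p ^ 2 * qbase.theta p (Q (int (2 * k))) * qbase.theta p (Q (int k))
     * qbase.theta p (Q (int (3 * k))) / P ^ 3) (tuples k)"
proof (rule term2_has_sum_aux[OF k])
  show "((\<lambda>v. kappa v * Q (half_norm v - (3 * fst v + snd v) + 2)
        * Phi 1 (1 - fst v) (- 1 - snd v) (- 2 + fst v + snd v) r) has_sum Q (int 0 * snd r) * G0 r) UNIV" for r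
    using expansion_mu0[of r] by simp
  have "kappa v * Q (half_norm v - (3 * fst v + snd v) + 2) * Q (int (k - 1) * (1 - ((1 - fst v) * (- 1 - snd v)
      + (1 - fst v) * (- 2 + fst v + snd v) + (- 1 - snd v) * (- 2 + fst v + snd v))))
     = kappa v * Q (int k * (half_norm v - 1) + int (2 * k) * (1 - fst v) + int k * (1 - fst v - snd v))" for v
  proof -
    have k1: "int (k - 1) = int k - 1" using k by auto
    have "half_norm v - (3 * fst v + snd v) + 2 + int (k - 1) * (1 - ((1 - fst v) * (- 1 - snd v)
      + (1 - fst v) * (- 2 + fst v + snd v) + (- 1 - snd v) * (- 2 + fst v + snd v)))
      = int k * (half_norm v - 1) + int (2 * k) * (1 - fst v) + int k * (1 - fst v - snd v)"
      unfolding k1 by (simp add: half_norm_def power2_eq_square algebra_simps)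
    then show ?thesis unfolding mult.assoc Q_add[symmetric] by simp
  qed
  moreover have "int (2 * k) + int k = int (3 * k)" by simp
  ultimately show "((\<lambda>v. kappa v * Q (half_norm v - (3 * fst v + snd v) + 2) * Q (int (k - 1) * (1 - ((1 - fst v) * (- 1 - snd v)
      + (1 - fst v) * (- 2 + fst v + snd v) + (- 1 - snd v) * (- 2 + fst v + snd v)))))
     has_sum qpoch_inf p p ^ 2 * qbase.theta p (Q (int (2 * k))) * qbase.theta p (Q (int k))
     * qbase.theta p (Q (int (3 * k)))) UNIV"
    using macdonald_specialised[of k "int (2 * k)" "int k"] unfolding p_def by (simp only:)
qed simp

lemma term2_has_sum_1:
  fixes k :: nat
  assumes k: "k \<ge> 2"
  defines "p \<equiv> q ^ (3 * k + 1)"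
  shows "(term2 q k 1 has_sum qpoch_inf p p ^ 2 * qbase.theta p (Q (int k)) * qbase.theta p (Q (int (3 * k)))
     * qbase.theta p (Q (int (k - 1))) / P ^ 3) (tuples k)"
proof (rule term2_has_sum_aux[OF k])
  show "((\<lambda>v. - kappa v * Q (half_norm v - (4 * fst v + 3 * snd v) + 3)
        * Phi 1 (1 - fst v) (- snd v) (- 3 + fst v + snd v) r) has_sum Q (int 1 * snd r) * G0 r) UNIV" for r
    using expansion_mu1[of r] by simp
  have k1: "int (k - 1) = int k - 1" using k by auto
  have eq: "- kappa v * Q (half_norm v - (4 * fst v + 3 * snd v) + 3) * Q (int (k - 1) * (1 - ((1 - fst v) * (- snd v)
      + (1 - fst v) * (- 3 + fst v + snd v) + (- snd v) * (- 3 + fst v + snd v))))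
     = - Q (int (k - 1)) * (kappa v * Q (int k * (half_norm v - 1) + int k * (1 - fst v) + int (3 * k) * (1 - fst v - snd v)))" for v
  proof -
    have "half_norm v - (4 * fst v + 3 * snd v) + 3 + int (k - 1) * (1 - ((1 - fst v) * (- snd v)
      + (1 - fst v) * (- 3 + fst v + snd v) + (- snd v) * (- 3 + fst v + snd v)))
      = int (k - 1) + (int k * (half_norm v - 1) + int k * (1 - fst v) + int (3 * k) * (1 - fst v - snd v))"
      unfolding k1 by (simp add: half_norm_def power2_eq_square algebra_simps)
    then have "Q (half_norm v - (4 * fst v + 3 * snd v) + 3) * Q (int (k - 1) * (1 - ((1 - fst v) * (- snd v)
      + (1 - fst v) * (- 3 + fst v + snd v) + (- snd v) * (- 3 + fst v + snd v))))
      = Q (int (k - 1)) * Q (int k * (half_norm v - 1) + int k * (1 - fst v) + int (3 * k) * (1 - fst v - snd v))"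
      by (simp only: Q_add[symmetric])
    then show ?thesis by (simp only: mult_minus_left mult_minus_right mult.assoc mult.left_commute)
  qed
  interpret p: qbase p unfolding p_def by (rule qbase_power) simp
  \<comment> \<open>The third theta argument has exponent \<open>4 * k\<close>, beyond the modulus
    \<open>3 * k + 1\<close>. Reducing it to \<open>k - 1\<close> by quasi-periodicity costs
    \<open>- 1 / Q (int (k - 1))\<close>, which cancels the prefactor in \<open>eq\<close>.\<close>
  have "Q (int k + int (3 * k)) = p * Q (int (k - 1))"
  proof -
    have "int k + int (3 * k) = int (3 * k + 1) + int (k - 1)" using k by auto
    then show ?thesis unfolding p_def by (simp only: Q_add power_int_of_nat)
  qed
  then have th: "p.theta (Q (int k + int (3 * k))) = - p.theta (Q (int (k - 1))) / Q (int (k - 1))"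
    using p.theta_q_mult[of "Q (int (k - 1))"] by simp
  have "((\<lambda>v. - Q (int (k - 1)) * (kappa v * Q (int k * (half_norm v - 1) + int k * (1 - fst v) + int (3 * k) * (1 - fst v - snd v))))
    has_sum - Q (int (k - 1)) * (qpoch_inf p p ^ 2 * p.theta (Q (int k)) * p.theta (Q (int (3 * k)))
      * (- p.theta (Q (int (k - 1))) / Q (int (k - 1))))) UNIV"
    unfolding th[symmetric] unfolding p_def by (intro has_sum_cmult_right macdonald_specialised)
  moreover have "- Q (int (k - 1)) * (qpoch_inf p p ^ 2 * p.theta (Q (int k)) * p.theta (Q (int (3 * k)))
      * (- p.theta (Q (int (k - 1))) / Q (int (k - 1))))
    = qpoch_inf p p ^ 2 * p.theta (Q (int k)) * p.theta (Q (int (3 * k))) * p.theta (Q (int (k - 1)))"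
    by simp
  ultimately show "((\<lambda>v. - kappa v * Q (half_norm v - (4 * fst v + 3 * snd v) + 3) * Q (int (k - 1) * (1 - ((1 - fst v) * (- snd v)
      + (1 - fst v) * (- 3 + fst v + snd v) + (- snd v) * (- 3 + fst v + snd v)))))
     has_sum qpoch_inf p p ^ 2 * p.theta (Q (int k)) * p.theta (Q (int (3 * k))) * p.theta (Q (int (k - 1)))) UNIV"
    unfolding eq by simp
qed simp

end

section \<open>The degenerate base \<open>q = 0\<close>\<close>

lemma qpoch_inf_0: "qpoch_inf 0 p = 1"
  by (simp add: qpoch_inf_def)

lemma inv_qfac_0: "inv_qfac 0 n = (if n < 0 then 0 else 1)"
  by (simp add: inv_qfac_def)

text \<open>At \<open>q = 0\<close> a reciprocal factorial is 1 or 0 according to the sign of its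
  index. A nonzero product therefore forces the vectors to decrease componentwise down to a
  nonnegative last one.\<close>

lemma denom_inv_0:
  assumes k: "k \<ge> 2" and nz: "denom_inv 0 k r \<noteq> 0" and j: "j \<in> {1..k - 1}"
  shows "0 \<le> fst (r j) \<and> 0 \<le> snd (r j)"
proof -
  have last: "0 \<le> fst (r (k - 1)) \<and> 0 \<le> snd (r (k - 1))"
    using nz by (auto simp: denom_inv_def inv_qfac2_def inv_qfac_0 split: if_splits)
  have mono: "fst (r (Suc l)) \<le> fst (r l) \<and> snd (r (Suc l)) \<le> snd (r l)" if "l \<in> {1..k - 2}" for l
  proof -
    have "inv_qfac2 0 (vdiff (r l) (r (l + 1))) \<noteq> 0"
      using nz that by (auto simp: denom_inv_def)
    then show ?thesis by (auto simp: inv_qfac2_def inv_qfac_0 vdiff_def split: if_splits)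
  qed
  have "j \<le> k - 1" using j by simp
  then show ?thesis
  proof (induction rule: inc_induct)
    case base
    show ?case by (rule last)
  next
    case (step l)
    then have "l \<in> {1..k - 2}" using j by auto
    from mono[OF this] show ?case using step.IH by linarith
  qed
qed

lemma halfvCv_pos: "v \<noteq> (0, 0) \<Longrightarrow> halfvCv v > 0"
proof -
  assume "v \<noteq> (0, 0)"
  then have "(fst v)\<^sup>2 + (snd v)\<^sup>2 > 0" by (cases v) (simp add: sum_power2_gt_zero_iff)
  moreover have "2 * halfvCv v = (fst v)\<^sup>2 + (snd v)\<^sup>2 + (fst v - snd v)\<^sup>2"
    by (simp add: halfvCv_def power2_eq_square algebra_simps)
  ultimately show ?thesis using zero_le_power2[of "fst v - snd v"] by linarith
qed

lemma halfvCv_nonneg: "halfvCv v \<ge> 0"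
  using halfvCv_pos[of v] by (cases "v = (0, 0)") (auto simp: halfvCv_def)

text \<open>For \<open>q = 0\<close> only the zero tuple contributes; the main argument divides by \<open>q\<close>.\<close>

lemma has_sum_0_base:
  assumes k: "k \<ge> 2"
    and f: "\<And>r. f r = 0 powi (E r) * c r * denom_inv 0 k r"
    and E: "\<And>r. \<forall>j\<in>{1..k - 1}. 0 \<le> fst (r j) \<and> 0 \<le> snd (r j) \<Longrightarrow> E r \<ge> (\<Sum>j\<in>{1..k - 1}. halfvCv (r j))"
    and E0: "E (\<lambda>_. (0, 0)) = 0" and c: "c (\<lambda>_. (0, 0)) = 1"
  shows "(f has_sum 1) (tuples k)"
proof (rule has_sum_finite_neutralI[of "{\<lambda>_. (0, 0)}"])
  show "{\<lambda>_. (0, 0)} \<subseteq> tuples k" by (simp add: tuples_def)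
  have "denom_inv 0 k (\<lambda>_. (0, 0)) = 1"
    by (simp add: denom_inv_def inv_qfac2_def inv_qfac_0 vdiff_def vabs_def)
  then show "1 = (\<Sum>r\<in>{\<lambda>_. (0, 0)}. f r)" by (simp add: f E0 c)
  fix r assume r: "r \<in> tuples k - {\<lambda>_. (0, 0)}"
  then obtain j where "r j \<noteq> (0, 0)" by (auto simp: fun_eq_iff)
  then have j: "j \<in> {1..k - 1}" "r j \<noteq> (0, 0)" using r by (auto simp: tuples_def)
  show "f r = 0"
  proof (cases "denom_inv 0 k r = 0")
    case False
    then have "E r \<ge> (\<Sum>j\<in>{1..k - 1}. halfvCv (r j))" using denom_inv_0[OF k] by (intro E) auto
    moreover have "(\<Sum>j\<in>{1..k - 1}. halfvCv (r j)) \<ge> halfvCv (r j)"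
      using j halfvCv_nonneg by (intro member_le_sum) auto
    ultimately have "E r > 0" using halfvCv_pos[OF j(2)] by linarith
    then show ?thesis by (simp add: f power_int_0_left_if)
  qed (simp add: f)
qed auto

theorem theorem5p5:
  fixes q :: complex and k :: nat
  assumes "norm q < 1" and "k \<ge> 2"
  shows "(\<forall>i\<in>{1..k}.
            (term1 q k i has_sum
               (qpoch_inf (q^i) (q^(3*k+1)) * qpoch_inf (q^i) (q^(3*k+1))
                * qpoch_inf (q^(2*i)) (q^(3*k+1)) * qpoch_inf (q^(3*k-2*i+1)) (q^(3*k+1))
                * qpoch_inf (q^(3*k-i+1)) (q^(3*k+1)) * qpoch_inf (q^(3*k-i+1)) (q^(3*k+1))
                * qpoch_inf (q^(3*k+1)) (q^(3*k+1)) * qpoch_inf (q^(3*k+1)) (q^(3*k+1))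
                / (qpoch_inf q q)^3)) (tuples k))
       \<and> (\<forall>\<sigma>\<in>{0,1::nat}.
            (term2 q k \<sigma> has_sum
               (qpoch_inf q (q^(3*k+1)) * qpoch_inf (q^(k-\<sigma>)) (q^(3*k+1))
                * qpoch_inf (q^(k+1-\<sigma>)) (q^(3*k+1)) * qpoch_inf (q^(2*k+\<sigma>)) (q^(3*k+1))
                * qpoch_inf (q^(2*k+1+\<sigma>)) (q^(3*k+1)) * qpoch_inf (q^(3*k)) (q^(3*k+1))
                * qpoch_inf (q^(3*k+1)) (q^(3*k+1)) * qpoch_inf (q^(3*k+1)) (q^(3*k+1))
                / (qpoch_inf q q)^3)) (tuples k))"
proof (cases "q = 0")
  case True
  have "(term1 0 k i has_sum 1) (tuples k)" if "i \<in> {1..k}" for i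
  proof (rule has_sum_0_base[OF assms(2)])
    show "term1 0 k i r = 0 powi ((\<Sum>j\<in>{1..k-1}. halfvCv (r j)) + (\<Sum>j\<in>{i..k-1}. vabs (r j)))
      * (if i = 1 then 1 else 1 - 0 powi (vabs (r (i-1)) + 1)) * denom_inv 0 k r" for r
      by (simp add: term1_def)
    show "(\<Sum>j\<in>{1..k - 1}. halfvCv (r j)) + (\<Sum>j\<in>{i..k - 1}. vabs (r j)) \<ge> (\<Sum>j\<in>{1..k - 1}. halfvCv (r j))"
      if "\<forall>j\<in>{1..k - 1}. 0 \<le> fst (r j) \<and> 0 \<le> snd (r j)" for r
      using that \<open>i \<in> {1..k}\<close> by (auto intro!: sum_nonneg simp: vabs_def)
  qed (auto simp: halfvCv_def vabs_def)
  moreover have "(term2 0 k \<sigma> has_sum 1) (tuples k)" for \<sigma>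
  proof (rule has_sum_0_base[OF assms(2), where c = "\<lambda>_. 1"])
    show "term2 0 k \<sigma> r = 0 powi ((\<Sum>j\<in>{1..k-1}. halfvCv (r j) + fst (r j)) + int \<sigma> * snd (r (k-1)))
      * 1 * denom_inv 0 k r" for r
      by (simp add: term2_def)
    show "(\<Sum>j\<in>{1..k-1}. halfvCv (r j) + fst (r j)) + int \<sigma> * snd (r (k-1)) \<ge> (\<Sum>j\<in>{1..k - 1}. halfvCv (r j))"
      if "\<forall>j\<in>{1..k - 1}. 0 \<le> fst (r j) \<and> 0 \<le> snd (r j)" for r
    proof -
      have "k - 1 \<in> {1..k - 1}" using assms(2) by auto
      then have "int \<sigma> * snd (r (k - 1)) \<ge> 0" using that by (intro mult_nonneg_nonneg) auto
      moreover have "(\<Sum>j\<in>{1..k-1}. fst (r j)) \<ge> 0" using that by (intro sum_nonneg) auto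
      ultimately show ?thesis by (simp add: sum.distrib)
    qed
  qed (auto simp: halfvCv_def)
  ultimately show ?thesis using True assms(2) by (auto simp: qpoch_inf_0 power_0_left)
next
  case False
  interpret qbase q using False assms(1) by unfold_locales
  \<comment> \<open>Complementary exponents pair up: the three theta functions supply six of the
    eight products on the right, and the square of \<open>qpoch_inf p p\<close> in base
    \<open>p = q ^ (3 * k + 1)\<close> the other two.\<close>
  have th: "e \<le> 3 * k + 1 \<Longrightarrow> e' = 3 * k + 1 - e \<Longrightarrow> qbase.theta (q ^ (3 * k + 1)) (Q (int e))
      = qpoch_inf (q ^ e) (q ^ (3 * k + 1)) * qpoch_inf (q ^ e') (q ^ (3 * k + 1))" for e e'
    using theta_Q[of e k] by simp
  have 1: "(term1 q k i has_sum
               (qpoch_inf (q^i) (q^(3*k+1)) * qpoch_inf (q^i) (q^(3*k+1))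
                * qpoch_inf (q^(2*i)) (q^(3*k+1)) * qpoch_inf (q^(3*k-2*i+1)) (q^(3*k+1))
                * qpoch_inf (q^(3*k-i+1)) (q^(3*k+1)) * qpoch_inf (q^(3*k-i+1)) (q^(3*k+1))
                * qpoch_inf (q^(3*k+1)) (q^(3*k+1)) * qpoch_inf (q^(3*k+1)) (q^(3*k+1))
                / (qpoch_inf q q)^3)) (tuples k)" if i: "i \<in> {1..k}" for i
  proof -
    have e: "int i + int i = int (2 * i)" by simp
    have t1: "qbase.theta (q ^ (3 * k + 1)) (Q (int i)) = qpoch_inf (q ^ i) (q ^ (3 * k + 1)) * qpoch_inf (q ^ (3*k-i+1)) (q ^ (3 * k + 1))"
      using i by (intro th) auto
    have t2: "qbase.theta (q ^ (3 * k + 1)) (Q (int (2 * i))) = qpoch_inf (q ^ (2 * i)) (q ^ (3 * k + 1)) * qpoch_inf (q ^ (3*k-2*i+1)) (q ^ (3 * k + 1))"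
      using i by (intro th) auto
    show ?thesis
      using term1_has_sum[of k i] assms(2) i unfolding e t1 t2 by (simp add: power2_eq_square mult_ac)
  qed
  have t: "qbase.theta (q ^ (3 * k + 1)) (Q (int (2 * k))) = qpoch_inf (q ^ (2 * k)) (q ^ (3 * k + 1)) * qpoch_inf (q ^ (k + 1)) (q ^ (3 * k + 1))"
    "qbase.theta (q ^ (3 * k + 1)) (Q (int k)) = qpoch_inf (q ^ k) (q ^ (3 * k + 1)) * qpoch_inf (q ^ (2 * k + 1)) (q ^ (3 * k + 1))"
    "qbase.theta (q ^ (3 * k + 1)) (Q (int (3 * k))) = qpoch_inf (q ^ (3 * k)) (q ^ (3 * k + 1)) * qpoch_inf (q ^ 1) (q ^ (3 * k + 1))"
    "qbase.theta (q ^ (3 * k + 1)) (Q (int (k - 1))) = qpoch_inf (q ^ (k - 1)) (q ^ (3 * k + 1)) * qpoch_inf (q ^ (2 * k + 1 + 1)) (q ^ (3 * k + 1))"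
    using assms(2) by (intro th; simp)+
  have s0: "(term2 q k 0 has_sum
               (qpoch_inf q (q^(3*k+1)) * qpoch_inf (q^(k-0)) (q^(3*k+1))
                * qpoch_inf (q^(k+1-0)) (q^(3*k+1)) * qpoch_inf (q^(2*k+0)) (q^(3*k+1))
                * qpoch_inf (q^(2*k+1+0)) (q^(3*k+1)) * qpoch_inf (q^(3*k)) (q^(3*k+1))
                * qpoch_inf (q^(3*k+1)) (q^(3*k+1)) * qpoch_inf (q^(3*k+1)) (q^(3*k+1))
                / (qpoch_inf q q)^3)) (tuples k)"
    using term2_has_sum_0[OF assms(2)] unfolding t by (simp add: power2_eq_square mult_ac)
  have s1: "(term2 q k 1 has_sum
               (qpoch_inf q (q^(3*k+1)) * qpoch_inf (q^(k-1)) (q^(3*k+1))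
                * qpoch_inf (q^(k+1-1)) (q^(3*k+1)) * qpoch_inf (q^(2*k+1)) (q^(3*k+1))
                * qpoch_inf (q^(2*k+1+1)) (q^(3*k+1)) * qpoch_inf (q^(3*k)) (q^(3*k+1))
                * qpoch_inf (q^(3*k+1)) (q^(3*k+1)) * qpoch_inf (q^(3*k+1)) (q^(3*k+1))
                / (qpoch_inf q q)^3)) (tuples k)"
    using term2_has_sum_1[OF assms(2)] unfolding t by (simp add: power2_eq_square mult_ac)
  show ?thesis using 1 s0 s1 by blast
qed

end
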